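(* Let $a\in\mathbb{R}\setminus\{0\}$, $\alpha>-1$, $t_0\in\mathbb{R}$, and let $$W_{a,\alpha}(t)=t^{\alpha}e^{-t}\begin{pmatrix}t^2+a^2(t-1)^2 & a(t-1) \\ a(t-1) & 1\end{pmatrix},\quad t\in(0,+\infty),$$ $$\phi=\phi^{\pm}=\frac{(a^2+1)(t_0+\alpha)-a^2+1\pm\sqrt{(a^2+1)\left(a^2(t_0-\alpha-1)^2+(t_0+\alpha+1)^2\right)}}{2a},$$ where one of the two signs is fixed throughout. Let $D_{a,\alpha,t_0}=\partial^2F_2(t)+\partial^1F_1(t)+\partial^0F_0$ with $$F_2(t)=\begin{pmatrix}at_0 & a^2t_0 \\ -t_0 & -at_0\end{pmatrix}+t\begin{pmatrix}\phi-\frac{1+(\alpha+t_0)(1+a^2)}{a} & -(\alpha+t_0+1)(1+a^2) \\ 0 & \phi+a\end{pmatrix}+t^2\begin{pmatrix}0 & (1+a^2)(1+\alpha) \\ 0 & 0\end{pmatrix},$$ $F_1(t)=G+tH$, where the entries of $G$ and $H$ are $$G_{11}=-a(3t_0-2+(\alpha+1)^2)+(\alpha+3)\left(\phi-\frac{t_0+\alpha+1}{a}\right),$$ $$G_{12}=2a\phi-(1+a^2)(\alpha^2+2t_0+3\alpha)+\alpha t_0(a^2-1)-(t_0+\alpha+3),$$ $$G_{21}=t_0-\alpha-1,\qquad G_{22}=\phi(\alpha+1)-a\alpha t_0,$$ $$H_{11}=-\phi+a(t_0-1)+\frac{t_0+\alpha+1}{a},\qquad H_{12}=(1+a^2)(\alpha^2+3\alpha-t_0\alpha+2)+2(\alpha+1),$$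 $$H_{21}=0,\qquad H_{22}=-\phi+a\alpha,$$ and $F_0=\begin{pmatrix}f & g \\ h & -f\end{pmatrix}$ with $$f=-\frac{\phi}{2}+\frac{a(t_0-1)}{2}+\frac{(\alpha+2)(t_0+\alpha+1)}{2a}-\frac{a(1+\alpha)}{1+a^2},$$ $$g=1+a\alpha\phi-\alpha(t_0-1)(a^2+\alpha+2)+\frac{1+\alpha}{1+a^2},\qquad h=\frac{1+\alpha}{1+a^2}.$$ Let $$M(a,\alpha,t_0)=\begin{pmatrix}\phi^2 & \phi \\ \phi & 1\end{pmatrix}.$$ Then the set $\Upsilon(D_{a,\alpha,t_0})$ of all $2\times2$ weight matrices with respect to which $D_{a,\alpha,t_0}$ is symmetric is $$\Upsilon(D_{a,\alpha,t_0})=\{\gamma W_{a,\alpha}\chi_{(0,+\infty)}+\zeta\,\delta_{t_0}M(a,\alpha,t_0):\ \gamma>0,\ \zeta\ge0\}.$$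
   Context: A weight matrix $W$ is an $N\times N$ matrix of measures supported in the real line such that: $W(\Omega)$ is positive semidefinite for every Borel set $\Omega\subset\mathbb{R}$; for every $n\in\mathbb{N}$ the moment $\mu_n=\int t^n\,dW(t)$ exists and is finite; and $\int P(t)\,dW(t)\,P^*(t)$ is nonsingular whenever $P$ is an $N\times N$ matrix polynomial with nonsingular leading coefficient. Here $P^*(t)$ is the conjugate transpose of $P(t)$; in this statement $N=2$. A density $W(t)$ is identified with the matrix of measures $W(t)\,dt$. An operator $D=\partial^2F_2(t)+\partial^1F_1(t)+\partial^0F_0$, $\partial=\frac{d}{dt}$, acts on the right on matrix polynomials: $PD=P''(t)F_2(t)+P'(t)F_1(t)+P(t)F_0$. It is symmetric with respect to $W$ if $\int(PD)\,dW\,Q^*=\int P\,dW\,(QD)^*$ for all matrix polynomials $P,Q$. We write $\Upsilon(D)$ for the set of all weight matrices with respect to which $D$ is symmetric. $\delta_{t_0}$ is the Dirac measure at $t_0$ and $\chi_{(0,+\infty)}$ is the indicator function of $(0,+\infty)$ (the point $t_0$ may lie inside or outside $(0,+\infty)$). *)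

theory Defs
  imports "HOL-Analysis.Analysis" "HOL-Computational_Algebra.Polynomial"
begin

section \<open>Integration against a complex measure\<close>

text \<open>
  Signed and complex measures on the Borel sets of the real line are plain set functions;
  only their values on Borel sets are ever used.  The integral is defined by the Jordan
  decomposition: the positive variation of a finite signed measure \<open>\<nu>\<close> is
  \<open>\<nu>\<^sup>+ A = sup {\<nu> B | B \<subseteq> A, B Borel}\<close>, and the negative variation
  is the positive variation of \<open>- \<nu>\<close>.  As \<open>\<nu> {} = 0\<close>, truncating the values by
  \<^const>\<open>ennreal\<close> does not change the supremum.
\<close>

definition pos_variation :: "(real set \<Rightarrow> real) \<Rightarrow> real measure" where
  "pos_variation \<nu> =
     measure_of UNIV (sets borel) (\<lambda>A. SUP B\<in>{B \<in> sets borel. B \<subseteq> A}. ennreal (\<nu> B))"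

definition neg_variation :: "(real set \<Rightarrow> real) \<Rightarrow> real measure" where
  "neg_variation \<nu> = pos_variation (\<lambda>A. - \<nu> A)"

definition signed_integrable :: "(real set \<Rightarrow> real) \<Rightarrow> (real \<Rightarrow> complex) \<Rightarrow> bool" where
  "signed_integrable \<nu> f \<longleftrightarrow> integrable (pos_variation \<nu>) f \<and> integrable (neg_variation \<nu>) f"

definition signed_integral :: "(real set \<Rightarrow> real) \<Rightarrow> (real \<Rightarrow> complex) \<Rightarrow> complex" where
  "signed_integral \<nu> f = integral\<^sup>L (pos_variation \<nu>) f - integral\<^sup>L (neg_variation \<nu>) f"

definition cmeas_integrable :: "(real set \<Rightarrow> complex) \<Rightarrow> (real \<Rightarrow> complex) \<Rightarrow> bool" where
  "cmeas_integrable \<nu> f \<longleftrightarrow>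
     signed_integrable (\<lambda>A. Re (\<nu> A)) f \<and> signed_integrable (\<lambda>A. Im (\<nu> A)) f"

definition cmeas_integral :: "(real set \<Rightarrow> complex) \<Rightarrow> (real \<Rightarrow> complex) \<Rightarrow> complex" where
  "cmeas_integral \<nu> f =
     signed_integral (\<lambda>A. Re (\<nu> A)) f + \<i> * signed_integral (\<lambda>A. Im (\<nu> A)) f"


section \<open>Matrices and matrix polynomials\<close>

definition ctranspose :: "complex^'n^'m \<Rightarrow> complex^'m^'n" where
  "ctranspose A = map_matrix cnj (transpose A)"

definition psd :: "complex^'n^'n \<Rightarrow> bool" where
  "psd A \<longleftrightarrow> ctranspose A = A \<and>
     (\<forall>v :: complex^'n. (\<Sum>i\<in>UNIV. \<Sum>j\<in>UNIV. cnj (v $ i) * A $ i $ j * v $ j) \<in> \<real>\<^sub>\<ge>\<^sub>0)"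

text \<open>
  A matrix polynomial is a matrix of complex polynomials, so that \<open>**\<close> is its product.
\<close>

type_synonym 'n matpoly = "complex poly^'n^'n"

definition mp_eval :: "'n::finite matpoly \<Rightarrow> real \<Rightarrow> complex^'n^'n" where
  "mp_eval P t = map_matrix (\<lambda>p. poly p (complex_of_real t)) P"

definition mp_deriv :: "'n::finite matpoly \<Rightarrow> 'n matpoly" where
  "mp_deriv P = map_matrix pderiv P"

definition mp_degree :: "'n::finite matpoly \<Rightarrow> nat" where
  "mp_degree P = Max {degree (P $ i $ j) | i j. True}"

definition mp_lead_coeff :: "'n::finite matpoly \<Rightarrow> complex^'n^'n" where
  "mp_lead_coeff P = map_matrix (\<lambda>p. coeff p (mp_degree P)) P"

text \<open>The matrix polynomial \<open>A\<^sub>0 + t A\<^sub>1 + t\<^sup>2 A\<^sub>2 + \<dots>\<close> with real coefficients \<open>[A\<^sub>0, A\<^sub>1, A\<^sub>2, \<dots>]\<close>.\<close>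

definition mp_of_coeffs :: "(real^'n^'n) list \<Rightarrow> 'n::finite matpoly" where
  "mp_of_coeffs As = (\<chi> i j. Poly (map (\<lambda>A. complex_of_real (A $ i $ j)) As))"


section \<open>Weight matrices\<close>

text \<open>
  Outside the Borel sets a matrix of measures is required to vanish, as for \<^const>\<open>emeasure\<close>;
  this makes equality of set functions coincide with equality of matrices of measures.
\<close>

definition matrix_of_measures :: "(real set \<Rightarrow> complex^'n^'n) \<Rightarrow> bool" where
  "matrix_of_measures W \<longleftrightarrow>
     (\<forall>A. A \<notin> sets borel \<longrightarrow> W A = 0) \<and>
     (\<forall>A :: nat \<Rightarrow> real set. range A \<subseteq> sets borel \<longrightarrow> disjoint_family A \<longrightarrow>
        (\<lambda>n. W (A n)) sums W (\<Union>n. A n))"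

text \<open>The integral of \<open>P dW R\<close> for matrix valued functions \<open>P\<close> and \<open>R\<close>.\<close>

definition mat_integral ::
  "(real \<Rightarrow> complex^'n^'n) \<Rightarrow> (real set \<Rightarrow> complex^'n^'n) \<Rightarrow> (real \<Rightarrow> complex^'n^'n)
    \<Rightarrow> complex^'n^'n" where
  "mat_integral P W R =
     (\<chi> i j. \<Sum>k\<in>UNIV. \<Sum>l\<in>UNIV.
        cmeas_integral (\<lambda>A. W A $ k $ l) (\<lambda>t. P t $ i $ k * R t $ l $ j))"

definition mp_inner ::
  "'n matpoly \<Rightarrow> (real set \<Rightarrow> complex^'n^'n) \<Rightarrow> 'n::finite matpoly \<Rightarrow> complex^'n^'n" where
  "mp_inner P W Q = mat_integral (mp_eval P) W (\<lambda>t. ctranspose (mp_eval Q t))"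

definition weight_matrix :: "(real set \<Rightarrow> complex^'n^'n) \<Rightarrow> bool" where
  "weight_matrix W \<longleftrightarrow>
     matrix_of_measures W \<and>
     (\<forall>A\<in>sets borel. psd (W A)) \<and>
     (\<forall>n i j. cmeas_integrable (\<lambda>A. W A $ i $ j) (\<lambda>t. complex_of_real t ^ n)) \<and>
     (\<forall>P. invertible (mp_lead_coeff P) \<longrightarrow> invertible (mp_inner P W P))"

definition density_mm :: "(real \<Rightarrow> complex^'n^'n) \<Rightarrow> real set \<Rightarrow> complex^'n^'n" where
  "density_mm w A = (if A \<in> sets borel then LINT t:A|lborel. w t else 0)"

definition dirac_mm :: "real \<Rightarrow> complex^'n^'n \<Rightarrow> real set \<Rightarrow> complex^'n^'n" where
  "dirac_mm t\<^sub>0 M A = (if A \<in> sets borel \<and> t\<^sub>0 \<in> A then M else 0)"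


section \<open>Second order differential operators\<close>

definition right_op ::
  "'n matpoly \<Rightarrow> 'n matpoly \<Rightarrow> 'n matpoly \<Rightarrow> 'n matpoly \<Rightarrow> 'n::finite matpoly" where
  "right_op F2 F1 F0 P = mp_deriv (mp_deriv P) ** F2 + mp_deriv P ** F1 + P ** F0"

definition symmetric_wrt ::
  "('n matpoly \<Rightarrow> 'n::finite matpoly) \<Rightarrow> (real set \<Rightarrow> complex^'n^'n) \<Rightarrow> bool" where
  "symmetric_wrt D W \<longleftrightarrow> (\<forall>P Q. mp_inner (D P) W Q = mp_inner P W (D Q))"

definition Upsilon ::
  "('n matpoly \<Rightarrow> 'n::finite matpoly) \<Rightarrow> (real set \<Rightarrow> complex^'n^'n) set" where
  "Upsilon D = {W. weight_matrix W \<and> symmetric_wrt D W}"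


section \<open>The weight, the operator and the mass\<close>

definition mat2 :: "'a::zero \<Rightarrow> 'a \<Rightarrow> 'a \<Rightarrow> 'a \<Rightarrow> 'a^2^2" where
  "mat2 x11 x12 x21 x22 = vector [vector [x11, x12], vector [x21, x22]]"

definition Wd :: "real \<Rightarrow> real \<Rightarrow> real \<Rightarrow> real^2^2" where
  "Wd a \<alpha> t = (t powr \<alpha> * exp (- t)) *\<^sub>R
     mat2 (t^2 + a^2 * (t - 1)^2) (a * (t - 1))
          (a * (t - 1))           1"

text \<open>The parameter \<open>s\<close>, equal to \<open>1\<close> or \<open>-1\<close>, is the choice of sign of the square root.\<close>

definition phi :: "real \<Rightarrow> real \<Rightarrow> real \<Rightarrow> real \<Rightarrow> real" where
  "phi s a \<alpha> t\<^sub>0 =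
     ((a^2 + 1) * (t\<^sub>0 + \<alpha>) - a^2 + 1
       + s * sqrt ((a^2 + 1) * (a^2 * (t\<^sub>0 - \<alpha> - 1)^2 + (t\<^sub>0 + \<alpha> + 1)^2))) / (2 * a)"

definition F2_op :: "real \<Rightarrow> real \<Rightarrow> real \<Rightarrow> real \<Rightarrow> 2 matpoly" where
  "F2_op s a \<alpha> t\<^sub>0 = (let \<phi> = phi s a \<alpha> t\<^sub>0 in mp_of_coeffs
     [mat2 (a * t\<^sub>0) (a^2 * t\<^sub>0)
           (- t\<^sub>0)    (- a * t\<^sub>0),
      mat2 (\<phi> - (1 + (\<alpha> + t\<^sub>0) * (1 + a^2)) / a) (- (\<alpha> + t\<^sub>0 + 1) * (1 + a^2))
           0                                      (\<phi> + a),
      mat2 0 ((1 + a^2) * (1 + \<alpha>))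
           0 0])"

definition F1_op :: "real \<Rightarrow> real \<Rightarrow> real \<Rightarrow> real \<Rightarrow> 2 matpoly" where
  "F1_op s a \<alpha> t\<^sub>0 = (let \<phi> = phi s a \<alpha> t\<^sub>0;
       g11 = - a * (3 * t\<^sub>0 - 2 + (\<alpha> + 1)^2) + (\<alpha> + 3) * (\<phi> - (t\<^sub>0 + \<alpha> + 1) / a);
       g12 = 2 * a * \<phi> - (1 + a^2) * (\<alpha>^2 + 2 * t\<^sub>0 + 3 * \<alpha>)
               + \<alpha> * t\<^sub>0 * (a^2 - 1) - (t\<^sub>0 + \<alpha> + 3);
       g21 = t\<^sub>0 - \<alpha> - 1;
       g22 = \<phi> * (\<alpha> + 1) - a * \<alpha> * t\<^sub>0;
       h11 = - \<phi> + a * (t\<^sub>0 - 1) + (t\<^sub>0 + \<alpha> + 1) / a;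
       h12 = (1 + a^2) * (\<alpha>^2 + 3 * \<alpha> - t\<^sub>0 * \<alpha> + 2) + 2 * (\<alpha> + 1);
       h22 = - \<phi> + a * \<alpha>
     in mp_of_coeffs [mat2 g11 g12 g21 g22, mat2 h11 h12 0 h22])"

definition F0_op :: "real \<Rightarrow> real \<Rightarrow> real \<Rightarrow> real \<Rightarrow> 2 matpoly" where
  "F0_op s a \<alpha> t\<^sub>0 = (let \<phi> = phi s a \<alpha> t\<^sub>0;
       f = - \<phi> / 2 + a * (t\<^sub>0 - 1) / 2 + (\<alpha> + 2) * (t\<^sub>0 + \<alpha> + 1) / (2 * a)
             - a * (1 + \<alpha>) / (1 + a^2);
       g = 1 + a * \<alpha> * \<phi> - \<alpha> * (t\<^sub>0 - 1) * (a^2 + \<alpha> + 2) + (1 + \<alpha>) / (1 + a^2);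
       h = (1 + \<alpha>) / (1 + a^2)
     in mp_of_coeffs [mat2 f g h (- f)])"

definition D_op :: "real \<Rightarrow> real \<Rightarrow> real \<Rightarrow> real \<Rightarrow> 2 matpoly \<Rightarrow> 2 matpoly" where
  "D_op s a \<alpha> t\<^sub>0 = right_op (F2_op s a \<alpha> t\<^sub>0) (F1_op s a \<alpha> t\<^sub>0) (F0_op s a \<alpha> t\<^sub>0)"

definition M_mass :: "real \<Rightarrow> real \<Rightarrow> real \<Rightarrow> real \<Rightarrow> real^2^2" where
  "M_mass s a \<alpha> t\<^sub>0 = (let \<phi> = phi s a \<alpha> t\<^sub>0 in mat2 (\<phi>^2) \<phi> \<phi> 1)"

end

theory Submission
  imports Defs "HOL-Probability.Probability"
begin

text \<open>
  Write \<open>W = t\<^sup>\<alpha> e\<^sup>-\<^sup>t T diag(t\<^sup>2, 1) T\<^sup>*\<close>, where \<open>T\<close> has the rows \<open>(1, a (t - 1))\<close> and \<open>(0, 1)\<close>.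
  Conjugation by the unipotent matrix \<open>T\<close> replaces matrix polynomials \<open>P\<close> by \<open>P T\<close> and turns \<open>D\<close> into
  an operator whose leading coefficient has the rows \<open>(\<kappa> t, - t\<^sub>0 t\<^sup>2)\<close> and \<open>(- t\<^sub>0, \<psi> t)\<close> with
  \<open>\<psi> = \<phi> - a (t\<^sub>0 - 1)\<close>.  The defining equation of \<open>\<phi>\<close> becomes \<open>\<kappa> \<psi> = t\<^sub>0\<^sup>2\<close>
  (lemma \<open>kappa_psi\<close>), so this matrix is singular, and at \<open>t\<^sub>0\<close> it annihilates the vector \<open>(\<psi>, 1)\<close>
  that spans the conjugated mass.

  Symmetry of \<open>D\<close> depends only on the moments, that is, on the four functionals that the entries of a
  weight matrix define on polynomials.  It is equivalent to the moment equations, which say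
  \<open>F\<^sub>2 W = W F\<^sub>2\<^sup>*\<close>, \<open>2 (F\<^sub>2 W)' = F\<^sub>1 W + W F\<^sub>1\<^sup>*\<close> and
  \<open>(F\<^sub>2 W)'' - (F\<^sub>1 W)' + F\<^sub>0 W = W F\<^sub>0\<^sup>*\<close> in the weak sense (lemma \<open>intertwine_iff\<close>).  For \<open>t\<^sub>0 \<noteq> 0\<close>
  they force \<open>(t - t\<^sub>0) Y = 0\<close> for the off-diagonal entry \<open>Y\<close> after conjugation, so that \<open>Y\<close> is a
  multiple of \<open>\<delta>\<close> at \<open>t\<^sub>0\<close>.  Once the corresponding point mass is subtracted, the entry \<open>(2, 2)\<close>
  satisfies the Pearson equation of the Laguerre weight, which determines its moments up to a factor.
  If \<open>t\<^sub>0 = 0\<close>, then \<open>\<kappa> = 0\<close> or \<open>\<psi> = 0\<close>, and other moment equations lead to the same end.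
  Hence the moments form a two-parameter family (lemma \<open>symmetric_form_unique\<close>).

  The moments determine the weight matrix, because the Laguerre weight and a point mass have exponential
  moments and the Taylor expansion of the characteristic function can be continued along the line (lemma
  \<open>moment_measure_determinacy\<close>).  The integral of \<open>(t - t\<^sub>0)\<^sup>2\<close>, which does not see the point mass,
  gives \<open>\<gamma> \<ge> 0\<close>, and \<open>\<gamma> = 0\<close> is excluded because a point mass alone is degenerate.  If \<open>\<zeta>\<close> were negative, then adding \<open>|\<zeta>| \<delta> M\<close> to the weight matrix would give
  a matrix with the moments of a density and yet with a mass at \<open>t\<^sub>0\<close>.
\<close>

section \<open>Integration against a difference of finite measures\<close>

lemma integrable_simple_borel:
  fixes s :: "real \<Rightarrow> complex"
  assumes "finite_measure M" "sets M = sets borel" "simple_function borel s"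
  shows "integrable M s"
    and "integral\<^sup>L M s = (\<Sum>y\<in>range s. measure M (s -` {y}) *\<^sub>R y)"
proof -
  interpret finite_measure M by fact
  have fin: "finite (range s)" and meas: "s -` {y} \<in> sets borel" for y
  proof -
    show "finite (range s)"
      using assms(3) by (simp add: simple_function_def)
    show "s -` {y} \<in> sets borel"
      using assms(3) simple_functionD(2)[of borel s "{y}"] by simp
  qed
  have meas': "s -` {y} \<in> sets M" for y
    using meas assms(2) by simp
  have sp: "space M = UNIV"
    using sets_eq_imp_space_eq[OF assms(2)] by simp
  have eq: "s = (\<lambda>x. \<Sum>y\<in>range s. indicator (s -` {y}) x *\<^sub>R y)"
  proof
    fix x
    have "(\<Sum>y\<in>range s. indicator (s -` {y}) x *\<^sub>R y) = (\<Sum>y\<in>range s. if y = s x then y else 0)"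
      by (intro sum.cong) (auto simp: indicator_def)
    also have "\<dots> = s x"
      using fin by (simp add: sum.delta)
    finally show "s x = (\<Sum>y\<in>range s. indicator (s -` {y}) x *\<^sub>R y)" ..
  qed
  have int: "integrable M (\<lambda>x. indicator (s -` {y}) x *\<^sub>R y)" for y
    using meas' by (intro integrable_scaleR_left) (simp add: emeasure_finite less_top[symmetric])
  show "integrable M s"
    by (subst eq) (intro Bochner_Integration.integrable_sum int)
  have "integral\<^sup>L M s = (\<Sum>y\<in>range s. integral\<^sup>L M (\<lambda>x. indicator (s -` {y}) x *\<^sub>R y))"
    by (subst eq) (intro Bochner_Integration.integral_sum int)
  also have "\<dots> = (\<Sum>y\<in>range s. measure M (s -` {y}) *\<^sub>R y)"
  proof (intro sum.cong refl)
    fix y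
    have "integrable M (indicator (s -` {y}) :: real \<Rightarrow> real)"
      using meas' by (simp add: emeasure_finite less_top[symmetric])
    then show "integral\<^sup>L M (\<lambda>x. indicator (s -` {y}) x *\<^sub>R y) = measure M (s -` {y}) *\<^sub>R y"
      using meas' by (simp add: integral_scaleR_left sp)
  qed
  finally show "integral\<^sup>L M s = (\<Sum>y\<in>range s. measure M (s -` {y}) *\<^sub>R y)" .
qed

text \<open>
  A linear relation between finite measures, with complex coefficients, is inherited by the integrals.  This holds for
  simple functions, and dominated convergence extends it to integrable functions.
\<close>

lemma linear_relation_integral:
  fixes f :: "real \<Rightarrow> complex" and c :: "'i \<Rightarrow> complex" and M :: "'i \<Rightarrow> real measure"
  assumes fin: "\<And>i. i \<in> I \<Longrightarrow> finite_measure (M i)"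
    and sets: "\<And>i. i \<in> I \<Longrightarrow> sets (M i) = sets borel"
    and f: "f \<in> borel_measurable borel" "\<And>i. i \<in> I \<Longrightarrow> integrable (M i) f"
    and rel: "\<And>A. A \<in> sets borel \<Longrightarrow> (\<Sum>i\<in>I. c i * of_real (measure (M i) A)) = 0"
  shows "(\<Sum>i\<in>I. c i * integral\<^sup>L (M i) f) = 0"
proof -
  obtain s where s: "\<And>n. simple_function borel (s n)" "\<And>x. (\<lambda>n. s n x) \<longlonglongrightarrow> f x"
    "\<And>n x. dist (s n x) 0 \<le> 2 * dist (f x) 0"
    using borel_measurable_implies_sequence_metric[OF f(1), of 0] unfolding space_borel by blast
  have zero: "(\<Sum>i\<in>I. c i * integral\<^sup>L (M i) (s n)) = 0" for n
  proof -
    have "(\<Sum>i\<in>I. c i * integral\<^sup>L (M i) (s n))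
        = (\<Sum>i\<in>I. \<Sum>y\<in>range (s n). c i * (of_real (measure (M i) (s n -` {y})) * y))"
      by (intro sum.cong refl, subst integrable_simple_borel(2)[OF fin sets s(1)])
        (simp_all add: sum_distrib_left scaleR_conv_of_real)
    also have "\<dots> = (\<Sum>y\<in>range (s n). (\<Sum>i\<in>I. c i * of_real (measure (M i) (s n -` {y}))) * y)"
      by (subst sum.swap) (simp add: sum_distrib_right mult.assoc)
    also have "\<dots> = 0"
    proof (intro sum.neutral ballI)
      fix y
      have "s n -` {y} \<in> sets borel"
        using s(1)[of n] simple_functionD(2)[of borel "s n" "{y}"] by simp
      then show "(\<Sum>i\<in>I. c i * of_real (measure (M i) (s n -` {y}))) * y = 0"
        using rel by simp
    qed
    finally show ?thesis .
  qed
  have "(\<lambda>n. integral\<^sup>L (M i) (s n)) \<longlonglongrightarrow> integral\<^sup>L (M i) f" if "i \<in> I" for i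
  proof (rule integral_dominated_convergence[where w = "\<lambda>x. 2 * norm (f x)"])
    have cong: "borel_measurable (M i) = (borel_measurable borel :: (real \<Rightarrow> complex) set)"
      using sets[OF that] by (intro measurable_cong_sets) auto
    show "f \<in> borel_measurable (M i)" "\<And>n. s n \<in> borel_measurable (M i)"
      using f(1) borel_measurable_simple_function[OF s(1)] by (auto simp: cong)
    show "integrable (M i) (\<lambda>x. 2 * norm (f x))"
      using f(2)[OF that] by auto
  qed (use s(2,3) in auto)
  then have "(\<lambda>n. \<Sum>i\<in>I. c i * integral\<^sup>L (M i) (s n)) \<longlonglongrightarrow> (\<Sum>i\<in>I. c i * integral\<^sup>L (M i) f)"
    by (intro tendsto_intros)
  then have "(\<lambda>n. 0) \<longlonglongrightarrow> (\<Sum>i\<in>I. c i * integral\<^sup>L (M i) f)"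
    by (simp only: zero)
  then show ?thesis
    by (simp add: LIMSEQ_const_iff)
qed

lemma nn_integral_le_sum_measure:
  assumes sets: "sets M = sets borel" "sets M1 = sets borel" "sets M2 = sets borel"
    and le: "\<And>A. A \<in> sets borel \<Longrightarrow> emeasure M A \<le> C * (emeasure M1 A + emeasure M2 A)"
  shows "integral\<^sup>N M f \<le> C * (integral\<^sup>N M1 f + integral\<^sup>N M2 f)"
  unfolding nn_integral_def[of M]
proof (safe intro!: SUP_least)
  fix g assume g: "simple_function M g" "g \<le> f"
  have sp: "space M = UNIV" "space M1 = UNIV" "space M2 = UNIV"
    using sets[THEN sets_eq_imp_space_eq] by simp_all
  have g': "simple_function M1 g" "simple_function M2 g"
    using g(1) unfolding simple_function_def sets sp by auto
  have meas: "g -` {y} \<in> sets borel" for y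
    using simple_functionD(2)[OF g(1), of "{y}"] unfolding sets sp by simp
  have "integral\<^sup>S M g = (\<Sum>y\<in>range g. y * emeasure M (g -` {y}))"
    by (simp add: simple_integral_def sp)
  also have "\<dots> \<le> (\<Sum>y\<in>range g. y * (C * (emeasure M1 (g -` {y}) + emeasure M2 (g -` {y}))))"
    by (intro sum_mono mult_left_mono le meas) auto
  also have "\<dots> = C * (integral\<^sup>S M1 g + integral\<^sup>S M2 g)"
    by (simp add: simple_integral_def sp sum_distrib_left sum.distrib distrib_left mult_ac)
  also have "\<dots> \<le> C * (integral\<^sup>N M1 f + integral\<^sup>N M2 f)"
  proof (intro mult_left_mono add_mono)
    show "integral\<^sup>S M1 g \<le> integral\<^sup>N M1 f" "integral\<^sup>S M2 g \<le> integral\<^sup>N M2 f"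
      using g' g(2) unfolding nn_integral_def by (auto intro: SUP_upper)
  qed auto
  finally show "integral\<^sup>S M g \<le> C * (integral\<^sup>N M1 f + integral\<^sup>N M2 f)" .
qed

lemma integrable_le_sum_measure:
  fixes f :: "real \<Rightarrow> 'b::{banach, second_countable_topology}"
  assumes sets: "sets M = sets borel" "sets M1 = sets borel" "sets M2 = sets borel"
    and le: "\<And>A. A \<in> sets borel \<Longrightarrow> emeasure M A \<le> ennreal C * (emeasure M1 A + emeasure M2 A)"
    and int: "integrable M1 f" "integrable M2 f"
  shows "integrable M f"
proof (rule integrableI_bounded)
  show "f \<in> borel_measurable M"
    using borel_measurable_integrable[OF int(1)] measurable_cong_sets[of M M1 borel borel]
    unfolding sets by blast
  have "(\<integral>\<^sup>+ x. ennreal (norm (f x)) \<partial>M)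
      \<le> ennreal C * ((\<integral>\<^sup>+ x. ennreal (norm (f x)) \<partial>M1) + (\<integral>\<^sup>+ x. ennreal (norm (f x)) \<partial>M2))"
    using sets le by (rule nn_integral_le_sum_measure)
  also have "\<dots> < \<infinity>"
    using int by (simp add: integrable_iff_bounded ennreal_mult_less_top)
  finally show "(\<integral>\<^sup>+ x. ennreal (norm (f x)) \<partial>M) < \<infinity>" .
qed

text \<open>
  The set \<open>Y\<close> of a Hahn decomposition attains the supremum that defines the positive variation.
\<close>

lemma pos_variation_hahn:
  assumes fin: "finite_measure M1" "finite_measure M2"
    and sets: "sets M1 = sets borel" "sets M2 = sets borel"
    and nu: "\<And>A. A \<in> sets borel \<Longrightarrow> \<nu> A = measure M1 A - measure M2 A"
    and Y: "Y \<in> sets borel"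
      "\<And>X. X \<in> sets borel \<Longrightarrow> X \<subseteq> Y \<Longrightarrow> measure M2 X \<le> measure M1 X"
      "\<And>X. X \<in> sets borel \<Longrightarrow> X \<inter> Y = {} \<Longrightarrow> measure M1 X \<le> measure M2 X"
  shows "sets (pos_variation \<nu>) = sets borel"
    and "finite_measure (pos_variation \<nu>)"
    and "\<And>A. A \<in> sets borel \<Longrightarrow> measure (pos_variation \<nu>) A = \<nu> (A \<inter> Y)"
proof -
  interpret M1: finite_measure M1 by fact
  interpret M2: finite_measure M2 by fact
  define N1 where "N1 = density M1 (indicator Y)"
  define N2 where "N2 = density M2 (indicator Y)"
  have em: "emeasure N1 A = ennreal (measure M1 (A \<inter> Y))" "emeasure N2 A = ennreal (measure M2 (A \<inter> Y))"
    if "A \<in> sets borel" for A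
  proof -
    have "emeasure (density M (indicator Y)) A = ennreal (measure M (A \<inter> Y))"
      if "finite_measure M" "sets M = sets borel" for M
      using that \<open>A \<in> sets borel\<close> Y(1)
      by (simp add: emeasure_restricted finite_measure.emeasure_eq_measure Int_commute)
    with fin sets show "emeasure N1 A = ennreal (measure M1 (A \<inter> Y))" "emeasure N2 A = ennreal (measure M2 (A \<inter> Y))"
      by (simp_all add: N1_def N2_def)
  qed
  have fin': "finite_measure N1" "finite_measure N2"
  proof -
    have "space N1 = UNIV" "space N2 = UNIV"
      using sets_eq_imp_space_eq[OF sets(1)] sets_eq_imp_space_eq[OF sets(2)]
      by (simp_all add: N1_def N2_def)
    then show "finite_measure N1" "finite_measure N2"
      by (auto intro!: finite_measureI simp: em)
  qed
  have sets': "sets N1 = sets borel" "sets N2 = sets borel"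
    by (simp_all add: N1_def N2_def sets)
  have sup: "(SUP B\<in>{B \<in> sets borel. B \<subseteq> A}. ennreal (\<nu> B)) = emeasure N1 A - emeasure N2 A"
    if A: "A \<in> sets borel" for A
  proof -
    have "(SUP B\<in>{B \<in> sets borel. B \<subseteq> A}. ennreal (\<nu> B)) = ennreal (\<nu> (A \<inter> Y))"
    proof (rule antisym)
      show "(SUP B\<in>{B \<in> sets borel. B \<subseteq> A}. ennreal (\<nu> B)) \<le> ennreal (\<nu> (A \<inter> Y))"
      proof (safe intro!: SUP_least ennreal_leI)
        fix B assume B: "B \<in> sets borel" "B \<subseteq> A"
        \<comment> \<open>Removing the part of \<open>B\<close> outside \<open>Y\<close> and filling up inside \<open>Y\<close> both increase \<open>\<nu>\<close>.\<close>
        have split: "measure M X = measure M (X \<inter> Y) + measure M (X - Y)"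
          if "finite_measure M" "sets M = sets borel" "X \<in> sets borel" for M X
          using that Y(1) finite_measure.finite_measure_Union[OF that(1), of "X \<inter> Y" "X - Y"]
          by (simp add: Int_Diff_Un Int_Diff_disjoint)
        have union: "measure M (A \<inter> Y) = measure M (B \<inter> Y) + measure M (A \<inter> Y - B)"
          if "finite_measure M" "sets M = sets borel" for M
        proof -
          have "A \<inter> Y = (B \<inter> Y) \<union> (A \<inter> Y - B)" and "(B \<inter> Y) \<inter> (A \<inter> Y - B) = {}"
            using B by auto
          then show ?thesis
            using that Y(1) A B finite_measure.finite_measure_Union[OF that(1), of "B \<inter> Y" "A \<inter> Y - B"]
            by simp
        qed
        show "\<nu> B \<le> \<nu> (A \<inter> Y)"
        proof -
          have "measure M2 (A \<inter> Y - B) \<le> measure M1 (A \<inter> Y - B)"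
            using A B Y(1) by (intro Y(2)) auto
          moreover have "measure M1 (B - Y) \<le> measure M2 (B - Y)"
            using B Y(1) by (intro Y(3)) auto
          moreover have "\<nu> B = measure M1 B - measure M2 B"
            "\<nu> (A \<inter> Y) = measure M1 (A \<inter> Y) - measure M2 (A \<inter> Y)"
            using A B Y(1) by (auto intro!: nu)
          ultimately show ?thesis
            using split[OF fin(1) sets(1) B(1)] split[OF fin(2) sets(2) B(1)]
              union[OF fin(1) sets(1)] union[OF fin(2) sets(2)] by linarith
        qed
      qed
      show "ennreal (\<nu> (A \<inter> Y)) \<le> (SUP B\<in>{B \<in> sets borel. B \<subseteq> A}. ennreal (\<nu> B))"
        using A Y(1) by (intro SUP_upper) auto
    qed
    also have "\<dots> = emeasure N1 A - emeasure N2 A"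
      using A Y(1) by (simp add: em nu ennreal_minus)
    finally show ?thesis .
  qed
  have eq: "pos_variation \<nu> = diff_measure N1 N2"
  proof -
    have sp: "space N1 = UNIV"
      using sets_eq_imp_space_eq[OF sets'(1)] by simp
    show ?thesis
      unfolding pos_variation_def diff_measure_def sp sets'
    proof (rule measure_of_eq)
      fix A :: "real set"
      assume "A \<in> sigma_sets UNIV (sets borel)"
      then have "A \<in> sets borel"
        using sets.sigma_sets_eq[of "borel :: real measure"] by (simp only: space_borel)
      then show "(SUP B\<in>{B \<in> sets borel. B \<subseteq> A}. ennreal (\<nu> B)) = emeasure N1 A - emeasure N2 A"
        by (rule sup)
    qed simp
  qed
  have em': "emeasure (pos_variation \<nu>) A = ennreal (\<nu> (A \<inter> Y))" if "A \<in> sets borel" for A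
  proof -
    have "emeasure (diff_measure N1 N2) A = emeasure N1 A - emeasure N2 A"
      using that Y by (intro emeasure_diff_measure fin') (auto simp: sets' em)
    then show ?thesis
      using that Y(1) by (simp add: eq em nu ennreal_minus)
  qed
  have nonneg: "0 \<le> \<nu> (A \<inter> Y)" if "A \<in> sets borel" for A
    using that Y by (simp add: nu)
  show s: "sets (pos_variation \<nu>) = sets borel"
    by (simp add: eq sets')
  show "finite_measure (pos_variation \<nu>)"
    using em'[of UNIV] sets_eq_imp_space_eq[OF s] by (intro finite_measureI) auto
  show "measure (pos_variation \<nu>) A = \<nu> (A \<inter> Y)" if "A \<in> sets borel" for A
    using em'[OF that] nonneg[OF that] by (simp add: measure_def)
qed

lemma pos_neg_variation:
  assumes fin: "finite_measure M1" "finite_measure M2"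
    and sets: "sets M1 = sets borel" "sets M2 = sets borel"
    and nu: "\<And>A. A \<in> sets borel \<Longrightarrow> \<nu> A = measure M1 A - measure M2 A"
  obtains Y where "Y \<in> sets borel"
    "sets (pos_variation \<nu>) = sets borel" "finite_measure (pos_variation \<nu>)"
    "sets (neg_variation \<nu>) = sets borel" "finite_measure (neg_variation \<nu>)"
    "\<And>A. A \<in> sets borel \<Longrightarrow> measure (pos_variation \<nu>) A = \<nu> (A \<inter> Y)"
    "\<And>A. A \<in> sets borel \<Longrightarrow> measure (neg_variation \<nu>) A = - \<nu> (A - Y)"
proof -
  interpret M1: finite_measure M1 by fact
  interpret M2: finite_measure M2 by fact
  have "sets M2 = sets M1"
    by (simp only: sets)
  from finite_unsigned_Hahn_decomposition[OF fin this] obtain Y where "Y \<in> sets M1"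
    and Y': "\<forall>X\<in>sets M1. X \<subseteq> Y \<longrightarrow> emeasure M2 X \<le> emeasure M1 X"
      "\<forall>X\<in>sets M1. X \<inter> Y = {} \<longrightarrow> emeasure M1 X \<le> emeasure M2 X"
    by (elim bexE conjE)
  then have Y: "Y \<in> sets borel"
    by (simp only: sets)
  have "measure M2 X \<le> measure M1 X" if "X \<in> sets borel" "X \<subseteq> Y" for X
    using Y'(1) that unfolding sets by (simp add: M1.emeasure_eq_measure M2.emeasure_eq_measure)
  moreover have "measure M1 X \<le> measure M2 X" if "X \<in> sets borel" "X \<inter> Y = {}" for X
    using Y'(2) that unfolding sets by (simp add: M1.emeasure_eq_measure M2.emeasure_eq_measure)
  ultimately have Y': "\<And>X. X \<in> sets borel \<Longrightarrow> X \<subseteq> Y \<Longrightarrow> measure M2 X \<le> measure M1 X"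
      "\<And>X. X \<in> sets borel \<Longrightarrow> X \<inter> Y = {} \<Longrightarrow> measure M1 X \<le> measure M2 X"
    by simp_all
  note pos = pos_variation_hahn[OF fin sets nu Y Y']
  have c: "- Y \<in> sets borel"
      "\<And>A. A \<in> sets borel \<Longrightarrow> - \<nu> A = measure M2 A - measure M1 A"
      "\<And>X. X \<in> sets borel \<Longrightarrow> X \<subseteq> - Y \<Longrightarrow> measure M1 X \<le> measure M2 X"
      "\<And>X. X \<in> sets borel \<Longrightarrow> X \<inter> - Y = {} \<Longrightarrow> measure M2 X \<le> measure M1 X"
  proof -
    show "- \<nu> A = measure M2 A - measure M1 A" if "A \<in> sets borel" for A
      using nu[OF that] by simp
    show "measure M1 X \<le> measure M2 X" if "X \<in> sets borel" "X \<subseteq> - Y" for X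
      using that by (intro Y'(2)) auto
    show "measure M2 X \<le> measure M1 X" if "X \<in> sets borel" "X \<inter> - Y = {}" for X
      using that by (intro Y'(1)) auto
  qed (use Y in auto)
  note neg = pos_variation_hahn[OF fin(2,1) sets(2,1) c(2,1,3,4), folded neg_variation_def]
  show thesis
  proof (rule that[OF Y pos(1,2) neg(1,2) pos(3)])
    show "measure (neg_variation \<nu>) A = - \<nu> (A - Y)" if "A \<in> sets borel" for A
      unfolding Diff_eq by (rule neg(3)) (use that in simp_all)
  qed
qed

text \<open>
  The integral against a signed measure may be computed from any representation as a difference
  of finite measures, not only from the Jordan decomposition.
\<close>

lemma signed_integral_diff:
  assumes fin: "finite_measure M1" "finite_measure M2"
    and sets: "sets M1 = sets borel" "sets M2 = sets borel"
    and nu: "\<And>A. A \<in> sets borel \<Longrightarrow> \<nu> A = measure M1 A - measure M2 A"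
    and f: "integrable M1 f" "integrable M2 f"
  shows "signed_integrable \<nu> f"
    and "signed_integral \<nu> f = integral\<^sup>L M1 f - integral\<^sup>L M2 f"
proof -
  interpret M1: finite_measure M1 by fact
  interpret M2: finite_measure M2 by fact
  obtain Y where Y: "Y \<in> sets borel"
    "sets (pos_variation \<nu>) = sets borel" "finite_measure (pos_variation \<nu>)"
    "sets (neg_variation \<nu>) = sets borel" "finite_measure (neg_variation \<nu>)"
    "\<And>A. A \<in> sets borel \<Longrightarrow> measure (pos_variation \<nu>) A = \<nu> (A \<inter> Y)"
    "\<And>A. A \<in> sets borel \<Longrightarrow> measure (neg_variation \<nu>) A = - \<nu> (A - Y)"
    using pos_neg_variation[OF fin sets nu] by blast
  interpret P: finite_measure "pos_variation \<nu>" by fact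
  interpret N: finite_measure "neg_variation \<nu>" by fact
  have le: "emeasure (pos_variation \<nu>) A \<le> ennreal 1 * (emeasure M1 A + emeasure M2 A)"
      "emeasure (neg_variation \<nu>) A \<le> ennreal 1 * (emeasure M1 A + emeasure M2 A)"
    if A: "A \<in> sets borel" for A
  proof -
    have "measure M1 (A \<inter> Y) \<le> measure M1 A" "measure M2 (A - Y) \<le> measure M2 A"
      using A Y(1) by (auto intro!: M1.finite_measure_mono M2.finite_measure_mono simp: sets)
    then have "\<nu> (A \<inter> Y) \<le> measure M1 A + measure M2 A" "- \<nu> (A - Y) \<le> measure M1 A + measure M2 A"
      using nu[of "A \<inter> Y"] nu[of "A - Y"] A Y(1) measure_nonneg[of M2 "A \<inter> Y"]
        measure_nonneg[of M1 "A - Y"] measure_nonneg[of M1 A] measure_nonneg[of M2 A]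
      by (smt (verit) sets.Int sets.Diff)+
    then show "emeasure (pos_variation \<nu>) A \<le> ennreal 1 * (emeasure M1 A + emeasure M2 A)"
      "emeasure (neg_variation \<nu>) A \<le> ennreal 1 * (emeasure M1 A + emeasure M2 A)"
      unfolding P.emeasure_eq_measure N.emeasure_eq_measure M1.emeasure_eq_measure
        M2.emeasure_eq_measure Y(6)[OF A] Y(7)[OF A]
      by (auto simp flip: ennreal_plus intro!: ennreal_leI)
  qed
  have int: "integrable (pos_variation \<nu>) f" "integrable (neg_variation \<nu>) f"
    using integrable_le_sum_measure[OF Y(2) sets le(1) f] integrable_le_sum_measure[OF Y(4) sets le(2) f]
    by auto
  then show "signed_integrable \<nu> f"
    by (simp add: signed_integrable_def)
  have fm: "f \<in> borel_measurable borel"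
    using borel_measurable_integrable[OF f(1)] measurable_cong_sets[OF sets(1) refl, of borel] by blast
  have rel: "complex_of_real (measure (pos_variation \<nu>) A) - measure (neg_variation \<nu>) A
      - measure M1 A + measure M2 A = 0" if A: "A \<in> sets borel" for A
  proof -
    have "measure M A = measure M (A \<inter> Y) + measure M (A - Y)"
      if "finite_measure M" "sets M = sets borel" for M
      using that A Y(1) finite_measure.finite_measure_Union[OF that(1), of "A \<inter> Y" "A - Y"]
      by (simp add: Int_Diff_Un Int_Diff_disjoint)
    moreover have "\<nu> (A \<inter> Y) = measure M1 (A \<inter> Y) - measure M2 (A \<inter> Y)"
      "\<nu> (A - Y) = measure M1 (A - Y) - measure M2 (A - Y)"
      using A Y(1) by (auto intro!: nu)
    ultimately have "measure (pos_variation \<nu>) A - measure (neg_variation \<nu>) A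
        - measure M1 A + measure M2 A = 0"
      using fin sets Y(6,7)[OF A] by (smt (verit))
    then show ?thesis
      by (metis of_real_0 of_real_add of_real_diff)
  qed
  let ?I = "{0, 1, 2, 3 :: nat}"
  let ?M = "(!) [pos_variation \<nu>, neg_variation \<nu>, M1, M2]"
  let ?c = "(!) [1, -1, -1, 1 :: complex]"
  have "(\<Sum>i\<in>?I. ?c i * integral\<^sup>L (?M i) f) = 0"
  proof (rule linear_relation_integral)
    fix A :: "real set"
    assume "A \<in> sets borel"
    then show "(\<Sum>i\<in>?I. ?c i * of_real (measure (?M i) A)) = 0"
      using rel[of A] by (simp add: numeral_2_eq_2 numeral_3_eq_3 algebra_simps)
  next
    fix i
    assume "i \<in> ?I"
    then consider "?M i = pos_variation \<nu>" | "?M i = neg_variation \<nu>" | "?M i = M1" | "?M i = M2"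
      by (auto simp: numeral_2_eq_2 numeral_3_eq_3)
    note cases = this
    show "finite_measure (?M i)"
      by (rule cases) (simp_all only: Y(3,5) fin)
    show "sets (?M i) = sets borel"
      by (rule cases) (simp_all only: Y(2,4) sets)
    show "integrable (?M i) f"
      by (rule cases) (simp_all only: int f)
  qed (rule fm)
  then show "signed_integral \<nu> f = integral\<^sup>L M1 f - integral\<^sup>L M2 f"
    by (simp add: signed_integral_def numeral_2_eq_2 numeral_3_eq_3 algebra_simps)
qed

text \<open>Integrability against a positive measure, viewed as a signed one, has its usual meaning.\<close>

lemma signed_integrable_measure:
  assumes fin: "finite_measure M" and sets: "sets M = sets borel"
    and nu: "\<And>A. A \<in> sets borel \<Longrightarrow> \<nu> A = measure M A"
    and f: "signed_integrable \<nu> f"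
  shows "integrable M f"
proof -
  interpret M: finite_measure M by fact
  have null: "finite_measure (null_measure borel)"
    by (auto intro!: finite_measureI)
  have "pos_variation \<nu> = M"
  proof (rule measure_eqI)
    note pos = pos_variation_hahn[OF fin null sets, of \<nu> UNIV]
    show "sets (pos_variation \<nu>) = sets M"
      using pos(1) sets by (simp add: nu)
    interpret P: finite_measure "pos_variation \<nu>"
      using pos(2) by (simp add: nu)
    show "emeasure (pos_variation \<nu>) A = emeasure M A" if "A \<in> sets (pos_variation \<nu>)" for A
    proof -
      have "A \<in> sets borel"
        using that pos(1) by (simp add: nu)
      then have "measure (pos_variation \<nu>) A = measure M A"
        using pos(3)[of A] by (simp add: nu)
      then show ?thesis
        by (simp add: P.emeasure_eq_measure M.emeasure_eq_measure)
    qed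
  qed
  then show ?thesis
    using f by (simp add: signed_integrable_def)
qed

section \<open>Positive semidefinite matrices of measures\<close>

text \<open>The value at \<open>v\<close> of the Hermitian form of a complex \<open>2 \<times> 2\<close> matrix.\<close>

definition qform :: "complex^2^2 \<Rightarrow> complex^2 \<Rightarrow> complex" where
  "qform A v = (\<Sum>i\<in>UNIV. \<Sum>j\<in>UNIV. cnj (v $ i) * A $ i $ j * v $ j)"

text \<open>A positive semidefinite matrix of measures; these are weight matrices without the conditions on
  moments and nondegeneracy.\<close>

definition psd_measure :: "(real set \<Rightarrow> complex^2^2) \<Rightarrow> bool" where
  "psd_measure W \<longleftrightarrow> matrix_of_measures W \<and> (\<forall>A\<in>sets borel. psd (W A))"

text \<open>The positive scalar measure \<open>v\<^sup>* W v\<close>.\<close>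

definition qmeasure :: "(real set \<Rightarrow> complex^2^2) \<Rightarrow> complex^2 \<Rightarrow> real measure" where
  "qmeasure W v = measure_of UNIV (sets borel) (\<lambda>A. ennreal (Re (qform (W A) v)))"

lemma qform_expand:
  "qform A v = cnj (v $ 1) * A $ 1 $ 1 * v $ 1 + cnj (v $ 1) * A $ 1 $ 2 * v $ 2
    + cnj (v $ 2) * A $ 2 $ 1 * v $ 1 + cnj (v $ 2) * A $ 2 $ 2 * v $ 2"
  by (simp add: qform_def sum_2)

lemma psd_qform: "psd A \<Longrightarrow> 0 \<le> Re (qform A v) \<and> Im (qform A v) = 0"
  by (auto simp: psd_def qform_def complex_nonneg_Reals_iff)

lemma psd_hermitian: "psd A \<Longrightarrow> A $ j $ i = cnj (A $ i $ j)"
  by (auto simp: psd_def ctranspose_def map_matrix_def transpose_def vec_eq_iff)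

lemma bounded_linear_qform: "bounded_linear (\<lambda>A. qform A v)"
  unfolding qform_def
  by (intro bounded_linear_sum bounded_linear_mult_const bounded_linear_const_mult
      bounded_linear_compose[OF bounded_linear_vec_nth] bounded_linear_vec_nth)

lemma sets_qmeasure [simp]: "sets (qmeasure W v) = sets borel"
  unfolding qmeasure_def using sets.sigma_sets_eq[of "borel :: real measure"] by simp

lemma emeasure_qmeasure:
  assumes "psd_measure W" "A \<in> sets borel"
  shows "emeasure (qmeasure W v) A = ennreal (Re (qform (W A) v))"
  unfolding qmeasure_def
proof (rule emeasure_measure_of_sigma)
  show "sigma_algebra UNIV (sets (borel :: real measure))"
    by (metis sets.sigma_algebra_axioms space_borel)
  have "W {} = 0"
  proof -
    have "(\<lambda>n. W {}) sums W (\<Union>n::nat. {})"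
      using assms(1) by (auto simp: psd_measure_def matrix_of_measures_def disjoint_family_on_def)
    then have "(\<lambda>n. W {}) \<longlonglongrightarrow> 0"
      by (intro summable_LIMSEQ_zero) (auto simp: sums_iff)
    then show ?thesis
      by (simp add: LIMSEQ_const_iff)
  qed
  then show "positive (sets borel) (\<lambda>A. ennreal (Re (qform (W A) v)))"
    by (simp add: positive_def qform_expand)
  show "countably_additive (sets borel) (\<lambda>A. ennreal (Re (qform (W A) v)))"
  proof (rule countably_additiveI)
    fix B :: "nat \<Rightarrow> real set"
    assume B: "range B \<subseteq> sets borel" "disjoint_family B"
    then have "(\<lambda>n. W (B n)) sums W (\<Union>n. B n)"
      using assms(1) by (auto simp: psd_measure_def matrix_of_measures_def)
    then have "(\<lambda>n. Re (qform (W (B n)) v)) sums Re (qform (W (\<Union>n. B n)) v)"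
      by (intro bounded_linear.sums[OF bounded_linear_Re] bounded_linear.sums[OF bounded_linear_qform])
    moreover have "0 \<le> Re (qform (W (B n)) v)" for n
      using assms(1) B(1) psd_qform by (auto simp: psd_measure_def)
    ultimately show "(\<Sum>n. ennreal (Re (qform (W (B n)) v))) = ennreal (Re (qform (W (\<Union>n. B n)) v))"
      by (intro suminf_ennreal_eq) auto
  qed
qed (use assms in auto)

lemma finite_qmeasure:
  assumes "psd_measure W"
  shows "finite_measure (qmeasure W v)"
  using emeasure_qmeasure[OF assms, of UNIV v]
  by (intro finite_measureI) (simp add: sets_eq_imp_space_eq[OF sets_qmeasure])

lemma measure_qmeasure:
  assumes "psd_measure W" "A \<in> sets borel"
  shows "measure (qmeasure W v) A = Re (qform (W A) v)"
  using emeasure_qmeasure[OF assms, of v] psd_qform[of "W A" v] assms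
  by (auto simp: measure_def psd_measure_def)

lemma qform_eq_measure:
  assumes "psd_measure W" "A \<in> sets borel"
  shows "qform (W A) v = of_real (measure (qmeasure W v) A)"
  using measure_qmeasure[OF assms, of v] psd_qform[of "W A" v] assms
  by (auto simp: psd_measure_def complex_eq_iff)

text \<open>
  Polarization: the real part of the entry \<open>(k, l)\<close> of a Hermitian matrix is the difference of
  the form at \<open>\<onehalf>(e\<^sub>k + c e\<^sub>l)\<close> for \<open>c = 1\<close> and \<open>c = -1\<close>, the imaginary part is that for
  \<open>c = -\<i>\<close> and \<open>c = \<i>\<close>.
\<close>

definition pvec :: "2 \<Rightarrow> 2 \<Rightarrow> complex \<Rightarrow> complex^2" where
  "pvec k l c = (\<chi> m. ((if m = k then 1 else 0) + (if m = l then c else 0)) / 2)"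

lemma polarization:
  assumes "psd A"
  shows "Re (A $ k $ l) = Re (qform A (pvec k l 1)) - Re (qform A (pvec k l (- 1)))"
    and "Im (A $ k $ l) = Re (qform A (pvec k l (- \<i>))) - Re (qform A (pvec k l \<i>))"
proof -
  have h: "Im (A $ 1 $ 1) = 0" "Im (A $ 2 $ 2) = 0" "Re (A $ 2 $ 1) = Re (A $ 1 $ 2)"
      "Im (A $ 2 $ 1) = - Im (A $ 1 $ 2)"
    using psd_hermitian[OF assms, of 1 1] psd_hermitian[OF assms, of 2 2] psd_hermitian[OF assms, of 2 1]
    by (simp_all add: complex_eq_iff)
  consider "k = 1" "l = 1" | "k = 1" "l = 2" | "k = 2" "l = 1" | "k = 2" "l = 2"
    using exhaust_2 by metis
  then show "Re (A $ k $ l) = Re (qform A (pvec k l 1)) - Re (qform A (pvec k l (- 1)))"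
    by cases (simp_all add: h qform_expand pvec_def field_simps)
  consider "k = 1" "l = 1" | "k = 1" "l = 2" | "k = 2" "l = 1" | "k = 2" "l = 2"
    using exhaust_2 by metis
  then show "Im (A $ k $ l) = Re (qform A (pvec k l (- \<i>))) - Re (qform A (pvec k l \<i>))"
    by cases (simp_all add: h qform_expand pvec_def field_simps)
qed

lemma psd_eqI:
  assumes "psd A" "psd B" "\<And>v. qform A v = qform B v"
  shows "A = B"
  using polarization[OF assms(1)] polarization[OF assms(2)] assms(3)
  by (simp add: vec_eq_iff complex_eq_iff)

text \<open>Integrability against the diagonal entries of \<open>W\<close> suffices.\<close>

lemma integrable_qmeasure:
  fixes f :: "real \<Rightarrow> 'b::{banach, second_countable_topology}"
  assumes W: "psd_measure W"
    and int: "\<And>k. integrable (qmeasure W (axis k 1)) f"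
  shows "integrable (qmeasure W v) f"
proof (rule integrable_le_sum_measure[OF sets_qmeasure sets_qmeasure sets_qmeasure _ int[of 1] int[of 2]])
  fix A :: "real set"
  assume A: "A \<in> sets borel"
  let ?C = "2 * max ((cmod (v $ 1))\<^sup>2) ((cmod (v $ 2))\<^sup>2)"
  have psd: "psd (W A)"
    using W A by (auto simp: psd_measure_def)
  \<comment> \<open>The parallelogram law bounds the form at \<open>v\<close> by its diagonal part.\<close>
  define v' :: "complex^2" where "v' = vector [v $ 1, - v $ 2]"
  have ax: "qform (W A) (axis 1 1) = W A $ 1 $ 1" "qform (W A) (axis 2 1) = W A $ 2 $ 2"
    by (simp_all add: qform_expand axis_def)
  have nonneg: "0 \<le> Re (W A $ 1 $ 1)" "0 \<le> Re (W A $ 2 $ 2)"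
    using psd_qform[OF psd, of "axis 1 1"] psd_qform[OF psd, of "axis 2 1"] ax by simp_all
  have "qform (W A) v + qform (W A) v'
      = 2 * (of_real ((cmod (v $ 1))\<^sup>2) * W A $ 1 $ 1 + of_real ((cmod (v $ 2))\<^sup>2) * W A $ 2 $ 2)"
    by (simp add: qform_expand v'_def algebra_simps complex_norm_square del: of_real_power)
  then have "Re (qform (W A) v) + Re (qform (W A) v')
      = 2 * ((cmod (v $ 1))\<^sup>2 * Re (W A $ 1 $ 1) + (cmod (v $ 2))\<^sup>2 * Re (W A $ 2 $ 2))"
    by (simp add: complex_eq_iff del: of_real_power)
  moreover have "(cmod (v $ 1))\<^sup>2 * Re (W A $ 1 $ 1) \<le> max ((cmod (v $ 1))\<^sup>2) ((cmod (v $ 2))\<^sup>2) * Re (W A $ 1 $ 1)"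
    "(cmod (v $ 2))\<^sup>2 * Re (W A $ 2 $ 2) \<le> max ((cmod (v $ 1))\<^sup>2) ((cmod (v $ 2))\<^sup>2) * Re (W A $ 2 $ 2)"
    using nonneg by (auto intro!: mult_right_mono)
  ultimately have "Re (qform (W A) v) \<le> ?C * (Re (W A $ 1 $ 1) + Re (W A $ 2 $ 2))"
    using psd_qform[OF psd, of v'] by (simp add: algebra_simps)
  then have "ennreal (Re (qform (W A) v)) \<le> ennreal (?C * (Re (W A $ 1 $ 1) + Re (W A $ 2 $ 2)))"
    by (rule ennreal_leI)
  also have "\<dots> = ennreal ?C * (ennreal (Re (W A $ 1 $ 1)) + ennreal (Re (W A $ 2 $ 2)))"
    using nonneg by (subst ennreal_mult) (auto simp: le_max_iff_disj)
  finally show "emeasure (qmeasure W v) A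
      \<le> ennreal ?C * (emeasure (qmeasure W (axis 1 1)) A + emeasure (qmeasure W (axis 2 1)) A)"
    using A W by (simp add: emeasure_qmeasure ax)
qed

lemma cmeas_integral_qmeasure:
  assumes W: "psd_measure W"
    and int: "\<And>v. integrable (qmeasure W v) f"
  shows "cmeas_integrable (\<lambda>A. W A $ k $ l) f"
    and "cmeas_integral (\<lambda>A. W A $ k $ l) f =
      (integral\<^sup>L (qmeasure W (pvec k l 1)) f - integral\<^sup>L (qmeasure W (pvec k l (- 1))) f)
      + \<i> * (integral\<^sup>L (qmeasure W (pvec k l (- \<i>))) f - integral\<^sup>L (qmeasure W (pvec k l \<i>)) f)"
proof -
  have nu: "Re (W A $ k $ l) = measure (qmeasure W (pvec k l 1)) A - measure (qmeasure W (pvec k l (- 1))) A"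
      "Im (W A $ k $ l) = measure (qmeasure W (pvec k l (- \<i>))) A - measure (qmeasure W (pvec k l \<i>)) A"
    if "A \<in> sets borel" for A
    using that W polarization[of "W A" k l] by (simp_all add: measure_qmeasure psd_measure_def)
  note re = signed_integral_diff[OF finite_qmeasure[OF W] finite_qmeasure[OF W] sets_qmeasure
      sets_qmeasure nu(1) int int]
  note im = signed_integral_diff[OF finite_qmeasure[OF W] finite_qmeasure[OF W] sets_qmeasure
      sets_qmeasure nu(2) int int]
  show "cmeas_integrable (\<lambda>A. W A $ k $ l) f"
    using re(1) im(1) by (simp add: cmeas_integrable_def)
  show "cmeas_integral (\<lambda>A. W A $ k $ l) f =
      (integral\<^sup>L (qmeasure W (pvec k l 1)) f - integral\<^sup>L (qmeasure W (pvec k l (- 1))) f)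
      + \<i> * (integral\<^sup>L (qmeasure W (pvec k l (- \<i>))) f - integral\<^sup>L (qmeasure W (pvec k l \<i>)) f)"
    using re(2) im(2) by (simp add: cmeas_integral_def)
qed

lemma measurable_integrable_qmeasure:
  fixes f :: "real \<Rightarrow> complex"
  assumes "integrable (qmeasure W v) f"
  shows "f \<in> borel_measurable borel"
  using borel_measurable_integrable[OF assms] measurable_cong_sets[OF sets_qmeasure refl, of W v borel]
  by blast

text \<open>
  Conversely, the integrals against \<open>v\<^sup>* W v\<close> are recovered from those against the entries of \<open>W\<close>,
  because the measures \<open>v\<^sup>* W v\<close> and those of the polarization formula are linearly related.
\<close>

lemma integral_qmeasure:
  assumes W: "psd_measure W"
    and int: "\<And>v. integrable (qmeasure W v) f"
  shows "integral\<^sup>L (qmeasure W v) f =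
    (\<Sum>k\<in>UNIV. \<Sum>l\<in>UNIV. cnj (v $ k) * cmeas_integral (\<lambda>A. W A $ k $ l) f * v $ l)"
proof -
  define I where "I = insert None (Some ` ((UNIV :: 2 set) \<times> (UNIV :: 2 set) \<times> {1, - 1, \<i>, - \<i>}))"
  define w where "w = (\<lambda>i :: (2 \<times> 2 \<times> complex) option.
    case i of None \<Rightarrow> v | Some (k, l, c) \<Rightarrow> pvec k l c)"
  define d where "d = (\<lambda>i :: (2 \<times> 2 \<times> complex) option.
    case i of None \<Rightarrow> - 1 | Some (k, l, c) \<Rightarrow> cnj (v $ k) * v $ l * cnj c)"
  have sum: "(\<Sum>i\<in>I. d i * g (w i)) = (\<Sum>k\<in>UNIV. \<Sum>l\<in>UNIV. cnj (v $ k) *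
      ((g (pvec k l 1) - g (pvec k l (- 1))) + \<i> * (g (pvec k l (- \<i>)) - g (pvec k l \<i>))) * v $ l) - g v"
    for g :: "complex^2 \<Rightarrow> complex"
  proof -
    have "(\<Sum>i\<in>I. d i * g (w i)) = - g v + (\<Sum>(k, l, c)\<in>UNIV \<times> UNIV \<times> {1, - 1, \<i>, - \<i>}.
        cnj (v $ k) * v $ l * cnj c * g (pvec k l c))"
      by (simp add: I_def d_def w_def sum.reindex case_prod_unfold)
    also have "\<dots> = - g v + (\<Sum>k\<in>UNIV. \<Sum>l\<in>UNIV. \<Sum>c\<in>{1, - 1, \<i>, - \<i>}.
        cnj (v $ k) * v $ l * cnj c * g (pvec k l c))"
      by (simp only: sum.cartesian_product case_prod_unfold fst_conv snd_conv)
    finally show ?thesis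
      by (simp add: complex_eq_iff[of 1] complex_eq_iff[of "- 1"] complex_eq_iff[of \<i>] algebra_simps sum_2)
  qed
  have "(\<Sum>i\<in>I. d i * integral\<^sup>L (qmeasure W (w i)) f) = 0"
  proof (rule linear_relation_integral)
    fix A :: "real set"
    assume A: "A \<in> sets borel"
    have psd: "psd (W A)"
      using W A by (auto simp: psd_measure_def)
    have m: "complex_of_real (measure (qmeasure W u) A) = of_real (Re (qform (W A) u))" for u
      using measure_qmeasure[OF W A] by simp
    have entry: "W A $ k $ l = (of_real (Re (qform (W A) (pvec k l 1))) - of_real (Re (qform (W A) (pvec k l (- 1)))))
      + \<i> * (of_real (Re (qform (W A) (pvec k l (- \<i>)))) - of_real (Re (qform (W A) (pvec k l \<i>))))" for k l
      using polarization[OF psd, of k l] by (simp add: complex_eq_iff)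
    have "of_real (Re (qform (W A) v)) = qform (W A) v"
      using psd_qform[OF psd, of v] by (simp add: complex_eq_iff)
    then show "(\<Sum>i\<in>I. d i * of_real (measure (qmeasure W (w i)) A)) = 0"
      unfolding m sum[of "\<lambda>u. of_real (Re (qform (W A) u))"] entry[symmetric]
      by (simp add: qform_def)
  qed (use W int measurable_integrable_qmeasure finite_qmeasure in auto)
  then show ?thesis
    unfolding sum[of "\<lambda>u. integral\<^sup>L (qmeasure W u) f"] cmeas_integral_qmeasure(2)[OF W int]
    by simp
qed

text \<open>
  Matrices of measures all of whose moments are finite, and the functionals \<open>p \<mapsto> \<integral> p dW\<^sub>k\<^sub>l\<close> on
  polynomials that these moments define.
\<close>

definition moment_measure :: "(real set \<Rightarrow> complex^2^2) \<Rightarrow> bool" where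
  "moment_measure W \<longleftrightarrow> psd_measure W \<and>
     (\<forall>v n. integrable (qmeasure W v) (\<lambda>t. complex_of_real t ^ n))"

definition moment_fun :: "(real set \<Rightarrow> complex^2^2) \<Rightarrow> 2 \<Rightarrow> 2 \<Rightarrow> complex poly \<Rightarrow> complex" where
  "moment_fun W k l p = cmeas_integral (\<lambda>A. W A $ k $ l) (\<lambda>t. poly p (of_real t))"

lemma weight_matrix_moment_measure:
  assumes "weight_matrix W"
  shows "moment_measure W"
proof -
  have W: "psd_measure W"
    using assms by (simp add: weight_matrix_def psd_measure_def)
  have "integrable (qmeasure W (axis k 1)) (\<lambda>t. complex_of_real t ^ n)" for k n
  proof (rule signed_integrable_measure[OF finite_qmeasure[OF W] sets_qmeasure])
    have "k = 1 \<or> k = 2"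
      by (rule exhaust_2)
    then have "qform B (axis k 1) = B $ k $ k" for B
      by (elim disjE) (simp_all add: qform_expand axis_def)
    then show "Re (W A $ k $ k) = measure (qmeasure W (axis k 1)) A" if "A \<in> sets borel" for A
      using measure_qmeasure[OF W that] by simp
    show "signed_integrable (\<lambda>A. Re (W A $ k $ k)) (\<lambda>t. complex_of_real t ^ n)"
      using assms by (simp add: weight_matrix_def cmeas_integrable_def)
  qed
  then have "integrable (qmeasure W v) (\<lambda>t. complex_of_real t ^ n)" for v n
    by (rule integrable_qmeasure[OF W])
  then show ?thesis
    using W by (simp add: moment_measure_def)
qed

lemma integrable_poly_qmeasure:
  fixes p :: "complex poly"
  assumes "moment_measure W"
  shows "integrable (qmeasure W v) (\<lambda>t. poly p (of_real t))"
  unfolding poly_altdef using assms unfolding moment_measure_def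
  by (intro Bochner_Integration.integrable_sum integrable_mult_right) blast

lemma moment_fun_eq:
  assumes "moment_measure W"
  shows "moment_fun W k l p =
      (integral\<^sup>L (qmeasure W (pvec k l 1)) (\<lambda>t. poly p (of_real t))
        - integral\<^sup>L (qmeasure W (pvec k l (- 1))) (\<lambda>t. poly p (of_real t)))
      + \<i> * (integral\<^sup>L (qmeasure W (pvec k l (- \<i>))) (\<lambda>t. poly p (of_real t))
        - integral\<^sup>L (qmeasure W (pvec k l \<i>)) (\<lambda>t. poly p (of_real t)))"
  unfolding moment_fun_def
  by (rule cmeas_integral_qmeasure) (use assms integrable_poly_qmeasure in \<open>auto simp: moment_measure_def\<close>)

text \<open>Complex linear functionals on polynomials, without any continuity.\<close>

definition linear_functional :: "(complex poly \<Rightarrow> complex) \<Rightarrow> bool" where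
  "linear_functional L \<longleftrightarrow> (\<forall>p q. L (p + q) = L p + L q) \<and> (\<forall>c p. L (smult c p) = c * L p)"

lemma linear_functional_moment_fun:
  assumes "moment_measure W"
  shows "linear_functional (moment_fun W k l)"
  unfolding linear_functional_def moment_fun_eq[OF assms]
  by (simp add: integrable_poly_qmeasure[OF assms] algebra_simps)

lemma integral_poly_qmeasure:
  assumes "moment_measure W"
  shows "integral\<^sup>L (qmeasure W v) (\<lambda>t. poly p (of_real t)) =
    (\<Sum>k\<in>UNIV. \<Sum>l\<in>UNIV. cnj (v $ k) * moment_fun W k l p * v $ l)"
  unfolding moment_fun_def
  by (rule integral_qmeasure) (use assms integrable_poly_qmeasure in \<open>auto simp: moment_measure_def\<close>)

lemma mp_inner_moment_fun:
  "mp_inner P W Q $ i $ j =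
    (\<Sum>k\<in>UNIV. \<Sum>l\<in>UNIV. moment_fun W k l (P $ i $ k * map_poly cnj (Q $ j $ l)))"
  by (simp add: mp_inner_def mat_integral_def moment_fun_def mp_eval_def map_matrix_def
      ctranspose_def transpose_def)

lemma psd_measure_combination:
  assumes W': "psd_measure W1" "psd_measure W2" and c: "0 \<le> c" "0 \<le> d"
  defines "W \<equiv> \<lambda>A. c *\<^sub>R W1 A + d *\<^sub>R W2 A"
  shows "psd_measure W"
    and "\<And>A. A \<in> sets borel \<Longrightarrow>
      measure (qmeasure W v) A = c * measure (qmeasure W1 v) A + d * measure (qmeasure W2 v) A"
proof -
  have q: "qform (W A) v = c * qform (W1 A) v + d * qform (W2 A) v" for A v
    unfolding W_def qform_expand vector_add_component vector_scaleR_component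
    by (simp add: scaleR_conv_of_real algebra_simps)
  show psd: "psd_measure W"
    unfolding psd_measure_def
  proof
    show "matrix_of_measures W"
      using W' unfolding matrix_of_measures_def psd_measure_def W_def
      by (auto intro!: sums_add sums_scaleR_right)
    show "\<forall>A\<in>sets borel. psd (W A)"
    proof
      fix A :: "real set"
      assume A: "A \<in> sets borel"
      have p: "psd (W1 A)" "psd (W2 A)"
        using W' A by (auto simp: psd_measure_def)
      have "ctranspose (W A) = W A"
        by (simp add: ctranspose_def transpose_def map_matrix_def W_def vec_eq_iff
            flip: psd_hermitian[OF p(1)] psd_hermitian[OF p(2)])
      moreover have "qform (W A) v \<in> \<real>\<^sub>\<ge>\<^sub>0" for v
        using psd_qform[OF p(1), of v] psd_qform[OF p(2), of v] c
        unfolding q complex_nonneg_Reals_iff by simp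
      ultimately show "psd (W A)"
        by (simp add: psd_def qform_def)
    qed
  qed
  show "measure (qmeasure W v) A = c * measure (qmeasure W1 v) A + d * measure (qmeasure W2 v) A"
    if "A \<in> sets borel" for A
    using that psd W' by (simp add: measure_qmeasure q)
qed

lemma integrable_qmeasure_combination:
  fixes f :: "real \<Rightarrow> 'b::{banach, second_countable_topology}"
  assumes W': "psd_measure W1" "psd_measure W2" and c: "0 \<le> c" "0 \<le> d"
    and int: "integrable (qmeasure W1 v) f" "integrable (qmeasure W2 v) f"
  shows "integrable (qmeasure (\<lambda>A. c *\<^sub>R W1 A + d *\<^sub>R W2 A) v) f"
proof -
  define W where "W = (\<lambda>A. c *\<^sub>R W1 A + d *\<^sub>R W2 A)"
  note psd = psd_measure_combination(1)[OF W' c, folded W_def]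
  note m = psd_measure_combination(2)[OF W' c, folded W_def]
  have "integrable (qmeasure W v) f"
  proof (rule integrable_le_sum_measure[OF sets_qmeasure sets_qmeasure sets_qmeasure _ int, where C = "max c d"])
    fix A :: "real set"
    assume A: "A \<in> sets borel"
    interpret Q: finite_measure "qmeasure W v" by (rule finite_qmeasure[OF psd])
    interpret Q1: finite_measure "qmeasure W1 v" by (rule finite_qmeasure[OF W'(1)])
    interpret Q2: finite_measure "qmeasure W2 v" by (rule finite_qmeasure[OF W'(2)])
    have "measure (qmeasure W v) A \<le> max c d * (measure (qmeasure W1 v) A + measure (qmeasure W2 v) A)"
      using m[OF A] c by (simp add: distrib_left add_mono mult_right_mono)
    then have "ennreal (measure (qmeasure W v) A)
        \<le> ennreal (max c d * (measure (qmeasure W1 v) A + measure (qmeasure W2 v) A))"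
      by (rule ennreal_leI)
    also have "\<dots> = ennreal (max c d) * (ennreal (measure (qmeasure W1 v) A) + ennreal (measure (qmeasure W2 v) A))"
      using c by (subst ennreal_mult) (auto simp: le_max_iff_disj)
    finally show "emeasure (qmeasure W v) A
        \<le> ennreal (max c d) * (emeasure (qmeasure W1 v) A + emeasure (qmeasure W2 v) A)"
      by (simp only: Q.emeasure_eq_measure Q1.emeasure_eq_measure Q2.emeasure_eq_measure)
  qed
  then show ?thesis
    by (simp only: W_def)
qed

lemma moment_measure_combination:
  assumes W: "moment_measure W1" "moment_measure W2" and c: "0 \<le> c" "0 \<le> d"
  defines "W \<equiv> \<lambda>A. c *\<^sub>R W1 A + d *\<^sub>R W2 A"
  shows "moment_measure W"
    and "moment_fun W k l p = c * moment_fun W1 k l p + d * moment_fun W2 k l p"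
proof -
  have W': "psd_measure W1" "psd_measure W2"
    using W by (simp_all add: moment_measure_def)
  note psd = psd_measure_combination(1)[OF W' c, folded W_def]
  note m = psd_measure_combination(2)[OF W' c, folded W_def]
  note int = integrable_qmeasure_combination[OF W' c, folded W_def]
  show mm: "moment_measure W"
    using psd W by (auto simp: moment_measure_def intro: int)
  have "integral\<^sup>L (qmeasure W v) f = c * integral\<^sup>L (qmeasure W1 v) f + d * integral\<^sup>L (qmeasure W2 v) f"
    if "f = (\<lambda>t. poly p (of_real t))" for v and f :: "real \<Rightarrow> complex"
  proof -
    have ints: "integrable (qmeasure W v) f" "integrable (qmeasure W1 v) f" "integrable (qmeasure W2 v) f"
      using integrable_poly_qmeasure W mm that by auto
    let ?I = "{0, 1, 2 :: nat}"
    let ?M = "(!) [qmeasure W v, qmeasure W1 v, qmeasure W2 v]"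
    let ?c = "(!) [-1, of_real c, of_real d :: complex]"
    have cases: "?M i = qmeasure W v \<or> ?M i = qmeasure W1 v \<or> ?M i = qmeasure W2 v" if "i \<in> ?I" for i
      using that by (auto simp: numeral_2_eq_2)
    have "(\<Sum>i\<in>?I. ?c i * integral\<^sup>L (?M i) f) = 0"
    proof (rule linear_relation_integral)
      fix A :: "real set"
      assume "A \<in> sets borel"
      then show "(\<Sum>i\<in>?I. ?c i * of_real (measure (?M i) A)) = 0"
        by (simp add: numeral_2_eq_2 m)
    next
      fix i
      assume "i \<in> ?I"
      note * = cases[OF this]
      show "finite_measure (?M i)"
        using * finite_qmeasure[OF psd] finite_qmeasure[OF W'(1)] finite_qmeasure[OF W'(2)] by metis
      show "sets (?M i) = sets borel"
        using * sets_qmeasure by metis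
      show "integrable (?M i) f"
        using * ints by metis
    qed (rule measurable_integrable_qmeasure[OF ints(1)])
    then show ?thesis
      by (simp add: numeral_2_eq_2 algebra_simps)
  qed
  then show "moment_fun W k l p = c * moment_fun W1 k l p + d * moment_fun W2 k l p"
    by (simp add: moment_fun_eq mm W algebra_simps)
qed

section \<open>Determinacy of the moment problem under an exponential moment\<close>

lemma power_le_exp:
  fixes x e :: real
  assumes "0 < e" "0 \<le> x"
  shows "x ^ n \<le> fact n / e ^ n * exp (e * x)"
proof -
  have "(e * x) ^ n /\<^sub>R fact n \<le> (\<Sum>k. (e * x) ^ k /\<^sub>R fact k)"
    using assms sum_le_suminf[OF summable_exp_generic[of "e * x"], of "{n}"] by simp
  then have "(e * x) ^ n / fact n \<le> exp (e * x)"
    by (simp add: exp_def divide_inverse mult.commute)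
  then show ?thesis
    using assms by (simp add: field_simps power_mult_distrib)
qed

text \<open>Up to the factor \<open>\<i>\<^sup>n\<close>, the \<open>n\<close>-th derivative of the characteristic function of \<open>M\<close>.\<close>

definition exp_moment :: "real measure \<Rightarrow> nat \<Rightarrow> real \<Rightarrow> complex" where
  "exp_moment M n t = (\<integral>x. of_real (x ^ n) * iexp (t * x) \<partial>M)"

text \<open>
  Under an exponential moment the functions \<open>t \<mapsto> \<integral> x\<^sup>n e\<^sup>i\<^sup>t\<^sup>x dM(x)\<close> have Taylor expansions about
  every point, with a radius of convergence bounded below.
\<close>

lemma exp_moment_taylor:
  fixes M :: "real measure"
  assumes fin: "finite_measure M" and sets: "sets M = sets borel"
    and e: "0 < e" and int: "integrable M (\<lambda>x. exp (e * \<bar>x\<bar>))" and h: "\<bar>h\<bar> \<le> e / 2"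
  shows "(\<lambda>k. (\<i> * of_real h) ^ k / fact k * exp_moment M (n + k) t) sums exp_moment M n (t + h)"
proof -
  interpret finite_measure M by fact
  have measc: "f \<in> borel_measurable M \<longleftrightarrow> f \<in> borel_measurable borel" for f :: "real \<Rightarrow> complex"
    using measurable_cong_sets[OF sets refl, of borel] by blast
  have measr: "f \<in> borel_measurable M \<longleftrightarrow> f \<in> borel_measurable borel" for f :: "real \<Rightarrow> real"
    using measurable_cong_sets[OF sets refl, of borel] by blast
  define f where "f k x = (\<i> * of_real h) ^ k / fact k * (of_real (x ^ (n + k)) * iexp (t * x))" for k x
  have norm_f: "norm (f k x) = \<bar>x\<bar> ^ n * ((\<bar>h\<bar> * \<bar>x\<bar>) ^ k / fact k)" for k x
    by (simp add: f_def norm_mult norm_power norm_divide power_add power_mult_distrib power_abs)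
  have sums_norm: "(\<lambda>k. norm (f k x)) sums (\<bar>x\<bar> ^ n * exp (\<bar>h\<bar> * \<bar>x\<bar>))" for x
    unfolding norm_f using exp_converges[of "\<bar>h\<bar> * \<bar>x\<bar>"]
    by (intro sums_mult) (simp add: divide_inverse mult.commute)
  have bound: "\<bar>x\<bar> ^ n * exp (\<bar>h\<bar> * \<bar>x\<bar>) \<le> fact n / (e / 2) ^ n * exp (e * \<bar>x\<bar>)" for x
  proof -
    have "\<bar>x\<bar> ^ n * exp (\<bar>h\<bar> * \<bar>x\<bar>) \<le> (fact n / (e / 2) ^ n * exp (e / 2 * \<bar>x\<bar>)) * exp (e / 2 * \<bar>x\<bar>)"
      using e mult_right_mono[OF h abs_ge_zero[of x]] by (intro mult_mono power_le_exp) auto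
    also have "\<dots> = fact n / (e / 2) ^ n * exp (e * \<bar>x\<bar>)"
      by (simp add: mult.assoc flip: exp_add)
    finally show ?thesis .
  qed
  have int_dom: "integrable M (\<lambda>x. \<bar>x\<bar> ^ n * exp (\<bar>h\<bar> * \<bar>x\<bar>))"
  proof (rule Bochner_Integration.integrable_bound)
    show "integrable M (\<lambda>x. fact n / (e / 2) ^ n * exp (e * \<bar>x\<bar>))"
      using int by simp
    show "(\<lambda>x. \<bar>x\<bar> ^ n * exp (\<bar>h\<bar> * \<bar>x\<bar>)) \<in> borel_measurable M"
      unfolding measr by measurable
    show "AE x in M. norm (\<bar>x\<bar> ^ n * exp (\<bar>h\<bar> * \<bar>x\<bar>)) \<le> norm (fact n / (e / 2) ^ n * exp (e * \<bar>x\<bar>))"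
      using bound e by (intro AE_I2) (simp add: abs_mult power_abs)
  qed
  have le_dom: "(\<Sum>k<m. norm (f k x)) \<le> \<bar>x\<bar> ^ n * exp (\<bar>h\<bar> * \<bar>x\<bar>)" for m x
    using sums_norm[of x] sum_le_suminf[of "\<lambda>k. norm (f k x)" "{..<m}"] by (simp add: sums_iff)
  have int_f: "integrable M (f k)" for k
  proof (rule Bochner_Integration.integrable_bound[OF int_dom])
    show "f k \<in> borel_measurable M"
      unfolding measc f_def by measurable
    have "norm (f k x) \<le> \<bar>x\<bar> ^ n * exp (\<bar>h\<bar> * \<bar>x\<bar>)" for x
    proof -
      have "norm (f k x) \<le> (\<Sum>j<Suc k. norm (f j x))"
        by (rule member_le_sum) auto
      also have "\<dots> \<le> \<bar>x\<bar> ^ n * exp (\<bar>h\<bar> * \<bar>x\<bar>)"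
        by (rule le_dom)
      finally show ?thesis .
    qed
    then show "AE x in M. norm (f k x) \<le> norm (\<bar>x\<bar> ^ n * exp (\<bar>h\<bar> * \<bar>x\<bar>))"
      by (intro AE_I2) (simp add: abs_mult power_abs)
  qed
  have "summable (\<lambda>k. \<integral>x. norm (f k x) \<partial>M)"
  proof (rule bounded_imp_summable)
    show "(\<Sum>k\<le>m. \<integral>x. norm (f k x) \<partial>M) \<le> (\<integral>x. \<bar>x\<bar> ^ n * exp (\<bar>h\<bar> * \<bar>x\<bar>) \<partial>M)" for m
    proof -
      have "(\<Sum>k\<le>m. \<integral>x. norm (f k x) \<partial>M) = (\<integral>x. (\<Sum>k\<le>m. norm (f k x)) \<partial>M)"
        using int_f by (subst Bochner_Integration.integral_sum) auto
      also have "\<dots> \<le> (\<integral>x. \<bar>x\<bar> ^ n * exp (\<bar>h\<bar> * \<bar>x\<bar>) \<partial>M)"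
        using int_f int_dom le_dom[where m = "Suc m"] by (intro integral_mono) (auto simp: lessThan_Suc_atMost)
      finally show ?thesis .
    qed
  qed auto
  then have "(\<lambda>k. \<integral>x. f k x \<partial>M) sums (\<integral>x. (\<Sum>k. f k x) \<partial>M)"
    using int_f sums_norm by (intro sums_integral) (auto simp: sums_iff)
  moreover have "(\<Sum>k. f k x) = of_real (x ^ n) * iexp ((t + h) * x)" for x
  proof -
    have "(\<lambda>k. (\<i> * of_real (h * x)) ^ k /\<^sub>R fact k) sums exp (\<i> * of_real (h * x))"
      by (rule exp_converges)
    then have "(\<lambda>k. (of_real (x ^ n) * iexp (t * x)) * ((\<i> * of_real (h * x)) ^ k /\<^sub>R fact k))
        sums ((of_real (x ^ n) * iexp (t * x)) * exp (\<i> * of_real (h * x)))"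
      by (rule sums_mult)
    moreover have "(of_real (x ^ n) * iexp (t * x)) * ((\<i> * of_real (h * x)) ^ k /\<^sub>R fact k) = f k x" for k
      by (simp add: f_def power_add power_mult_distrib scaleR_conv_of_real divide_inverse mult_ac)
    moreover have "(of_real (x ^ n) * iexp (t * x)) * exp (\<i> * of_real (h * x))
        = of_real (x ^ n) * iexp ((t + h) * x)"
      by (simp add: algebra_simps flip: exp_add)
    ultimately show ?thesis
      by (simp add: sums_iff)
  qed
  moreover have "(\<integral>x. f k x \<partial>M) = (\<i> * of_real h) ^ k / fact k * exp_moment M (n + k) t" for k
    unfolding f_def exp_moment_def by (rule integral_mult_right_zero)
  ultimately show ?thesis
    by (simp add: exp_moment_def)
qed

text \<open>The even moments determine the integral of \<open>cosh (e x)\<close>, hence whether it is finite.\<close>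

lemma exp_integrable_of_moments:
  fixes M N :: "real measure"
  assumes sets: "sets M = sets borel" "sets N = sets borel"
    and int: "\<And>n. integrable M (\<lambda>x. x ^ n)" "\<And>n. integrable N (\<lambda>x. x ^ n)"
    and eq: "\<And>n. (\<integral>x. x ^ n \<partial>M) = (\<integral>x. x ^ n \<partial>N)"
    and e: "integrable N (\<lambda>x. exp (e * \<bar>x\<bar>))"
  shows "integrable M (\<lambda>x. exp (e * \<bar>x\<bar>))"
proof -
  define c where "c n x = (if even n then (e * x) ^ n /\<^sub>R fact n else 0)" for n :: nat and x :: real
  have nonneg: "0 \<le> c n x" for n x
    by (simp add: c_def zero_le_even_power)
  have c_sum: "(\<Sum>n. ennreal (c n x)) = ennreal (cosh (e * x))" for x
    using cosh_converges[of "e * x"] nonneg by (intro suminf_ennreal_eq) (simp_all add: c_def)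
  have c_alt: "c n = (\<lambda>x. (if even n then e ^ n / fact n else 0) * x ^ n)" for n
    by (auto simp: c_def power_mult_distrib fun_eq_iff divide_inverse)
  have expand: "(\<integral>\<^sup>+ x. ennreal (cosh (e * x)) \<partial>K)
      = (\<Sum>n. ennreal ((if even n then e ^ n / fact n else 0) * (\<integral>x. x ^ n \<partial>K)))"
    if "sets K = sets borel" "\<And>n. integrable K (\<lambda>x. x ^ n)" for K :: "real measure"
  proof -
    have int_c: "integrable K (c n)" for n
      unfolding c_alt using that(2) by simp
    have "(\<integral>\<^sup>+ x. ennreal (cosh (e * x)) \<partial>K) = (\<Sum>n. \<integral>\<^sup>+ x. ennreal (c n x) \<partial>K)"
      unfolding c_sum[symmetric] using int_c by (intro nn_integral_suminf) auto
    also have "\<dots> = (\<Sum>n. ennreal (\<integral>x. c n x \<partial>K))"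
      using int_c nonneg by (intro arg_cong[where f = suminf] ext nn_integral_eq_integral) auto
    finally show ?thesis
      unfolding c_alt by (simp only: integral_mult_right_zero)
  qed
  have cosh_bounds: "cosh (e * x) \<le> exp (e * \<bar>x\<bar>)" "exp (e * \<bar>x\<bar>) \<le> 2 * cosh (e * x)" if "0 \<le> e" for x
  proof -
    have "cosh (e * x) = (exp (e * \<bar>x\<bar>) + exp (- (e * \<bar>x\<bar>))) / 2"
      by (cases "0 \<le> x") (simp_all add: cosh_def)
    moreover have "exp (- (e * \<bar>x\<bar>)) \<le> exp (e * \<bar>x\<bar>)"
      using that by simp
    moreover have "0 < exp (- (e * \<bar>x\<bar>))"
      by simp
    moreover have "c = (E + F) / 2 \<Longrightarrow> F \<le> E \<Longrightarrow> 0 < F \<Longrightarrow> c \<le> E \<and> E \<le> 2 * c" for c E F :: real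
      by simp
    ultimately have "cosh (e * x) \<le> exp (e * \<bar>x\<bar>) \<and> exp (e * \<bar>x\<bar>) \<le> 2 * cosh (e * x)"
      by blast
    then show "cosh (e * x) \<le> exp (e * \<bar>x\<bar>)" "exp (e * \<bar>x\<bar>) \<le> 2 * cosh (e * x)"
      by simp_all
  qed
  have meas: "(\<lambda>x. exp (e * \<bar>x\<bar>)) \<in> borel_measurable M"
  proof -
    have "(\<lambda>x::real. exp (e * \<bar>x\<bar>)) \<in> borel_measurable borel"
      by measurable
    then show ?thesis
      using measurable_cong_sets[OF sets(1) refl, of borel] by blast
  qed
  show ?thesis
  proof (cases "0 \<le> e")
    case True
    have "(\<integral>\<^sup>+ x. ennreal (norm (exp (e * \<bar>x\<bar>))) \<partial>M) \<le> (\<integral>\<^sup>+ x. 2 * ennreal (cosh (e * x)) \<partial>M)"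
      using cosh_bounds(2)[OF True]
      by (intro nn_integral_mono) (metis abs_exp_cancel ennreal_leI ennreal_mult' ennreal_numeral real_norm_def zero_le_numeral)
    also have "\<dots> = 2 * (\<integral>\<^sup>+ x. ennreal (cosh (e * x)) \<partial>M)"
    proof (rule nn_integral_cmult)
      have "(\<lambda>x::real. ennreal (cosh (e * x))) \<in> borel_measurable borel"
        by (intro measurable_compose[OF _ measurable_ennreal] borel_measurable_continuous_onI continuous_intros)
      then show "(\<lambda>x. ennreal (cosh (e * x))) \<in> borel_measurable M"
        using measurable_cong_sets[OF sets(1) refl, of borel] by blast
    qed
    also have "\<dots> = 2 * (\<integral>\<^sup>+ x. ennreal (cosh (e * x)) \<partial>N)"
      using expand[OF sets(1) int(1)] expand[OF sets(2) int(2)] eq by simp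
    also have "\<dots> \<le> 2 * (\<integral>\<^sup>+ x. ennreal (norm (exp (e * \<bar>x\<bar>))) \<partial>N)"
      using cosh_bounds(1)[OF True] by (intro mult_left_mono nn_integral_mono) (auto intro: ennreal_leI)
    also have "\<dots> < \<infinity>"
      using e by (simp add: integrable_iff_bounded ennreal_mult_less_top)
    finally show ?thesis
      using meas by (intro integrableI_bounded)
  next
    case False
    show ?thesis
    proof (rule Bochner_Integration.integrable_bound)
      show "integrable M (\<lambda>x. x ^ 0 :: real)"
        by (rule int(1))
      show "AE x in M. norm (exp (e * \<bar>x\<bar>)) \<le> norm (x ^ 0 :: real)"
        using False by (intro AE_I2) (simp add: mult_nonpos_nonneg)
    qed (rule meas)
  qed
qed

text \<open>
  Equality of the moments is equality of all derivatives of the characteristic functions at \<open>0\<close>;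
  the Taylor expansions propagate it to the whole line in steps of length at most \<open>e/2\<close>.
\<close>

lemma moment_determinacy:
  fixes M N :: "real measure"
  assumes M: "real_distribution M" and N: "real_distribution N"
    and int: "\<And>n. integrable M (\<lambda>x. x ^ n)" "\<And>n. integrable N (\<lambda>x. x ^ n)"
    and eq: "\<And>n. (\<integral>x. x ^ n \<partial>M) = (\<integral>x. x ^ n \<partial>N)"
    and e: "0 < e" "integrable N (\<lambda>x. exp (e * \<bar>x\<bar>))"
  shows "M = N"
proof (rule Levy_uniqueness[OF M N])
  have sets: "sets M = sets borel" "sets N = sets borel"
    using M N by (simp_all add: real_distribution_def real_distribution_axioms_def)
  have fin: "finite_measure M" "finite_measure N"
    using M N by (simp_all add: real_distribution_def prob_space_def)
  have eM: "integrable M (\<lambda>x. exp (e * \<bar>x\<bar>))"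
    by (rule exp_integrable_of_moments[OF sets int eq e(2)])
  have start: "exp_moment M n 0 = exp_moment N n 0" for n
  proof -
    have "exp_moment K n 0 = of_real (\<integral>x. x ^ n \<partial>K)" for K :: "real measure"
      by (simp add: exp_moment_def flip: of_real_power)
    then show ?thesis
      by (simp add: eq)
  qed
  have step: "exp_moment M n (t + h) = exp_moment N n (t + h)"
    if "\<And>n. exp_moment M n t = exp_moment N n t" "\<bar>h\<bar> \<le> e / 2" for n t h
    using exp_moment_taylor[OF fin(1) sets(1) e(1) eM that(2), of n t]
      exp_moment_taylor[OF fin(2) sets(2) e(1) e(2) that(2), of n t]
    by (simp add: that(1) sums_iff)
  have steps: "exp_moment M n (real m * h) = exp_moment N n (real m * h)" if "\<bar>h\<bar> \<le> e / 2" for n m h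
  proof (induction m arbitrary: n)
    case 0
    then show ?case
      by (simp add: start)
  next
    case (Suc m)
    then show ?case
      using step[of "real m * h" h n] that by (simp add: algebra_simps)
  qed
  have "exp_moment M n t = exp_moment N n t" for n t
  proof -
    obtain m :: nat where m: "\<bar>t\<bar> / (e / 2) < real m"
      using reals_Archimedean2 by blast
    have "0 \<le> \<bar>t\<bar> / (e / 2)"
      using e(1) by simp
    then have pos: "0 < real m"
      using m by linarith
    then have "\<bar>t / real m\<bar> \<le> e / 2"
      using m e(1) by (simp add: field_simps)
    from steps[OF this, of n m] show ?thesis
      using pos by simp
  qed
  from this[of 0] show "char M = char N"
    by (simp add: exp_moment_def char_def fun_eq_iff)
qed

text \<open>
  The same for matrices of measures: each scalar measure \<open>v\<^sup>* W v\<close> is determined by its moments,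
  after rescaling \<open>v\<close> so that it becomes a probability measure.
\<close>

lemma moment_measure_determinacy:
  assumes W: "moment_measure W" and C: "moment_measure C"
    and eq: "\<And>k l p. moment_fun W k l p = moment_fun C k l p"
    and e: "0 < e" "\<And>v. integrable (qmeasure C v) (\<lambda>t. exp (e * \<bar>t\<bar>))"
  shows "W = C"
proof
  fix A :: "real set"
  have psd: "psd_measure W" "psd_measure C"
    using W C by (simp_all add: moment_measure_def)
  have int_eq: "integral\<^sup>L (qmeasure W v) (\<lambda>t. poly p (of_real t)) = integral\<^sup>L (qmeasure C v) (\<lambda>t. poly p (of_real t))"
    for v and p :: "complex poly"
    by (simp add: integral_poly_qmeasure W C eq)
  have real: "integrable (qmeasure K v) (\<lambda>t. t ^ n)"
      "complex_of_real (\<integral>t. t ^ n \<partial>qmeasure K v) = integral\<^sup>L (qmeasure K v) (\<lambda>t. poly (monom 1 n) (of_real t))"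
    if "moment_measure K" for K v n
  proof -
    have "integrable (qmeasure K v) (\<lambda>t. Re (complex_of_real t ^ n))"
      using that by (intro integrable_Re) (simp add: moment_measure_def)
    then show "integrable (qmeasure K v) (\<lambda>t. t ^ n)"
      by (simp flip: of_real_power)
    show "complex_of_real (\<integral>t. t ^ n \<partial>qmeasure K v) = integral\<^sup>L (qmeasure K v) (\<lambda>t. poly (monom 1 n) (of_real t))"
      by (simp add: poly_monom flip: of_real_power)
  qed
  have mom: "(\<integral>t. t ^ n \<partial>qmeasure W v) = (\<integral>t. t ^ n \<partial>qmeasure C v)" for n v
    using real(2)[OF W, of v n] real(2)[OF C, of v n] int_eq[of v "monom 1 n"]
    by (metis of_real_eq_iff)
  have total: "measure (qmeasure K v) UNIV = Re (qform (K UNIV) v)" if "psd_measure K" for K v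
    using measure_qmeasure[OF that, of UNIV v] by simp
  have sp: "space (qmeasure K v) = UNIV" for K v
    using sets_eq_imp_space_eq[OF sets_qmeasure] by simp
  have total_eq: "measure (qmeasure W v) UNIV = measure (qmeasure C v) UNIV" for v
    using mom[of v 0] by (simp add: sp)
  have q_eq: "qform (W A) v = qform (C A) v" if A: "A \<in> sets borel" for v
  proof (cases "measure (qmeasure W v) UNIV = 0")
    case True
    have "measure (qmeasure K v) A = 0" if "psd_measure K" "measure (qmeasure K v) UNIV = 0" for K
    proof -
      have "measure (qmeasure K v) A \<le> measure (qmeasure K v) UNIV"
        using A finite_measure.finite_measure_mono[OF finite_qmeasure[OF that(1)], of A UNIV v] by simp
      then show ?thesis
        using that(2) measure_nonneg[of "qmeasure K v" A] by linarith
    qed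
    then show ?thesis
      using True total_eq psd by (simp add: qform_eq_measure A)
  next
    case False
    define m where "m = measure (qmeasure W v) UNIV"
    have m: "0 < m"
      using False measure_nonneg[of "qmeasure W v" UNIV] by (simp add: m_def less_le)
    define u where "u = (1 / sqrt m) *\<^sub>R v"
    have scale: "qform B u = qform B v / m" for B
    proof -
      have "cnj (u $ i) * B $ i $ j * u $ j = cnj (v $ i) * B $ i $ j * v $ j / of_real (sqrt m * sqrt m)" for i j
        unfolding u_def vector_scaleR_component
        by (simp add: scaleR_conv_of_real del: real_sqrt_mult_self)
      then show ?thesis
        using m by (simp add: qform_def sum_divide_distrib)
    qed
    have dist: "real_distribution (qmeasure K u)"
      if "psd_measure K" "measure (qmeasure K v) UNIV = m" for K
    proof -
      have "measure (qmeasure K u) UNIV = 1"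
        using that m total[of K] by (simp add: scale)
      then have "prob_space (qmeasure K u)"
        using finite_measure.emeasure_eq_measure[OF finite_qmeasure[OF that(1)], of u UNIV]
        by (intro prob_spaceI) (simp add: sp)
      then show ?thesis
        by (simp add: real_distribution_def real_distribution_axioms_def)
    qed
    have "qmeasure W u = qmeasure C u"
    proof (rule moment_determinacy[OF _ _ _ _ mom e(1) e(2)])
      show "real_distribution (qmeasure W u)"
        using psd(1) by (rule dist) (simp add: m_def)
      show "real_distribution (qmeasure C u)"
        using psd(2) by (rule dist) (simp add: m_def total_eq)
    qed (simp_all add: real W C)
    then have "qform (W A) u = qform (C A) u"
      by (simp add: qform_eq_measure psd A)
    then show ?thesis
      using m by (simp add: scale)
  qed
  show "W A = C A"
  proof (cases "A \<in> sets borel")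
    case True
    then show ?thesis
      using psd q_eq by (intro psd_eqI) (auto simp: psd_measure_def)
  next
    case False
    then show ?thesis
      using psd by (simp add: psd_measure_def matrix_of_measures_def)
  qed
qed

section \<open>Linear functionals on polynomials\<close>

text \<open>The indeterminate \<open>t\<close>.  A separate constant keeps the simplifier from rewriting products with it
  into coefficient form.\<close>

definition polyX :: "complex poly" where "polyX = [:0, 1:]"

lemma pderiv_polyX_mult: "pderiv (polyX * r) = r + polyX * pderiv r"
  by (simp add: polyX_def pderiv_pCons)

lemma poly_polyX [simp]: "poly polyX x = x"
  by (simp add: polyX_def)

lemma linear_functionalD:
  assumes "linear_functional L"
  shows "L (p + q) = L p + L q" "L (smult c p) = c * L p" "L 0 = 0" "L (- p) = - L p"
    "L (p - q) = L p - L q"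
proof -
  show add: "L (p + q) = L p + L q" and smult: "L (smult c p) = c * L p" for p q c
    using assms by (auto simp: linear_functional_def)
  show "L 0 = 0"
    using smult[of 0 0] by simp
  show neg: "L (- p) = - L p" for p
    using smult[of "-1" p] by simp
  show "L (p - q) = L p - L q"
    using add[of p "- q"] neg[of q] by simp
qed

lemma linear_functional_expand:
  assumes "linear_functional L"
  shows "L p = (\<Sum>i\<le>degree p. coeff p i * L (polyX ^ i))"
proof -
  note L = linear_functionalD[OF assms]
  have sum: "L (\<Sum>i\<in>I. f i) = (\<Sum>i\<in>I. L (f i))" for I :: "nat set" and f
    by (induction I rule: infinite_finite_induct) (simp_all add: L)
  have "L p = L (\<Sum>i\<le>degree p. smult (coeff p i) (polyX ^ i))"
    using poly_as_sum_of_monoms[of p] by (simp add: monom_altdef polyX_def)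
  then show ?thesis
    by (simp add: sum L)
qed

lemma linear_functional_eqI:
  assumes "linear_functional L" "linear_functional K" "\<And>n. L (polyX ^ n) = K (polyX ^ n)"
  shows "L p = K p"
  by (simp only: linear_functional_expand[OF assms(1), of p] linear_functional_expand[OF assms(2), of p] assms(3))

text \<open>A functional that annihilates the multiples of \<open>t - x\<close> is a multiple of the evaluation at \<open>x\<close>.\<close>

lemma functional_eval:
  assumes "linear_functional L" and zero: "\<And>r. L (polyX * r) = x * L r"
  shows "L p = L 1 * poly p x"
proof -
  have "L (polyX ^ n) = L 1 * x ^ n" for n
    by (induction n) (simp_all add: zero)
  then show ?thesis
    using linear_functional_eqI[OF assms(1), of "\<lambda>p. L 1 * poly p x" p]
    by (simp add: linear_functional_def algebra_simps)
qed

text \<open>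
  The Pearson equation \<open>(t L)' = (c - t) L\<close>, whose solutions are the multiples of the moment
  functional of \<open>t\<^sup>c\<^sup>-\<^sup>1 e\<^sup>-\<^sup>t\<close>.
\<close>

definition pearson :: "complex \<Rightarrow> (complex poly \<Rightarrow> complex) \<Rightarrow> bool" where
  "pearson c L \<longleftrightarrow> (\<forall>r. L (polyX * pderiv r) + c * L r - L (polyX * r) = 0)"

lemma pderiv_polyX_power: "polyX * pderiv (polyX ^ n) = smult (of_nat n) (polyX ^ n)"
  by (induction n) (simp_all add: pderiv_polyX_mult algebra_simps smult_add_left)

lemma pearson_unique:
  assumes "linear_functional L" "linear_functional K" "pearson c L" "pearson c K"
    and "L 1 = s * K 1"
  shows "L p = s * K p"
proof (rule linear_functional_eqI)
  have rec: "M (polyX ^ Suc n) = (of_nat n + c) * M (polyX ^ n)"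
    if "linear_functional M" "pearson c M" for M n
    using that(2)[unfolded pearson_def, rule_format, of "polyX ^ n"]
    by (simp add: pderiv_polyX_power linear_functionalD(2)[OF that(1)] algebra_simps)
  show "L (polyX ^ n) = s * K (polyX ^ n)" for n
    by (induction n) (simp_all add: assms(5) rec[OF assms(1,3)] rec[OF assms(2,4)] del: power_Suc)
qed (use assms(1,2) in \<open>simp_all add: linear_functional_def algebra_simps\<close>)

text \<open>
  Symmetry of a second-order operator, for a single pair of entries: the bilinear identity is
  equivalent to three equations for functionals of one argument, the moment equations.  They are
  read off by testing with \<open>q = 1, t, t\<^sup>2\<close>.
\<close>

definition intertwine ::
  "(complex poly \<Rightarrow> complex) \<Rightarrow> (complex poly \<Rightarrow> complex) \<Rightarrow> (complex poly \<Rightarrow> complex) \<Rightarrow>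
   (complex poly \<Rightarrow> complex) \<Rightarrow> (complex poly \<Rightarrow> complex) \<Rightarrow> (complex poly \<Rightarrow> complex) \<Rightarrow> bool" where
  "intertwine U2 U1 U0 V2 V1 V0 \<longleftrightarrow> (\<forall>p q.
     U2 (pderiv (pderiv p) * q) + U1 (pderiv p * q) + U0 (p * q)
       = V2 (p * pderiv (pderiv q)) + V1 (p * pderiv q) + V0 (p * q))"

lemma intertwine_iff:
  assumes lin: "linear_functional U2" "linear_functional U1" "linear_functional U0"
    "linear_functional V2" "linear_functional V1" "linear_functional V0"
  shows "intertwine U2 U1 U0 V2 V1 V0 \<longleftrightarrow>
    (\<forall>r. U2 r = V2 r) \<and> (\<forall>r. 2 * U2 (pderiv r) + U1 r + V1 r = 0) \<and>
    (\<forall>r. U2 (pderiv (pderiv r)) + U1 (pderiv r) + U0 r = V0 r)"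
    (is "?L \<longleftrightarrow> ?C \<and> ?B \<and> ?A")
proof
  note lins = linear_functionalD[OF lin(1)] linear_functionalD[OF lin(2)] linear_functionalD[OF lin(3)]
    linear_functionalD[OF lin(4)] linear_functionalD[OF lin(5)] linear_functionalD[OF lin(6)]
  have two: "2 * p = smult 2 p" "p * 2 = smult 2 p" for p :: "complex poly"
    by (simp_all add: numeral_poly)
  {
    assume ?L
    then have eq: "U2 (pderiv (pderiv p) * q) + U1 (pderiv p * q) + U0 (p * q)
       = V2 (p * pderiv (pderiv q)) + V1 (p * pderiv q) + V0 (p * q)" for p q
      unfolding intertwine_def by blast
    have dX: "pderiv polyX = 1"
      by (simp add: polyX_def pderiv_pCons)
    have A: "U2 (pderiv (pderiv r)) + U1 (pderiv r) + U0 r = V0 r" for r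
      using eq[of r 1] by (simp add: lins)
    have B: "2 * U2 (pderiv r) + U1 r + V1 r = 0" for r
      using eq[of r polyX] A[of "polyX * r"]
      by (simp add: lins dX pderiv_polyX_mult pderiv_add two mult.commute[of _ polyX]) algebra
    have C: "U2 r = V2 r" for r
      using eq[of r "polyX * polyX"] A[of "polyX * (polyX * r)"] B[of "polyX * r"]
      by (simp add: lins dX pderiv_polyX_mult pderiv_add pderiv_smult distrib_left two
          mult.commute[of r polyX] mult.left_commute[of r polyX]
          mult.commute[of "pderiv r" polyX] mult.left_commute[of "pderiv r" polyX]
          mult.commute[of "pderiv (pderiv r)" polyX] mult.left_commute[of "pderiv (pderiv r)" polyX]) algebra
    from A B C show "?C \<and> ?B \<and> ?A"
      by blast
  next
    assume *: "?C \<and> ?B \<and> ?A"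
    have aux: "u0 + (w1 + w2) = v0 + (v1 + v2)"
      if "u1 + (v1 + (2 * x + 2 * v2)) = 0" "u0 + (u1 + (w1 + (w2 + (v2 + 2 * x)))) = v0"
      for u0 u1 v0 v1 v2 w1 w2 x :: complex
      using that by algebra
    show ?L
      unfolding intertwine_def
    proof (intro allI)
      fix p q
      show "U2 (pderiv (pderiv p) * q) + U1 (pderiv p * q) + U0 (p * q)
       = V2 (p * pderiv (pderiv q)) + V1 (p * pderiv q) + V0 (p * q)"
        using *[THEN conjunct1, rule_format, of "p * pderiv (pderiv q)"]
          *[THEN conjunct2, THEN conjunct1, rule_format, of "p * pderiv q"]
          *[THEN conjunct2, THEN conjunct2, rule_format, of "p * q"]
        by (simp add: lins pderiv_mult pderiv_add two algebra_simps) (rule aux, assumption+)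
    qed
  }
qed

section \<open>The conjugated operator and its symmetric forms\<close>

text \<open>
  Here \<open>\<tau>\<close>, \<open>\<psi>\<close> and \<open>\<kappa>\<close> stand for \<open>t\<^sub>0\<close>, \<open>\<phi> - a (t\<^sub>0 - 1)\<close> and the number with
  \<open>\<psi> - \<kappa> = (\<tau> + \<alpha> + 1) / a + a (\<alpha> + 1 - \<tau>)\<close>.  The quadratic equation for \<open>\<phi>\<close> becomes
  \<open>\<kappa> \<psi> = \<tau>\<^sup>2\<close>, which says that the leading coefficient of the conjugated operator is singular.  The
  parameters are complex because the functionals take complex values.
\<close>

locale operator_parameters =
  fixes a al tau psi kap :: complex
  assumes a: "a \<noteq> 0" "1 + a\<^sup>2 \<noteq> 0"
    and al: "al + 1 \<noteq> 0" "al + 2 \<noteq> 0" "al + 3 \<noteq> 0"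
    and prod: "kap * psi = tau\<^sup>2"
    and diff: "psi - kap = (tau + al + 1) / a + a * (al + 1 - tau)"
    and sum: "kap + psi \<noteq> 0"
begin

text \<open>Constants in the coefficient of order zero.\<close>

definition h where "h = (al + 1) / (1 + a\<^sup>2)"
definition d1 where "d1 = - psi / 2 + (al + 2) * (tau + al + 1) / (2 * a) + a * (al + 1 - tau)"
definition d2 where "d2 = psi / 2 - (al + 2) * (tau + al + 1) / (2 * a)"

lemma h_eq: "(1 + a\<^sup>2) * h = al + 1"
  using a(2) by (simp add: h_def)

lemma diff_eq: "a * (psi - kap) = tau + al + 1 + a\<^sup>2 * (al + 1 - tau)"
  using a(1) by (simp add: diff field_simps power2_eq_square)

text \<open>
  The two components of the conjugated operator, applied to a row \<open>(p\<^sub>1, p\<^sub>2)\<close>.  Its leading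
  coefficient has the rows \<open>(\<kappa> t, - \<tau> t\<^sup>2)\<close> and \<open>(- \<tau>, \<psi> t)\<close>.
\<close>

definition T1 :: "complex poly \<Rightarrow> complex poly \<Rightarrow> complex poly" where
  "T1 p1 p2 = smult kap (polyX * pderiv (pderiv p1)) - smult tau (pderiv (pderiv p2))
    + smult (kap * (al + 3)) (pderiv p1) - smult kap (polyX * pderiv p1)
    + smult (tau - al - 1) (pderiv p2)
    + smult d1 p1 - smult (a * h) (polyX * p1) + smult h p2"

definition T2 :: "complex poly \<Rightarrow> complex poly \<Rightarrow> complex poly" where
  "T2 p1 p2 = smult psi (polyX * pderiv (pderiv p2)) - smult tau (polyX * (polyX * pderiv (pderiv p1)))
    - smult (2 * tau * (al + 2)) (polyX * pderiv p1)
    + smult (tau + al + 1) (polyX * (polyX * pderiv p1))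
    + smult (psi * (al + 1)) (pderiv p2) - smult psi (polyX * pderiv p2)
    - smult (tau * (al + 2) * (al + 1)) p1 + smult ((al + 2) * (tau + al + 1)) (polyX * p1)
    - smult (a\<^sup>2 * h) (polyX * (polyX * p1)) + smult d2 p2 + smult (a * h) (polyX * p2)"

text \<open>
  Symmetry of the operator for the bilinear form on rows whose entries are the functionals
  \<open>XF\<close>, \<open>YF\<close>, \<open>YG\<close>, \<open>ZF\<close> at the positions \<open>(1,1)\<close>, \<open>(1,2)\<close>, \<open>(2,1)\<close>, \<open>(2,2)\<close>.
\<close>

definition symmetric_form where
  "symmetric_form XF YF YG ZF \<longleftrightarrow> (\<forall>u1 u2 v1 v2.
     XF (T1 u1 u2 * v1) + YF (T1 u1 u2 * v2) + YG (T2 u1 u2 * v1) + ZF (T2 u1 u2 * v2)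
     = (XF (u1 * T1 v1 v2) + YF (u1 * T2 v1 v2) + YG (u2 * T1 v1 v2) + ZF (u2 * T2 v1 v2) :: complex))"

text \<open>
  \<open>R\<^sub>k\<^sub>i A B\<close> is the functional \<open>r \<mapsto> A (f\<^sub>1 r) + B (f\<^sub>2 r)\<close>, where \<open>(f\<^sub>1, f\<^sub>2)\<close> is the row \<open>k\<close> of the
  coefficient of the derivative of order \<open>i\<close>.
\<close>

definition R12 where "R12 A B r = kap * A (polyX * r) - tau * B (polyX * (polyX * r))"
definition R11 where "R11 A B r = kap * (al + 3) * A r - kap * A (polyX * r)
    - 2 * tau * (al + 2) * B (polyX * r) + (tau + al + 1) * B (polyX * (polyX * r))"
definition R10 where "R10 A B r = d1 * A r - a * h * A (polyX * r) - tau * (al + 2) * (al + 1) * B r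
    + (al + 2) * (tau + al + 1) * B (polyX * r) - a\<^sup>2 * h * B (polyX * (polyX * r))"
definition R22 where "R22 A B r = psi * B (polyX * r) - tau * A r"
definition R21 where "R21 A B r = (tau - al - 1) * A r + psi * (al + 1) * B r - psi * B (polyX * r)"
definition R20 where "R20 A B r = h * A r + d2 * B r + a * h * B (polyX * r)"

lemmas R_defs = R12_def R11_def R10_def R22_def R21_def R20_def

lemma linear_R:
  assumes "linear_functional A" "linear_functional B"
  shows "linear_functional (R12 A B)" "linear_functional (R11 A B)" "linear_functional (R10 A B)"
    "linear_functional (R22 A B)" "linear_functional (R21 A B)" "linear_functional (R20 A B)"
  unfolding linear_functional_def R_defs
  by (simp_all add: linear_functionalD[OF assms(1)] linear_functionalD[OF assms(2)] algebra_simps)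

text \<open>Testing with rows that have a single nonzero entry decouples the symmetry condition.\<close>

lemma symmetric_form_iff:
  assumes lin: "linear_functional XF" "linear_functional YF" "linear_functional YG" "linear_functional ZF"
  shows "symmetric_form XF YF YG ZF \<longleftrightarrow>
    intertwine (R12 XF YG) (R11 XF YG) (R10 XF YG) (R12 XF YF) (R11 XF YF) (R10 XF YF) \<and>
    intertwine (R12 YF ZF) (R11 YF ZF) (R10 YF ZF) (R22 XF YF) (R21 XF YF) (R20 XF YF) \<and>
    intertwine (R22 XF YG) (R21 XF YG) (R20 XF YG) (R12 YG ZF) (R11 YG ZF) (R10 YG ZF) \<and>
    intertwine (R22 YF ZF) (R21 YF ZF) (R20 YF ZF) (R22 YG ZF) (R21 YG ZF) (R20 YG ZF)"
    (is "?S \<longleftrightarrow> ?I11 \<and> ?I12 \<and> ?I21 \<and> ?I22")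
proof
  note lins = linear_functionalD[OF lin(1)] linear_functionalD[OF lin(2)] linear_functionalD[OF lin(3)]
    linear_functionalD[OF lin(4)]
  note expand = T1_def T2_def R_defs lins distrib_left distrib_right left_diff_distrib right_diff_distrib
    mult_smult_left mult_smult_right mult.assoc
  {
    assume ?S
    then have eq: "XF (T1 u1 u2 * v1) + YF (T1 u1 u2 * v2) + YG (T2 u1 u2 * v1) + ZF (T2 u1 u2 * v2)
     = XF (u1 * T1 v1 v2) + YF (u1 * T2 v1 v2) + YG (u2 * T1 v1 v2) + ZF (u2 * T2 v1 v2)" for u1 u2 v1 v2
      unfolding symmetric_form_def by blast
    have ?I11
      unfolding intertwine_def
    proof (intro allI)
      fix p q
      show "R12 XF YG (pderiv (pderiv p) * q) + R11 XF YG (pderiv p * q) + R10 XF YG (p * q)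
        = R12 XF YF (p * pderiv (pderiv q)) + R11 XF YF (p * pderiv q) + R10 XF YF (p * q)"
        using eq[of p 0 q 0] by (simp add: expand mult.left_commute[of p polyX]) (simp add: algebra_simps)
    qed
    moreover have ?I12
      unfolding intertwine_def
    proof (intro allI)
      fix p q
      show "R12 YF ZF (pderiv (pderiv p) * q) + R11 YF ZF (pderiv p * q) + R10 YF ZF (p * q)
        = R22 XF YF (p * pderiv (pderiv q)) + R21 XF YF (p * pderiv q) + R20 XF YF (p * q)"
        using eq[of p 0 0 q] by (simp add: expand mult.left_commute[of p polyX]) (simp add: algebra_simps)
    qed
    moreover have ?I21
      unfolding intertwine_def
    proof (intro allI)
      fix p q
      show "R22 XF YG (pderiv (pderiv p) * q) + R21 XF YG (pderiv p * q) + R20 XF YG (p * q)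
        = R12 YG ZF (p * pderiv (pderiv q)) + R11 YG ZF (p * pderiv q) + R10 YG ZF (p * q)"
        using eq[of 0 p q 0] by (simp add: expand mult.left_commute[of p polyX]) (simp add: algebra_simps)
    qed
    moreover have ?I22
      unfolding intertwine_def
    proof (intro allI)
      fix p q
      show "R22 YF ZF (pderiv (pderiv p) * q) + R21 YF ZF (pderiv p * q) + R20 YF ZF (p * q)
        = R22 YG ZF (p * pderiv (pderiv q)) + R21 YG ZF (p * pderiv q) + R20 YG ZF (p * q)"
        using eq[of 0 p 0 q] by (simp add: expand mult.left_commute[of p polyX]) (simp add: algebra_simps)
    qed
    ultimately show "?I11 \<and> ?I12 \<and> ?I21 \<and> ?I22"
      by blast
  next
    assume *: "?I11 \<and> ?I12 \<and> ?I21 \<and> ?I22"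
    show ?S
      unfolding symmetric_form_def
    proof (intro allI)
      fix u1 u2 v1 v2
      have T: "T1 u1 u2 = T1 u1 0 + T1 0 u2" "T2 u1 u2 = T2 u1 0 + T2 0 u2" for u1 u2
        by (simp_all add: T1_def T2_def)
      have "XF (T1 u1 0 * v1) + YG (T2 u1 0 * v1) = XF (u1 * T1 v1 0) + YF (u1 * T2 v1 0)"
        using *[THEN conjunct1, unfolded intertwine_def, rule_format, of u1 v1]
        by (simp add: expand mult.left_commute[of u1 polyX] mult.left_commute[of u2 polyX]) (simp add: algebra_simps)
      moreover have "YF (T1 u1 0 * v2) + ZF (T2 u1 0 * v2) = XF (u1 * T1 0 v2) + YF (u1 * T2 0 v2)"
        using *[THEN conjunct2, THEN conjunct1, unfolded intertwine_def, rule_format, of u1 v2]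
        by (simp add: expand mult.left_commute[of u1 polyX] mult.left_commute[of u2 polyX]) (simp add: algebra_simps)
      moreover have "XF (T1 0 u2 * v1) + YG (T2 0 u2 * v1) = YG (u2 * T1 v1 0) + ZF (u2 * T2 v1 0)"
        using *[THEN conjunct2, THEN conjunct2, THEN conjunct1, unfolded intertwine_def, rule_format, of u2 v1]
        by (simp add: expand mult.left_commute[of u1 polyX] mult.left_commute[of u2 polyX]) (simp add: algebra_simps)
      moreover have "YF (T1 0 u2 * v2) + ZF (T2 0 u2 * v2) = YG (u2 * T1 0 v2) + ZF (u2 * T2 0 v2)"
        using *[THEN conjunct2, THEN conjunct2, THEN conjunct2, unfolded intertwine_def, rule_format, of u2 v2]
        by (simp add: expand mult.left_commute[of u1 polyX] mult.left_commute[of u2 polyX]) (simp add: algebra_simps)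
      ultimately show "XF (T1 u1 u2 * v1) + YF (T1 u1 u2 * v2) + YG (T2 u1 u2 * v1) + ZF (T2 u1 u2 * v2)
        = XF (u1 * T1 v1 v2) + YF (u1 * T2 v1 v2) + YG (u2 * T1 v1 v2) + ZF (u2 * T2 v1 v2)"
        unfolding T(1)[of u1 u2] T(2)[of u1 u2] T(1)[of v1 v2] T(2)[of v1 v2]
          distrib_left distrib_right lins by algebra
    qed
  }
qed

text \<open>The two basic symmetric forms: that of the diagonal weight, and that of the point mass at \<open>\<tau>\<close>.\<close>

lemma symmetric_form_weight:
  assumes z: "linear_functional z" and pearson: "pearson (al + 1) z"
  shows "symmetric_form (\<lambda>r. z (polyX * (polyX * r))) (\<lambda>r. 0) (\<lambda>r. 0) z"
proof -
  have lin: "linear_functional (\<lambda>r. z (polyX * (polyX * r)))" "linear_functional (\<lambda>r. 0)"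
    by (simp_all add: linear_functional_def linear_functionalD[OF z] distrib_left)
  note zs = linear_functionalD[OF z]
  have p: "z (polyX * pderiv r) = z (polyX * r) - (al + 1) * z r" for r
    using pearson unfolding pearson_def by (metis add_diff_cancel_right' diff_add_cancel eq_iff_diff_eq_0)
  have p1: "z (polyX * (polyX * pderiv r)) = z (polyX * (polyX * r)) - (al + 2) * z (polyX * r)" for r
    using p[of "polyX * r"] by (simp add: pderiv_polyX_mult distrib_left zs algebra_simps)
  have p2: "z (polyX * (polyX * (polyX * pderiv r)))
      = z (polyX * (polyX * (polyX * r))) - (al + 3) * z (polyX * (polyX * r))" for r
    using p1[of "polyX * r"] by (simp add: pderiv_polyX_mult distrib_left zs algebra_simps)
  have h: "h * w + h * (a\<^sup>2 * w) = w + al * w" for w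
    using h_eq by algebra
  show ?thesis
    unfolding symmetric_form_iff[OF lin(1,2,2) z]
      intertwine_iff[OF linear_R(1-3)[OF lin] linear_R(1-3)[OF lin]]
      intertwine_iff[OF linear_R(1-3)[OF lin(2) z] linear_R(4-6)[OF lin]]
      intertwine_iff[OF linear_R(4-6)[OF lin] linear_R(1-3)[OF lin(2) z]]
      intertwine_iff[OF linear_R(4-6)[OF lin(2) z] linear_R(4-6)[OF lin(2) z]]
    by (simp add: R_defs p p1 p2 algebra_simps) (simp add: h)
qed

lemma symmetric_form_point:
  "symmetric_form (\<lambda>r. psi\<^sup>2 * poly r tau) (\<lambda>r. psi * poly r tau) (\<lambda>r. psi * poly r tau) (\<lambda>r. poly r tau)"
proof -
  \<comment> \<open>At \<open>\<tau>\<close> the coefficients of both derivatives annihilate the vector \<open>(\<psi>, 1)\<close>, which is an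
    eigenvector of the coefficient of order zero, with eigenvalue \<open>l\<close>.\<close>
  define l where "l = h * psi + d2 + a * h * tau"
  have "a * (d1 - d2) = - a * psi + (al + 2) * (tau + al + 1) + a\<^sup>2 * (al + 1 - tau)"
    using a(1) by (simp add: d1_def d2_def field_simps power2_eq_square)
  then have "a * (1 + a\<^sup>2) * (psi * (d1 - a * h * tau) - tau * (al + 2) * (al + 1)
      + (al + 2) * (tau + al + 1) * tau - a\<^sup>2 * h * tau\<^sup>2 - l * psi) = 0"
    using h_eq diff_eq prod unfolding l_def by algebra
  then have zero: "psi * (d1 - a * h * tau) - tau * (al + 2) * (al + 1)
      + (al + 2) * (tau + al + 1) * tau - a\<^sup>2 * h * tau\<^sup>2 = l * psi"
    using a by simp
  have eig: "psi * poly (T1 u1 u2) tau + poly (T2 u1 u2) tau = l * (psi * poly u1 tau + poly u2 tau)" for u1 u2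
    using zero prod l_def by (simp add: T1_def T2_def) algebra
  show ?thesis
    unfolding symmetric_form_def
  proof (intro allI)
    fix u1 u2 v1 v2
    have "(psi * poly (T1 u1 u2) tau + poly (T2 u1 u2) tau) * (psi * poly v1 tau + poly v2 tau)
      = (psi * poly u1 tau + poly u2 tau) * (psi * poly (T1 v1 v2) tau + poly (T2 v1 v2) tau)"
      by (simp add: eig mult_ac)
    then show "psi\<^sup>2 * poly (T1 u1 u2 * v1) tau + psi * poly (T1 u1 u2 * v2) tau
        + psi * poly (T2 u1 u2 * v1) tau + poly (T2 u1 u2 * v2) tau
      = psi\<^sup>2 * poly (u1 * T1 v1 v2) tau + psi * poly (u1 * T2 v1 v2) tau
        + psi * poly (u2 * T1 v1 v2) tau + poly (u2 * T2 v1 v2) tau"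
      by (simp add: power2_eq_square algebra_simps)
  qed
qed

text \<open>
  There are no other symmetric forms.  If \<open>\<tau> \<noteq> 0\<close>, the moment equations imply
  \<open>(t - \<tau>) YF = 0\<close>, so that \<open>YF\<close> is a point mass, and after subtracting a point mass from \<open>ZF\<close> the
  Pearson equation remains.  If \<open>\<tau> = 0\<close>, then \<open>t YF = 0\<close> and one of \<open>\<kappa>\<close> and \<open>\<psi>\<close> vanishes.  For
  \<open>\<kappa> = 0\<close> the argument ends in the same way.  For \<open>\<psi> = 0\<close> one finds \<open>YF = 0\<close> and \<open>XF = t\<^sup>2 ZF\<close>, and the
  Pearson equation holds for \<open>XF\<close>; this leaves the first two moments of \<open>ZF\<close> open, and the
  third moment equation fixes the one of order \<open>1\<close>.
\<close>

lemma symmetric_form_unique: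
  assumes lin: "linear_functional XF" "linear_functional YF" "linear_functional YG" "linear_functional ZF"
    and sym: "symmetric_form XF YF YG ZF"
    and z: "linear_functional z" "pearson (al + 1) z" "z 1 \<noteq> 0"
  obtains c d where
    "\<And>r. XF r = c * z (polyX * (polyX * r)) + d * (psi\<^sup>2 * poly r tau)"
    "\<And>r. YF r = d * (psi * poly r tau)"
    "\<And>r. YG r = d * (psi * poly r tau)"
    "\<And>r. ZF r = c * z r + d * poly r tau"
proof -
  note result = that
  note lins = linear_functionalD[OF lin(1)] linear_functionalD[OF lin(2)] linear_functionalD[OF lin(3)]
    linear_functionalD[OF lin(4)] linear_functionalD[OF z(1)]
  note eqs = sym[unfolded symmetric_form_iff[OF lin]
      intertwine_iff[OF linear_R(1-3)[OF lin(1,3)] linear_R(1-3)[OF lin(1,2)]]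
      intertwine_iff[OF linear_R(1-3)[OF lin(2,4)] linear_R(4-6)[OF lin(1,2)]]
      intertwine_iff[OF linear_R(4-6)[OF lin(1,3)] linear_R(1-3)[OF lin(3,4)]]
      intertwine_iff[OF linear_R(4-6)[OF lin(2,4)] linear_R(4-6)[OF lin(3,4)]]]
  have c12: "kap * YF (polyX * r) - tau * ZF (polyX * (polyX * r)) = psi * YF (polyX * r) - tau * XF r" for r
  proof -
    have "R12 YF ZF r = R22 XF YF r"
      using eqs by blast
    then show ?thesis
      by (simp add: R_defs)
  qed
  have c21: "psi * YG (polyX * r) - tau * XF r = kap * YG (polyX * r) - tau * ZF (polyX * (polyX * r))" for r
  proof -
    have "R22 XF YG r = R12 YG ZF r"
      using eqs by blast
    then show ?thesis
      by (simp add: R_defs)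
  qed
  have c22: "psi * ZF (polyX * r) - tau * YF r = psi * ZF (polyX * r) - tau * YG r" for r
  proof -
    have "R22 YF ZF r = R22 YG ZF r"
      using eqs by blast
    then show ?thesis
      by (simp add: R_defs)
  qed
  have b11: "2 * R12 XF YG (pderiv r) + R11 XF YG r + R11 XF YF r = 0" for r
    using eqs by blast
  have b12: "2 * R12 YF ZF (pderiv r) + R11 YF ZF r + R21 XF YF r = 0" for r
    using eqs by blast
  have b21: "2 * R22 XF YG (pderiv r) + R21 XF YG r + R11 YG ZF r = 0" for r
    using eqs by blast
  have b22: "2 * R22 YF ZF (pderiv r) + R21 YF ZF r + R21 YG ZF r = 0" for r
    using eqs by blast
  have a12: "R12 YF ZF (pderiv (pderiv r)) + R11 YF ZF (pderiv r) + R10 YF ZF r = R20 XF YF r" for r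
    using eqs by blast
  \<comment> \<open>The common end of the argument when \<open>\<psi> \<noteq> 0\<close>.\<close>
  have finish: thesis
    if psi: "psi \<noteq> 0" and Y: "\<And>r. YF (polyX * r) = tau * YF r" "\<And>r. YG r = YF r"
      and X: "\<And>r. XF r = (psi - kap) * YF r + ZF (polyX * (polyX * r))"
  proof -
    have YF: "YF r = YF 1 * poly r tau" for r
      by (rule functional_eval[OF lin(2) Y(1)])
    define d where "d = YF 1 / psi"
    define W where "W r = ZF r - d * poly r tau" for r
    have linW: "linear_functional W"
      unfolding linear_functional_def W_def by (simp add: lins algebra_simps)
    have pearson: "pearson (al + 1) W"
      unfolding pearson_def
    proof
      fix r
      have d: "d * psi = YF 1"
        using psi by (simp add: d_def)
      have "psi * (W (polyX * pderiv r) + (al + 1) * W r - W (polyX * r)) = 0"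
        using b22[of r] d YF[of r] YF[of "pderiv r"] Y(2)[of r] unfolding W_def R_defs poly_mult poly_polyX
        by algebra
      then show "W (polyX * pderiv r) + (al + 1) * W r - W (polyX * r) = 0"
        using psi by simp
    qed
    have W: "W r = (W 1 / z 1) * z r" for r
      by (rule pearson_unique[OF linW z(1) pearson z(2)]) (use z(3) in simp)
    have ZF: "ZF r = (W 1 / z 1) * z r + d * poly r tau" for r
      using W[of r] by (simp only: W_def[of r] diff_eq_eq)
    have YF': "YF r = d * (psi * poly r tau)" for r
      using YF[of r] psi by (simp add: d_def)
    show thesis
    proof (rule result)
      show "XF r = (W 1 / z 1) * z (polyX * (polyX * r)) + d * (psi\<^sup>2 * poly r tau)" for r
        using prod unfolding X YF' ZF poly_mult poly_polyX by algebra
    qed (simp_all only: YF' Y(2) ZF)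
  qed
  show thesis
  proof (cases "tau = 0")
    case False
    then have psi: "psi \<noteq> 0"
      using prod by auto
    have YG: "YG r = YF r" for r
      using c22[of r] False by simp
    have X: "tau * XF r = (psi - kap) * YF (polyX * r) + tau * ZF (polyX * (polyX * r))" for r
      using c12[of r] by (simp add: algebra_simps)
    have Y: "YF (polyX * r) = tau * YF r" for r
    proof -
      have b22': "2 * (psi * (ZF (polyX * r) + ZF (polyX * (polyX * pderiv r))) - tau * (YF r + YF (polyX * pderiv r)))
          + 2 * ((tau - al - 1) * YF (polyX * r) + psi * (al + 1) * ZF (polyX * r)
            - psi * ZF (polyX * (polyX * r))) = 0"
        using b22[of "polyX * r"]
        by (simp add: R_defs YG pderiv_polyX_mult distrib_left[of polyX] lins algebra_simps)
      have "psi * (al + 1) * (kap + psi) * (tau * YF r - YF (polyX * r)) = 0"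
        using b12[of r] b22' X[of r] prod unfolding R_defs by algebra
      then show ?thesis
        using psi al sum by simp
    qed
    show thesis
    proof (rule finish[OF psi Y YG])
      show "XF r = (psi - kap) * YF r + ZF (polyX * (polyX * r))" for r
      proof -
        have "tau * (XF r - ((psi - kap) * YF r + ZF (polyX * (polyX * r)))) = 0"
          using X[of r] unfolding Y by algebra
        then show ?thesis
          using False by simp
      qed
    qed
  next
    case True
    then have prod0: "kap = 0 \<or> psi = 0"
      using prod by simp
    then have ne: "kap \<noteq> psi" "kap * (al + 3) + psi * (al + 1) \<noteq> 0"
      using sum al by auto
    have Y: "YF (polyX * r) = 0" "YG (polyX * r) = 0" for r
      using c12[of r] c21[of r] ne True by simp_all
    have X: "(al + 1) * (XF r - ZF (polyX * (polyX * r))) = (kap * (al + 3) + psi * (al + 1)) * YF r" for r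
      using b12[of r] unfolding R_defs unfolding Y True by algebra
    have X': "(al + 1) * (XF r - ZF (polyX * (polyX * r))) = (kap * (al + 3) + psi * (al + 1)) * YG r" for r
      using b21[of r] unfolding R_defs unfolding Y True by algebra
    have YG: "YG r = YF r" for r
      using X[of r] X'[of r] ne by simp
    show thesis
    proof (cases "psi = 0")
      case False
      then have "kap = 0"
        using prod0 by simp
      show thesis
      proof (rule finish[OF False _ YG])
        show "YF (polyX * r) = tau * YF r" for r
          by (simp add: Y True)
        show "XF r = (psi - kap) * YF r + ZF (polyX * (polyX * r))" for r
        proof -
          have "(al + 1) * (XF r - ((psi - kap) * YF r + ZF (polyX * (polyX * r)))) = 0"
            using X[of r] \<open>kap = 0\<close> by algebra
          then show ?thesis
            using al by simp
        qed
      qed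
    next
      case psi: True
      have kap: "kap \<noteq> 0"
        using sum psi by simp
      have YF: "YF r = 0" for r
      proof -
        have "2 * ((al + 1) * YF r) = 0"
          using b22[of r] unfolding R_defs unfolding Y YG True psi by algebra
        then have "(al + 1) * YF r = 0"
          by (simp only: mult_eq_0_iff[of 2]) simp
        then show ?thesis
          using al by simp
      qed
      have XF: "XF r = ZF (polyX * (polyX * r))" for r
        using X[of r] al by (simp add: YF)
      have "pearson (al + 3) XF"
        unfolding pearson_def
      proof
        fix r
        have "2 * kap * (XF (polyX * pderiv r) + (al + 3) * XF r - XF (polyX * r)) = 0"
          using b11[of r] True unfolding R_defs Y YG YF by algebra
        then show "XF (polyX * pderiv r) + (al + 3) * XF r - XF (polyX * r) = 0"
          using kap by simp
      qed
      have two: "2 * p = smult 2 p" "p * 2 = smult 2 p" for p :: "complex poly"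
        by (simp_all add: numeral_poly)
      define K where "K r = z (polyX * (polyX * r))" for r
      have linK: "linear_functional K"
        unfolding linear_functional_def K_def by (simp add: lins distrib_left)
      have zp: "z (polyX * pderiv r) + (al + 1) * z r - z (polyX * r) = 0" for r
        using z(2) by (simp add: pearson_def)
      have "pearson (al + 3) K"
        unfolding pearson_def
      proof
        fix r
        show "K (polyX * pderiv r) + (al + 3) * K r - K (polyX * r) = 0"
          using zp[of "polyX * (polyX * r)"]
          by (simp add: K_def pderiv_polyX_mult distrib_left two lins)
            (simp add: distrib_right add_ac)
      qed
      have z1: "z polyX = (al + 1) * z 1"
        using zp[of 1] by (simp add: lins)
      have z2: "z (polyX * polyX) = (al + 2) * z polyX"
        using zp[of polyX] by (simp add: lins polyX_def pderiv_pCons algebra_simps flip: one_pCons)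
      have K1: "K 1 \<noteq> 0"
        using z1 z2 z(3) al by (simp add: K_def)
      define c where "c = XF 1 / K 1"
      have XK: "XF r = c * K r" for r
        by (rule pearson_unique[OF lin(1) linK \<open>pearson (al + 3) XF\<close> \<open>pearson (al + 3) K\<close>])
          (use K1 in \<open>simp add: c_def\<close>)
      have "(al + 2) * (al + 1) * ZF polyX - a\<^sup>2 * h * ZF (polyX * polyX) = h * XF 1"
        using a12[of 1] unfolding R_defs unfolding YF True by (simp add: lins)
      then have "(al + 1) * ((al + 2) * ZF polyX - ZF (polyX * polyX)) = 0"
        using h_eq XF[of 1] by (simp, algebra)
      then have "(al + 2) * ZF polyX = ZF (polyX * polyX)"
        using al by simp
      also have "\<dots> = (al + 2) * (c * z polyX)"
        using XF[of 1] XK[of 1] z2 by (simp add: K_def mult.left_commute)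
      finally have Z1: "ZF polyX = c * z polyX"
        using al by simp
      define d where "d = ZF 1 - c * z 1"
      have ZF: "ZF r = c * z r + d * poly r tau" for r
      proof (rule linear_functional_eqI[OF lin(4), of "\<lambda>r. c * z r + d * poly r tau"])
        show "linear_functional (\<lambda>r. c * z r + d * poly r tau)"
          unfolding linear_functional_def by (simp add: lins algebra_simps)
        show "ZF (polyX ^ n) = c * z (polyX ^ n) + d * poly (polyX ^ n) tau" for n
        proof -
          consider "n = 0" | "n = 1" | m where "n = Suc (Suc m)"
            by (metis One_nat_def not0_implies_Suc)
          then show ?thesis
          proof cases
            case 3
            then show ?thesis
              using XF[of "polyX ^ m"] XK[of "polyX ^ m"] True by (simp add: K_def)
          qed (simp_all add: d_def Z1 True)
        qed
      qed
      show thesis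
      proof (rule result)
        show "XF r = c * z (polyX * (polyX * r)) + d * (psi\<^sup>2 * poly r tau)" for r
          by (simp add: XK K_def psi)
        show "YF r = d * (psi * poly r tau)" "YG r = d * (psi * poly r tau)" for r
          by (simp_all add: YG YF psi)
      qed (rule ZF)
    qed
  qed
qed

end

section \<open>Matrices of measures given by densities\<close>

lemma integrable_matrixI:
  fixes w :: "real \<Rightarrow> complex^2^2"
  assumes "\<And>k l. integrable N (\<lambda>t. w t $ k $ l)"
  shows "integrable N w"
proof -
  have "integrable N (\<lambda>t. \<Sum>k\<in>UNIV. \<Sum>l\<in>UNIV. axis k (axis l (w t $ k $ l)))"
  proof (intro Bochner_Integration.integrable_sum)
    fix k l
    have "linear (\<lambda>z::complex. axis k (axis l z) :: complex^2^2)"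
      by (intro linearI) (simp_all add: vec_eq_iff axis_def)
    then have "bounded_linear (\<lambda>z::complex. axis k (axis l z) :: complex^2^2)"
      by (simp add: linear_conv_bounded_linear)
    then show "integrable N (\<lambda>t. axis k (axis l (w t $ k $ l)))"
      using assms[of k l] by (rule integrable_bounded_linear)
  qed
  moreover have "w = (\<lambda>t. \<Sum>k\<in>UNIV. \<Sum>l\<in>UNIV. axis k (axis l (w t $ k $ l)))"
    by (auto simp: fun_eq_iff vec_eq_iff axis_def sum_2 forall_2)
  ultimately show ?thesis
    by simp
qed

lemma qform_scaleR: "qform (c *\<^sub>R A) v = c *\<^sub>R qform A v"
  by (rule linear_scale[OF bounded_linear.linear[OF bounded_linear_qform]])

lemma borel_measurable_poly_of_real:
  "(\<lambda>t. poly p (complex_of_real t)) \<in> borel_measurable borel"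
  by (intro borel_measurable_continuous_onI continuous_intros)

text \<open>The matrix of measures \<open>w dN\<close>.\<close>

definition weighted :: "real measure \<Rightarrow> (real \<Rightarrow> complex^2^2) \<Rightarrow> real set \<Rightarrow> complex^2^2" where
  "weighted N w A = (if A \<in> sets borel then LINT t:A|N. w t else 0)"

context
  fixes N :: "real measure" and w :: "real \<Rightarrow> complex^2^2"
  assumes sets: "sets N = sets borel" and int: "integrable N w" and psd: "\<And>t. psd (w t)"
begin

lemma set_integrable_weighted: "A \<in> sets borel \<Longrightarrow> integrable N (\<lambda>t. indicator A t *\<^sub>R w t)"
  using int sets by (intro integrable_mult_indicator) simp_all

lemma qform_weighted:
  assumes "A \<in> sets borel"
  shows "qform (weighted N w A) v = (\<integral>t. indicator A t *\<^sub>R qform (w t) v \<partial>N)"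
proof -
  have "qform (indicator A t *\<^sub>R w t) v = indicator A t *\<^sub>R qform (w t) v" for t
    by (rule qform_scaleR)
  then show ?thesis
    using integral_bounded_linear[OF bounded_linear_qform[of v] set_integrable_weighted[OF assms]] assms
    by (simp add: weighted_def set_lebesgue_integral_def)
qed

lemma integrable_qform: "integrable N (\<lambda>t. Re (qform (w t) v))"
  by (intro integrable_Re integrable_bounded_linear[OF bounded_linear_qform] int)

lemma qform_weighted_real:
  assumes "A \<in> sets borel"
  shows "qform (weighted N w A) v = of_real (\<integral>t. indicator A t * Re (qform (w t) v) \<partial>N)"
proof -
  have "indicator A t *\<^sub>R qform (w t) v = of_real (indicator A t * Re (qform (w t) v))" for t
    using psd_qform[OF psd, of t v] by (simp add: complex_eq_iff indicator_def)
  then show ?thesis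
    unfolding qform_weighted[OF assms] by (simp only: integral_complex_of_real)
qed

lemma weighted_sums:
  assumes A: "range A \<subseteq> sets borel" "disjoint_family A"
  shows "(\<lambda>n. weighted N w (A n)) sums weighted N w (\<Union>n. A n)"
proof -
  let ?f = "\<lambda>i t. indicator (A i) t *\<^sub>R w t"
  have A': "A n \<in> sets borel" for n
    using A(1) by auto
  have ind: "(\<lambda>i. indicator (A i) t :: real) sums indicator (\<Union>i. A i) t" for t
    using A(2) by (intro indicator_sums) (auto simp: disjoint_family_on_def)
  have int_n: "integrable N (?f i)" for i
    by (rule set_integrable_weighted[OF A'])
  have sum_le: "(\<Sum>i\<le>n. indicator (A i) t) \<le> (1 :: real)" for n t
  proof -
    have "(\<Sum>i\<le>n. indicator (A i) t) \<le> (\<Sum>i. indicator (A i) t :: real)"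
      using ind[of t] by (intro sum_le_suminf) (auto simp: sums_iff)
    also have "\<dots> \<le> 1"
      using ind[of t] by (simp add: sums_iff indicator_def)
    finally show ?thesis .
  qed
  have "(\<lambda>i. integral\<^sup>L N (?f i)) sums (\<integral>t. (\<Sum>i. ?f i t) \<partial>N)"
  proof (rule sums_integral[OF int_n])
    show "AE t in N. summable (\<lambda>i. norm (?f i t))"
      using ind by (intro AE_I2) (auto intro!: summable_mult2 simp: sums_iff)
    show "summable (\<lambda>i. \<integral>t. norm (?f i t) \<partial>N)"
    proof (rule bounded_imp_summable)
      show "(\<Sum>i\<le>n. \<integral>t. norm (?f i t) \<partial>N) \<le> (\<integral>t. norm (w t) \<partial>N)" for n
      proof -
        have "(\<Sum>i\<le>n. \<integral>t. norm (?f i t) \<partial>N) = (\<integral>t. (\<Sum>i\<le>n. norm (?f i t)) \<partial>N)"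
          by (subst Bochner_Integration.integral_sum) (rule integrable_norm[OF int_n], rule refl)
        also have "\<dots> \<le> (\<integral>t. norm (w t) \<partial>N)"
        proof (rule integral_mono)
          show "integrable N (\<lambda>t. \<Sum>i\<le>n. norm (?f i t))"
            using int_n by (intro Bochner_Integration.integrable_sum integrable_norm) 
          show "integrable N (\<lambda>t. norm (w t))"
            using int by (rule integrable_norm)
          show "(\<Sum>i\<le>n. norm (?f i t)) \<le> norm (w t)" for t
            using mult_right_mono[OF sum_le[of t n], of "norm (w t)"] by (simp add: sum_distrib_right)
        qed
        finally show ?thesis .
      qed
    qed simp
  qed
  moreover have "(\<Sum>i. ?f i t) = indicator (\<Union>i. A i) t *\<^sub>R w t" for t
    using sums_scaleR_left[OF ind[of t], of "w t"] by (simp add: sums_iff)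
  ultimately show ?thesis
    using A' by (simp add: weighted_def set_lebesgue_integral_def)
qed

lemma psd_measure_weighted: "psd_measure (weighted N w)"
  unfolding psd_measure_def matrix_of_measures_def
proof (intro conjI allI impI ballI)
  fix A :: "real set"
  assume A: "A \<in> sets borel"
  have entry: "weighted N w A $ k $ l = (\<integral>t. indicator A t *\<^sub>R (w t $ k $ l) \<partial>N)" for k l
  proof -
    have "bounded_linear (\<lambda>B :: complex^2^2. B $ k $ l)"
      by (intro bounded_linear_compose[OF bounded_linear_vec_nth] bounded_linear_vec_nth)
    from integral_bounded_linear[OF this set_integrable_weighted[OF A]] show ?thesis
      using A by (simp add: weighted_def set_lebesgue_integral_def)
  qed
  have "cnj (weighted N w A $ l $ k) = weighted N w A $ k $ l" for k l
  proof -
    have "cnj (indicator A t *\<^sub>R (w t $ l $ k)) = indicator A t *\<^sub>R (w t $ k $ l)" for t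
      using psd_hermitian[OF psd, of t k l] by simp
    then show ?thesis
      unfolding entry Bochner_Integration.integral_cnj[symmetric] by (simp only:)
  qed
  then have "ctranspose (weighted N w A) = weighted N w A"
    by (simp add: ctranspose_def transpose_def map_matrix_def vec_eq_iff)
  moreover have "qform (weighted N w A) v \<in> \<real>\<^sub>\<ge>\<^sub>0" for v
  proof -
    have "0 \<le> (\<integral>t. indicator A t * Re (qform (w t) v) \<partial>N)"
      using psd_qform[OF psd] by (intro integral_nonneg_AE) simp
    then show ?thesis
      unfolding qform_weighted_real[OF A] by simp
  qed
  ultimately show "psd (weighted N w A)"
    by (simp add: psd_def qform_def)
next
  show "weighted N w A = 0" if "A \<notin> sets borel" for A
    using that by (simp add: weighted_def)
qed (rule weighted_sums)

lemma qmeasure_weighted: "qmeasure (weighted N w) v = density N (\<lambda>t. ennreal (Re (qform (w t) v)))"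
proof (rule measure_eqI)
  fix A :: "real set"
  assume "A \<in> sets (qmeasure (weighted N w) v)"
  then have A: "A \<in> sets borel" "A \<in> sets N"
    using sets by simp_all
  have nonneg: "0 \<le> Re (qform (w t) v)" for t
    using psd_qform[OF psd] by simp
  have "emeasure (density N (\<lambda>t. ennreal (Re (qform (w t) v)))) A
      = (\<integral>\<^sup>+ t. ennreal (Re (qform (w t) v)) * indicator A t \<partial>N)"
    using A borel_measurable_integrable[OF integrable_qform[of v]] by (intro emeasure_density) simp_all
  also have "\<dots> = (\<integral>\<^sup>+ t. ennreal (indicator A t * Re (qform (w t) v)) \<partial>N)"
    by (intro nn_integral_cong) (simp split: split_indicator)
  also have "\<dots> = ennreal (\<integral>t. indicator A t * Re (qform (w t) v) \<partial>N)"
    using nonneg integrable_mult_indicator[OF A(2) integrable_qform[of v]]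
    by (intro nn_integral_eq_integral) simp_all
  finally show "emeasure (qmeasure (weighted N w) v) A
      = emeasure (density N (\<lambda>t. ennreal (Re (qform (w t) v)))) A"
    by (simp add: emeasure_qmeasure[OF psd_measure_weighted A(1)] qform_weighted_real[OF A(1)])
qed (simp add: sets)

lemma measurable_weighted: "(f :: real \<Rightarrow> 'b::{banach, second_countable_topology}) \<in> borel_measurable borel
    \<Longrightarrow> f \<in> borel_measurable N"
  using measurable_cong_sets[OF sets refl] by blast

lemma integrable_qmeasure_weighted:
  fixes f :: "real \<Rightarrow> 'b::{banach, second_countable_topology}"
  assumes "f \<in> borel_measurable borel"
  shows "integrable (qmeasure (weighted N w) v) f \<longleftrightarrow> integrable N (\<lambda>t. Re (qform (w t) v) *\<^sub>R f t)"
  unfolding qmeasure_weighted using psd_qform[OF psd]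
  by (intro integrable_density measurable_weighted assms borel_measurable_integrable[OF integrable_qform] AE_I2) simp

lemma integral_qmeasure_weighted:
  fixes f :: "real \<Rightarrow> 'b::{banach, second_countable_topology}"
  assumes "f \<in> borel_measurable borel"
  shows "integral\<^sup>L (qmeasure (weighted N w) v) f = (\<integral>t. Re (qform (w t) v) *\<^sub>R f t \<partial>N)"
  unfolding qmeasure_weighted using psd_qform[OF psd]
  by (intro integral_density measurable_weighted assms borel_measurable_integrable[OF integrable_qform] AE_I2) simp

lemma moment_measure_weighted:
  assumes "\<And>n. integrable N (\<lambda>t. t ^ n *\<^sub>R w t)"
  shows "moment_measure (weighted N w)"
  unfolding moment_measure_def
proof (intro conjI allI psd_measure_weighted)
  fix v n
  have "integrable N (\<lambda>t. complex_of_real (Re (qform (t ^ n *\<^sub>R w t) v)))"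
    by (intro integrable_of_real integrable_Re integrable_bounded_linear[OF bounded_linear_qform] assms)
  moreover have "complex_of_real (Re (qform (t ^ n *\<^sub>R w t) v)) = Re (qform (w t) v) *\<^sub>R complex_of_real t ^ n" for t
    by (simp only: qform_scaleR) (simp add: scaleR_conv_of_real)
  ultimately show "integrable (qmeasure (weighted N w) v) (\<lambda>t. complex_of_real t ^ n)"
    by (subst integrable_qmeasure_weighted) simp_all
qed

lemma moment_fun_weighted:
  assumes mom: "\<And>n. integrable N (\<lambda>t. t ^ n *\<^sub>R w t)"
  shows "moment_fun (weighted N w) k l p = (\<integral>t. w t $ k $ l * poly p (of_real t) \<partial>N)"
proof -
  note mm = moment_measure_weighted[OF mom]
  note meas = borel_measurable_poly_of_real[of p]
  have int_v: "integrable N (\<lambda>t. Re (qform (w t) v) *\<^sub>R poly p (complex_of_real t))" for v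
    using integrable_poly_qmeasure[OF mm, of v p] by (simp add: integrable_qmeasure_weighted[OF meas])
  have pol: "w t $ k $ l * z =
      (Re (qform (w t) (pvec k l 1)) *\<^sub>R z - Re (qform (w t) (pvec k l (- 1))) *\<^sub>R z)
      + \<i> * (Re (qform (w t) (pvec k l (- \<i>))) *\<^sub>R z - Re (qform (w t) (pvec k l \<i>)) *\<^sub>R z)" for t z
  proof -
    have "w t $ k $ l = of_real (Re (w t $ k $ l)) + \<i> * of_real (Im (w t $ k $ l))"
      by (simp add: complex_eq_iff)
    then show ?thesis
      unfolding polarization[OF psd] scaleR_conv_of_real of_real_diff by algebra
  qed
  show ?thesis
    unfolding moment_fun_eq[OF mm] integral_qmeasure_weighted[OF meas] pol
    using int_v by simp
qed

end

text \<open>Densities with respect to Lebesgue measure and point masses are of this form.\<close>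

lemma density_mm_weighted: "density_mm w = weighted lborel w"
  by (simp add: density_mm_def weighted_def fun_eq_iff)

lemma dirac_mm_weighted: "dirac_mm x M = weighted (return borel x) (\<lambda>t. M)"
  by (auto simp: dirac_mm_def weighted_def fun_eq_iff set_lebesgue_integral_def integral_return)

lemma
  assumes "psd M"
  shows moment_measure_dirac: "moment_measure (dirac_mm x M)"
    and moment_fun_dirac: "moment_fun (dirac_mm x M) k l p = M $ k $ l * poly p (of_real x)"
    and integrable_qmeasure_dirac: "\<And>f :: real \<Rightarrow> real. f \<in> borel_measurable borel \<Longrightarrow>
      integrable (qmeasure (dirac_mm x M) v) f"
proof -
  have int: "integrable (return borel x) f" if "f \<in> borel_measurable borel"
    for f :: "real \<Rightarrow> 'b::{banach, second_countable_topology}"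
    using that by (intro integrableI_bounded) (simp_all add: nn_integral_return)
  have mom: "integrable (return borel x) (\<lambda>t. t ^ n *\<^sub>R M)" for n
    by (intro integrableI_bounded) (simp_all add: nn_integral_return)
  have const: "integrable (return borel x) (\<lambda>t. M)"
    using mom[of 0] by simp
  show "moment_measure (dirac_mm x M)"
    unfolding dirac_mm_weighted by (rule moment_measure_weighted) (use const mom assms in simp_all)
  show "moment_fun (dirac_mm x M) k l p = M $ k $ l * poly p (of_real x)"
    unfolding dirac_mm_weighted
    by (subst moment_fun_weighted) (use const mom assms in \<open>simp_all add: integral_return borel_measurable_poly_of_real\<close>)
  show "integrable (qmeasure (dirac_mm x M) v) f" if "f \<in> borel_measurable borel" for f :: "real \<Rightarrow> real"
    unfolding dirac_mm_weighted
    by (subst integrable_qmeasure_weighted) (use const assms that in \<open>simp_all add: int\<close>)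
qed

section \<open>The Laguerre functional\<close>

text \<open>The Laguerre weight \<open>t\<^sup>\<alpha> e\<^sup>-\<^sup>t\<close> on the positive half-line.\<close>

definition laguerre :: "real \<Rightarrow> real \<Rightarrow> real" where
  "laguerre \<alpha> t = indicator {0<..} t * (t powr \<alpha> * exp (- t))"

lemma laguerre_nonneg: "0 \<le> laguerre \<alpha> t"
  by (simp add: laguerre_def)

lemma integrable_powr_exp:
  assumes "-1 < b" "0 < c"
  shows "integrable lborel (\<lambda>t. indicator {0<..} t * (t powr b * exp (- (c * t))) :: real)"
proof -
  let ?f = "\<lambda>t. complex_of_real t powr (of_real (b + 1) - 1) / of_real (exp (c * t))"
  have "?f absolutely_integrable_on {0<..}"
    using assms by (intro absolutely_integrable_Gamma_integral) simp_all
  then have "(\<lambda>t. norm (?f t)) absolutely_integrable_on {0<..}"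
    using absolutely_integrable_norm by (simp only: o_def)
  then have "integrable lebesgue (\<lambda>t. indicator {0<..} t *\<^sub>R norm (?f t))"
    by (simp only: set_integrable_def)
  moreover have "indicator {0<..} t *\<^sub>R norm (?f t) = indicator {0<..} t * (t powr b * exp (- (c * t)))" for t :: real
    by (cases "0 < t") (simp_all add: norm_mult norm_inverse norm_powr_real_powr exp_minus divide_inverse)
  ultimately have "integrable lebesgue (\<lambda>t. indicator {0<..} t * (t powr b * exp (- (c * t))) :: real)"
    by (simp only:)
  then show ?thesis
    by (subst (asm) integrable_completion) simp_all
qed

lemma laguerre_power:
  "laguerre \<alpha> t * exp ((1 - c) * t) * t ^ n = indicator {0<..} t * (t powr (\<alpha> + n) * exp (- (c * t)))"
proof (cases "0 < t")
  case True
  have "exp (- t) * exp ((1 - c) * t) = exp (- (c * t))"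
    by (simp add: algebra_simps flip: exp_add)
  then show ?thesis
    using True by (simp add: laguerre_def powr_add powr_realpow mult_ac)
qed (simp add: laguerre_def)

lemma integrable_laguerre_exp_poly:
  assumes "-1 < \<alpha>" "0 < c"
  shows "integrable lborel (\<lambda>t. of_real (laguerre \<alpha> t * exp ((1 - c) * t)) * poly p (complex_of_real t))"
proof -
  have "integrable lborel (\<lambda>t. coeff p i * complex_of_real (laguerre \<alpha> t * exp ((1 - c) * t) * t ^ i))" for i
    unfolding laguerre_power using assms
    by (intro integrable_mult_right integrable_of_real integrable_powr_exp) simp_all
  then have "integrable lborel (\<lambda>t. \<Sum>i\<le>degree p. coeff p i * complex_of_real (laguerre \<alpha> t * exp ((1 - c) * t) * t ^ i))"
    by (intro Bochner_Integration.integrable_sum)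
  then show ?thesis
    by (simp add: poly_altdef sum_distrib_left mult_ac)
qed

lemma integrable_laguerre_poly:
  assumes "-1 < \<alpha>"
  shows "integrable lborel (\<lambda>t. of_real (laguerre \<alpha> t) * poly p (complex_of_real t))"
  using integrable_laguerre_exp_poly[OF assms, of 1 p] by simp

text \<open>Integration of polynomials against the Laguerre weight.\<close>

definition laguerre_fun :: "real \<Rightarrow> complex poly \<Rightarrow> complex" where
  "laguerre_fun \<alpha> p = (\<integral>t. of_real (laguerre \<alpha> t) * poly p (of_real t) \<partial>lborel)"

lemma linear_functional_laguerre:
  assumes "-1 < \<alpha>"
  shows "linear_functional (laguerre_fun \<alpha>)"
  unfolding linear_functional_def laguerre_fun_def
proof (intro conjI allI)
  fix p q :: "complex poly" and c :: complex
  show "(\<integral>t. of_real (laguerre \<alpha> t) * poly (p + q) (of_real t) \<partial>lborel)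
      = (\<integral>t. of_real (laguerre \<alpha> t) * poly p (of_real t) \<partial>lborel)
        + (\<integral>t. of_real (laguerre \<alpha> t) * poly q (of_real t) \<partial>lborel)"
    using integrable_laguerre_poly[OF assms] by (simp add: distrib_left)
  show "(\<integral>t. of_real (laguerre \<alpha> t) * poly (smult c p) (of_real t) \<partial>lborel)
      = c * (\<integral>t. of_real (laguerre \<alpha> t) * poly p (of_real t) \<partial>lborel)"
    by (simp add: mult.left_commute)
qed

lemma laguerre_fun_power:
  assumes "-1 < \<alpha>"
  shows "laguerre_fun \<alpha> (polyX ^ n) = of_real (Gamma (\<alpha> + 1 + n))"
proof -
  let ?f = "\<lambda>t. indicator {0<..} t * (t powr (\<alpha> + n) * exp (- t)) :: real"
  have "integrable lborel ?f"
    using integrable_powr_exp[of "\<alpha> + n" 1] assms by simp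
  then have "(?f has_integral (integral\<^sup>L lborel ?f)) UNIV"
    by (rule has_integral_integral_lborel)
  moreover have "(?f has_integral Gamma (\<alpha> + 1 + n)) UNIV"
  proof -
    have "((\<lambda>t. t powr (\<alpha> + 1 + n - 1) / exp t) has_integral Gamma (\<alpha> + 1 + n)) {0..}"
      using assms by (intro Gamma_integral_real) simp
    then have "((\<lambda>t. if t \<in> {0..} then t powr (\<alpha> + 1 + n - 1) / exp t else 0) has_integral Gamma (\<alpha> + 1 + n)) UNIV"
      by (simp only: has_integral_restrict_UNIV)
    moreover have "(if t \<in> {0..} then t powr (\<alpha> + 1 + n - 1) / exp t else 0) = ?f t" for t
      by (cases "t = 0") (auto simp: indicator_def exp_minus divide_inverse)
    ultimately show ?thesis
      by simp
  qed
  ultimately have "integral\<^sup>L lborel ?f = Gamma (\<alpha> + 1 + n)"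
    by (rule has_integral_unique)
  moreover have "of_real (laguerre \<alpha> t) * poly (polyX ^ n) (complex_of_real t) = of_real (?f t)" for t
    using laguerre_power[of \<alpha> t 1 n] by (simp flip: of_real_power of_real_mult)
  ultimately show ?thesis
    unfolding laguerre_fun_def by (simp only: integral_complex_of_real)
qed

lemma laguerre_fun_1:
  assumes "-1 < \<alpha>"
  shows "laguerre_fun \<alpha> 1 = of_real (Gamma (\<alpha> + 1))" "0 < Gamma (\<alpha> + 1)"
  using laguerre_fun_power[OF assms, of 0] assms by (simp_all add: Gamma_real_pos)

lemma pearson_laguerre:
  assumes "-1 < \<alpha>"
  shows "pearson (of_real \<alpha> + 1) (laguerre_fun \<alpha>)"
  unfolding pearson_def
proof
  fix r
  note lins = linear_functionalD[OF linear_functional_laguerre[OF assms]]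
  let ?L = "\<lambda>r. laguerre_fun \<alpha> (polyX * pderiv r) + (of_real \<alpha> + 1) * laguerre_fun \<alpha> r
      - laguerre_fun \<alpha> (polyX * r)"
  have "linear_functional ?L"
    unfolding linear_functional_def
    by (simp add: lins pderiv_add pderiv_smult distrib_left) (simp add: algebra_simps)
  moreover have "linear_functional (\<lambda>r. 0)"
    by (simp add: linear_functional_def)
  moreover have "?L (polyX ^ n) = 0" for n
  proof -
    have "Gamma (\<alpha> + 1 + n + 1) = (\<alpha> + 1 + n) * Gamma (\<alpha> + 1 + n)"
      using assms by (intro Gamma_plus1) (auto elim!: nonpos_Ints_cases)
    then have "laguerre_fun \<alpha> (polyX ^ Suc n) = (\<alpha> + 1 + n) * laguerre_fun \<alpha> (polyX ^ n)"
      unfolding laguerre_fun_power[OF assms] by (simp add: add_ac)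
    then show ?thesis
      by (simp add: pderiv_polyX_power lins) (simp add: algebra_simps)
  qed
  ultimately show "?L r = 0"
    by (rule linear_functional_eqI)
qed

lemma laguerre_fun_square:
  "laguerre_fun \<alpha> (p * map_poly cnj p) = of_real (\<integral>t. laguerre \<alpha> t * (cmod (poly p (of_real t)))\<^sup>2 \<partial>lborel)"
proof -
  have "of_real (laguerre \<alpha> t) * poly (p * map_poly cnj p) (complex_of_real t)
      = of_real (laguerre \<alpha> t * (cmod (poly p (of_real t)))\<^sup>2)" for t
    by (simp only: of_real_mult complex_norm_square) simp
  then show ?thesis
    unfolding laguerre_fun_def by (simp only: integral_complex_of_real)
qed

lemma laguerre_fun_square_nonneg:
  "0 \<le> Re (laguerre_fun \<alpha> (p * map_poly cnj p))"
  unfolding laguerre_fun_square by (simp_all add: laguerre_nonneg integral_nonneg_AE)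

lemma laguerre_fun_square_eq_0:
  assumes \<alpha>: "-1 < \<alpha>" and zero: "Re (laguerre_fun \<alpha> (p * map_poly cnj p)) = 0"
  shows "p = 0"
proof (rule ccontr)
  assume p: "p \<noteq> 0"
  let ?f = "\<lambda>t. laguerre \<alpha> t * (cmod (poly p (of_real t)))\<^sup>2"
  have "integrable lborel (\<lambda>t. Re (of_real (laguerre \<alpha> t) * poly (p * map_poly cnj p) (complex_of_real t)))"
    by (intro integrable_Re integrable_laguerre_poly \<alpha>)
  moreover have "Re (of_real (laguerre \<alpha> t) * poly (p * map_poly cnj p) (complex_of_real t)) = ?f t" for t
    by (simp add: cmod_power2) (simp add: power2_eq_square)
  ultimately have "integrable lborel ?f"
    by (simp only:)
  moreover have "integral\<^sup>L lborel ?f = 0"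
    using zero by (simp add: laguerre_fun_square)
  ultimately have "AE t in lborel. ?f t = 0"
    using integral_nonneg_eq_0_iff_AE[of lborel ?f] by (simp add: laguerre_nonneg)
  moreover have "AE t in lborel. t \<notin> {t. poly p (complex_of_real t) = 0}"
  proof (rule AE_not_in)
    have "{t. poly p (complex_of_real t) = 0} = complex_of_real -` {x. poly p x = 0}"
      by auto
    moreover have "finite (complex_of_real -` {x. poly p x = 0})"
      using poly_roots_finite[OF p] by (rule finite_vimageI) (simp add: inj_def)
    ultimately show "{t. poly p (complex_of_real t) = 0} \<in> null_sets lborel"
      by (simp add: countable_finite countable_imp_null_set_lborel)
  qed
  ultimately have "AE t in lborel. t \<notin> {0<..<1::real}"
    by eventually_elim (auto simp: laguerre_def)
  then have "{0<..<1::real} \<in> null_sets lborel"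
    by (subst AE_iff_null_sets) simp_all
  then have "emeasure lborel {0<..<1::real} = 0"
    by (rule null_setsD1)
  then show False
    by simp
qed

section \<open>The weight matrix\<close>

text \<open>
  The polynomial \<open>a (t - 1)\<close>, the polynomial matrix \<open>wpoly\<close> with \<open>W = t\<^sup>\<alpha> e\<^sup>-\<^sup>t wpoly\<close>, and the
  density \<open>W\<close> itself, extended by zero.
\<close>

definition bpoly :: "complex \<Rightarrow> complex poly" where "bpoly a = smult a polyX - smult a 1"

definition wpoly :: "complex \<Rightarrow> 2 \<Rightarrow> 2 \<Rightarrow> complex poly" where
  "wpoly a k l = (if k = 1 then if l = 1 then polyX * polyX + bpoly a * bpoly a else bpoly a
    else if l = 1 then bpoly a else 1)"

definition weight_density :: "real \<Rightarrow> real \<Rightarrow> real \<Rightarrow> complex^2^2" where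
  "weight_density a \<alpha> t = indicator {0<..} t *\<^sub>R map_matrix complex_of_real (Wd a \<alpha> t)"

lemma mat2_nth [simp]:
  "mat2 x11 x12 x21 x22 $ 1 $ 1 = x11" "mat2 x11 x12 x21 x22 $ 1 $ 2 = x12"
  "mat2 x11 x12 x21 x22 $ 2 $ 1 = x21" "mat2 x11 x12 x21 x22 $ 2 $ 2 = x22"
  by (simp_all add: mat2_def)

lemma poly_bpoly [simp]: "poly (bpoly a) x = a * (x - 1)"
  by (simp add: bpoly_def algebra_simps)

lemma weight_density_nth:
  "weight_density a \<alpha> t $ k $ l = of_real (laguerre \<alpha> t) * poly (wpoly a k l) (of_real t)"
proof -
  consider "k = 1" "l = 1" | "k = 1" "l = 2" | "k = 2" "l = 1" | "k = 2" "l = 2"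
    using exhaust_2 by metis
  then show ?thesis
    by cases (simp_all add: weight_density_def map_matrix_def Wd_def laguerre_def wpoly_def
        power2_eq_square indicator_def)
qed

text \<open>Both the density and the mass have a Hermitian form that is visibly a sum of squares.\<close>

lemma complex_psd_sum_of_squares:
  assumes "A $ 1 $ 2 = of_real y" "A $ 2 $ 1 = of_real y" "A $ 2 $ 2 = of_real z" "A $ 1 $ 1 = of_real x"
    and eq: "\<And>v. qform A v = of_real (r * (e * (cmod (v $ 1))\<^sup>2 + (cmod (of_real b * v $ 1 + v $ 2))\<^sup>2))"
    and "0 \<le> r" "0 \<le> e"
  shows "psd A"
proof -
  have "qform A v \<in> \<real>\<^sub>\<ge>\<^sub>0" for v
    unfolding eq nonneg_Reals_of_real_iff using assms(6,7) by simp
  then show ?thesis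
    using assms(1-4) by (simp add: psd_def qform_def ctranspose_def transpose_def map_matrix_def vec_eq_iff forall_2)
qed

lemma psd_weight_density: "psd (weight_density a \<alpha> t)"
proof (rule complex_psd_sum_of_squares)
  show "qform (weight_density a \<alpha> t) v = of_real (laguerre \<alpha> t *
      (t\<^sup>2 * (cmod (v $ 1))\<^sup>2 + (cmod (of_real (a * (t - 1)) * v $ 1 + v $ 2))\<^sup>2))" for v
    unfolding of_real_mult of_real_add complex_norm_square
    by (simp add: qform_expand weight_density_nth wpoly_def power2_eq_square algebra_simps)
  show "weight_density a \<alpha> t $ 1 $ 2 = of_real (laguerre \<alpha> t * (a * (t - 1)))"
    "weight_density a \<alpha> t $ 2 $ 1 = of_real (laguerre \<alpha> t * (a * (t - 1)))"
    "weight_density a \<alpha> t $ 2 $ 2 = of_real (laguerre \<alpha> t)"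
    "weight_density a \<alpha> t $ 1 $ 1 = of_real (laguerre \<alpha> t * (t * t + a * (t - 1) * (a * (t - 1))))"
    by (simp_all add: weight_density_nth wpoly_def)
qed (simp_all add: laguerre_nonneg)

lemma psd_mass: "psd (map_matrix complex_of_real (M_mass s a \<alpha> t\<^sub>0))"
proof (rule complex_psd_sum_of_squares)
  show "qform (map_matrix complex_of_real (M_mass s a \<alpha> t\<^sub>0)) v = of_real (1 *
      (0 * (cmod (v $ 1))\<^sup>2 + (cmod (of_real (phi s a \<alpha> t\<^sub>0) * v $ 1 + v $ 2))\<^sup>2))" for v
    unfolding of_real_mult of_real_add complex_norm_square
    by (simp add: qform_expand map_matrix_def M_mass_def Let_def power2_eq_square algebra_simps)
qed (simp_all add: map_matrix_def M_mass_def Let_def flip: of_real_power)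

lemma integrable_weight_density_exp:
  assumes "-1 < \<alpha>" "0 < c"
  shows "integrable lborel (\<lambda>t. (exp ((1 - c) * t) * t ^ n) *\<^sub>R weight_density a \<alpha> t)"
proof (rule integrable_matrixI)
  fix k l
  have "((exp ((1 - c) * t) * t ^ n) *\<^sub>R weight_density a \<alpha> t) $ k $ l
      = of_real (laguerre \<alpha> t * exp ((1 - c) * t)) * poly (polyX ^ n * wpoly a k l) (of_real t)" for t
    unfolding vector_scaleR_component weight_density_nth by (simp add: scaleR_conv_of_real mult_ac)
  then show "integrable lborel (\<lambda>t. ((exp ((1 - c) * t) * t ^ n) *\<^sub>R weight_density a \<alpha> t) $ k $ l)"
    using integrable_laguerre_exp_poly[OF assms] by (simp only:)
qed

context
  fixes a \<alpha> :: real
  assumes \<alpha>: "-1 < \<alpha>"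
begin

lemma integrable_weight_density: "integrable lborel (\<lambda>t. t ^ n *\<^sub>R weight_density a \<alpha> t)"
  using integrable_weight_density_exp[OF \<alpha>, of 1 n a] by simp

lemma integrable_weight_density_0: "integrable lborel (weight_density a \<alpha>)"
  using integrable_weight_density[of 0] by simp

lemma moment_measure_weight: "moment_measure (density_mm (weight_density a \<alpha>))"
  unfolding density_mm_weighted
  by (rule moment_measure_weighted)
    (simp_all add: integrable_weight_density integrable_weight_density_0 psd_weight_density)

lemma moment_fun_weight:
  "moment_fun (density_mm (weight_density a \<alpha>)) k l p = laguerre_fun \<alpha> (wpoly a k l * p)"
  unfolding density_mm_weighted laguerre_fun_def
  by (subst moment_fun_weighted)
    (simp_all add: integrable_weight_density integrable_weight_density_0 psd_weight_density
      weight_density_nth mult.assoc)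

lemma exp_integrable_weight:
  "integrable (qmeasure (density_mm (weight_density a \<alpha>)) v) (\<lambda>t. exp (1 / 2 * \<bar>t\<bar>))"
proof -
  have meas: "(\<lambda>t::real. exp (1 / 2 * \<bar>t\<bar>)) \<in> borel_measurable borel"
    by measurable
  have "integrable lborel (\<lambda>t. exp ((1 - 1 / 2) * t) *\<^sub>R weight_density a \<alpha> t)"
    using integrable_weight_density_exp[OF \<alpha>, of "1 / 2" 0 a] by simp
  then have "integrable lborel (\<lambda>t. Re (qform (exp ((1 - 1 / 2) * t) *\<^sub>R weight_density a \<alpha> t) v))"
    by (intro integrable_Re integrable_bounded_linear[OF bounded_linear_qform])
  moreover have "Re (qform (exp ((1 - 1 / 2) * t) *\<^sub>R weight_density a \<alpha> t) v)
      = Re (qform (weight_density a \<alpha> t) v) *\<^sub>R exp (1 / 2 * \<bar>t\<bar>)" for t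
  proof (cases "0 < t")
    case True
    then show ?thesis
      by (simp only: qform_scaleR) (simp add: mult.commute)
  next
    case False
    then show ?thesis
      by (simp add: weight_density_def qform_expand)
  qed
  ultimately show ?thesis
    unfolding density_mm_weighted
    by (subst integrable_qmeasure_weighted[OF _ _ _ meas])
      (simp_all add: integrable_weight_density_0 psd_weight_density)
qed

end

section \<open>The operator after conjugation\<close>

text \<open>
  The values \<open>\<psi>\<close> and \<open>\<kappa>\<close> for the operator of the theorem.  The sign \<open>s\<close> of the square root selects
  which root of the quadratic equation \<open>\<psi> (\<psi> - \<sigma>) = t\<^sub>0\<^sup>2\<close> is \<open>\<psi>\<close>, where
  \<open>\<sigma> = (t\<^sub>0 + \<alpha> + 1) / a + a (\<alpha> + 1 - t\<^sub>0)\<close>.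
\<close>

definition psi :: "real \<Rightarrow> real \<Rightarrow> real \<Rightarrow> real \<Rightarrow> real" where
  "psi s a \<alpha> t\<^sub>0 = phi s a \<alpha> t\<^sub>0 - a * (t\<^sub>0 - 1)"

definition kappa :: "real \<Rightarrow> real \<Rightarrow> real \<Rightarrow> real \<Rightarrow> real" where
  "kappa s a \<alpha> t\<^sub>0 = psi s a \<alpha> t\<^sub>0 - ((t\<^sub>0 + \<alpha> + 1) / a + a * (\<alpha> + 1 - t\<^sub>0))"

lemma kappa_psi:
  assumes "a \<noteq> 0" and "\<alpha> > -1" and "s \<in> {1, -1}"
  shows "kappa s a \<alpha> t\<^sub>0 * psi s a \<alpha> t\<^sub>0 = t\<^sub>0\<^sup>2" and "kappa s a \<alpha> t\<^sub>0 + psi s a \<alpha> t\<^sub>0 \<noteq> 0"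
proof -
  define R where "R = (a^2 + 1) * (a^2 * (t\<^sub>0 - \<alpha> - 1)^2 + (t\<^sub>0 + \<alpha> + 1)^2)"
  define S where "S = s * sqrt R"
  define u where "u = t\<^sub>0 + \<alpha> + 1 + a\<^sup>2 * (\<alpha> + 1 - t\<^sub>0)"
  have "0 < a\<^sup>2 * (t\<^sub>0 - \<alpha> - 1)\<^sup>2 + (t\<^sub>0 + \<alpha> + 1)\<^sup>2"
  proof (cases "t\<^sub>0 - \<alpha> - 1 = 0")
    case True
    then have "0 < (t\<^sub>0 + \<alpha> + 1)\<^sup>2"
      using assms by simp
    then show ?thesis
      by (intro add_nonneg_pos) simp_all
  next
    case False
    then show ?thesis
      using assms by (intro add_pos_nonneg) simp_all
  qed
  then have R: "0 < R"
    unfolding R_def by (intro mult_pos_pos) (simp_all add: add_nonneg_pos)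
  then have S: "S\<^sup>2 = R"
    using assms(3) by (auto simp: S_def power_mult_distrib)
  have psi: "psi s a \<alpha> t\<^sub>0 = (u + S) / (2 * a)"
    using assms(1) by (simp add: psi_def phi_def u_def S_def R_def field_simps power2_eq_square)
  have "(t\<^sub>0 + \<alpha> + 1) / a + a * (\<alpha> + 1 - t\<^sub>0) = u / a"
    using assms(1) by (simp add: u_def field_simps power2_eq_square)
  then have kappa: "kappa s a \<alpha> t\<^sub>0 = (S - u) / (2 * a)"
    using assms(1) by (simp add: kappa_def psi field_simps)
  have "R = u\<^sup>2 + 4 * a\<^sup>2 * t\<^sub>0\<^sup>2"
    unfolding R_def u_def by algebra
  then have "(S - u) * (S + u) = 4 * a\<^sup>2 * t\<^sub>0\<^sup>2"
    using S by algebra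
  then have "(S - u) * (u + S) = 4 * a\<^sup>2 * t\<^sub>0\<^sup>2"
    by (simp only: add.commute)
  then show "kappa s a \<alpha> t\<^sub>0 * psi s a \<alpha> t\<^sub>0 = t\<^sub>0\<^sup>2"
    using assms(1) unfolding psi kappa by (simp add: power2_eq_square)
  have "S \<noteq> 0"
    using R S by auto
  then show "kappa s a \<alpha> t\<^sub>0 + psi s a \<alpha> t\<^sub>0 \<noteq> 0"
    using assms(1) unfolding psi kappa by (simp add: field_simps)
qed

lemma operator_parameters_real:
  assumes "a \<noteq> 0" and "\<alpha> > -1" and "s \<in> {1, -1}"
  shows "operator_parameters (of_real a) (of_real \<alpha>) (of_real t\<^sub>0)
    (of_real (psi s a \<alpha> t\<^sub>0)) (of_real (kappa s a \<alpha> t\<^sub>0))"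
proof
  have ne: "complex_of_real x \<noteq> 0" if "x \<noteq> 0" for x
    using that by simp
  have "1 + a\<^sup>2 \<noteq> 0"
    by (metis add_nonneg_pos add.commute less_irrefl zero_le_power2 zero_less_one)
  then show "1 + (complex_of_real a)\<^sup>2 \<noteq> 0"
    using ne[of "1 + a\<^sup>2"] by simp
  show "complex_of_real \<alpha> + 1 \<noteq> 0" "complex_of_real \<alpha> + 2 \<noteq> 0" "complex_of_real \<alpha> + 3 \<noteq> 0"
    using ne[of "\<alpha> + 1"] ne[of "\<alpha> + 2"] ne[of "\<alpha> + 3"] assms by simp_all
  show "complex_of_real (kappa s a \<alpha> t\<^sub>0) * of_real (psi s a \<alpha> t\<^sub>0) = (of_real t\<^sub>0)\<^sup>2"
    using kappa_psi(1)[OF assms, of t\<^sub>0] by (metis of_real_mult of_real_power)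
  show "complex_of_real (kappa s a \<alpha> t\<^sub>0) + of_real (psi s a \<alpha> t\<^sub>0) \<noteq> 0"
    using ne[OF kappa_psi(2)[OF assms, of t\<^sub>0]] by simp
  show "complex_of_real (psi s a \<alpha> t\<^sub>0) - of_real (kappa s a \<alpha> t\<^sub>0)
      = (of_real t\<^sub>0 + of_real \<alpha> + 1) / of_real a + of_real a * (of_real \<alpha> + 1 - of_real t\<^sub>0)"
    by (simp add: kappa_def)
qed (use assms in simp)

lemma pderiv_map_poly_cnj: "pderiv (map_poly cnj p) = map_poly cnj (pderiv p)"
  by (rule poly_eqI) (simp add: coeff_pderiv coeff_map_poly)

lemma pderiv_bpoly_mult: "pderiv (bpoly a * p) = smult a p + bpoly a * pderiv p"
  by (simp add: bpoly_def pderiv_mult pderiv_diff pderiv_smult polyX_def pderiv_pCons algebra_simps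
      flip: one_pCons)

context
  fixes a \<alpha> t\<^sub>0 s :: real
  assumes params: "a \<noteq> 0" "\<alpha> > -1" "s \<in> {1, -1}"
begin

interpretation operator_parameters "of_real a" "of_real \<alpha>" "of_real t\<^sub>0"
    "of_real (psi s a \<alpha> t\<^sub>0)" "of_real (kappa s a \<alpha> t\<^sub>0)"
  by (rule operator_parameters_real[OF params])

abbreviation (input) "Bp \<equiv> bpoly (complex_of_real a)"
abbreviation (input) "cpsi \<equiv> complex_of_real (psi s a \<alpha> t\<^sub>0)"
abbreviation (input) "ckap \<equiv> complex_of_real (kappa s a \<alpha> t\<^sub>0)"
abbreviation (input) "ca \<equiv> complex_of_real a"
abbreviation (input) "cal \<equiv> complex_of_real \<alpha>"
abbreviation (input) "ct \<equiv> complex_of_real t\<^sub>0"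

text \<open>These identities eliminate \<open>\<phi>\<close> and the divisions by \<open>a\<close> from the coefficients of the operator.\<close>

lemma coefficient_identities:
  "phi s a \<alpha> t\<^sub>0 - (1 + (\<alpha> + t\<^sub>0) * (1 + a^2)) / a = kappa s a \<alpha> t\<^sub>0 - a * t\<^sub>0"
  "(t\<^sub>0 + \<alpha> + 1) / a = psi s a \<alpha> t\<^sub>0 - kappa s a \<alpha> t\<^sub>0 - a * (\<alpha> + 1 - t\<^sub>0)"
  "phi s a \<alpha> t\<^sub>0 = psi s a \<alpha> t\<^sub>0 + a * (t\<^sub>0 - 1)"
  using params(1) by (simp_all add: kappa_def psi_def field_simps power2_eq_square)

lemma poly_F2_op:
  "poly (F2_op s a \<alpha> t\<^sub>0 $ 1 $ 1) x = ca * ct + x * (ckap - ca * ct)"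
  "poly (F2_op s a \<alpha> t\<^sub>0 $ 1 $ 2) x = ca^2 * ct - x * (cal + ct + 1) * (1 + ca^2) + x^2 * (1 + ca^2) * (1 + cal)"
  "poly (F2_op s a \<alpha> t\<^sub>0 $ 2 $ 1) x = - ct"
  "poly (F2_op s a \<alpha> t\<^sub>0 $ 2 $ 2) x = - ca * ct + x * (cpsi + ca * ct)"
  unfolding F2_op_def Let_def coefficient_identities(1) unfolding coefficient_identities(3)
  by (simp_all add: mp_of_coeffs_def power2_eq_square algebra_simps)

lemma poly_F1_op:
  "poly (F1_op s a \<alpha> t\<^sub>0 $ 1 $ 1) x = - ca * (3 * ct - 2 + (cal + 1)^2)
    + (cal + 3) * (ckap + ca * cal) + x * (- ckap - ca * (cal + 1 - ct))"
  "poly (F1_op s a \<alpha> t\<^sub>0 $ 1 $ 2) x = 2 * ca * (cpsi + ca * (ct - 1)) - (1 + ca^2) * (cal^2 + 2 * ct + 3 * cal)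
    + cal * ct * (ca^2 - 1) - (ct + cal + 3)
    + x * ((1 + ca^2) * (cal^2 + 3 * cal - ct * cal + 2) + 2 * (cal + 1))"
  "poly (F1_op s a \<alpha> t\<^sub>0 $ 2 $ 1) x = ct - cal - 1"
  "poly (F1_op s a \<alpha> t\<^sub>0 $ 2 $ 2) x = (cpsi + ca * (ct - 1)) * (cal + 1) - ca * cal * ct
    + x * (- cpsi - ca * (ct - 1) + ca * cal)"
  unfolding F1_op_def Let_def coefficient_identities(2) unfolding coefficient_identities(3)
  by (simp_all add: mp_of_coeffs_def power2_eq_square algebra_simps)

lemma poly_F0_op:
  "poly (F0_op s a \<alpha> t\<^sub>0 $ 1 $ 1) x = d1 - ca * h - ca * (cal + 1 - ct)"
  "poly (F0_op s a \<alpha> t\<^sub>0 $ 1 $ 2) x = 1 + ca * cal * (cpsi + ca * (ct - 1))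
    - cal * (ct - 1) * (ca^2 + cal + 2) + h"
  "poly (F0_op s a \<alpha> t\<^sub>0 $ 2 $ 1) x = h"
  "poly (F0_op s a \<alpha> t\<^sub>0 $ 2 $ 2) x = d2 + ca * h"
proof -
  have hR: "h = of_real ((1 + \<alpha>) / (1 + a^2))"
    by (simp add: h_def add.commute)
  have d1R: "d1 = of_real (- psi s a \<alpha> t\<^sub>0 / 2 + (\<alpha> + 2) * (t\<^sub>0 + \<alpha> + 1) / (2 * a) + a * (\<alpha> + 1 - t\<^sub>0))"
    by (simp add: d1_def)
  have d2R: "d2 = of_real (psi s a \<alpha> t\<^sub>0 / 2 - (\<alpha> + 2) * (t\<^sub>0 + \<alpha> + 1) / (2 * a))"
    by (simp add: d2_def)
  have f: "- phi s a \<alpha> t\<^sub>0 / 2 + a * (t\<^sub>0 - 1) / 2 + (\<alpha> + 2) * (t\<^sub>0 + \<alpha> + 1) / (2 * a) - a * (1 + \<alpha>) / (1 + a^2)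
      = - psi s a \<alpha> t\<^sub>0 / 2 + (\<alpha> + 2) * (t\<^sub>0 + \<alpha> + 1) / (2 * a) - a * ((1 + \<alpha>) / (1 + a^2))"
    by (simp add: psi_def field_simps)
  show "poly (F0_op s a \<alpha> t\<^sub>0 $ 1 $ 1) x = d1 - ca * h - ca * (cal + 1 - ct)"
    unfolding F0_op_def Let_def f hR d1R by (simp add: mp_of_coeffs_def)
  show "poly (F0_op s a \<alpha> t\<^sub>0 $ 1 $ 2) x = 1 + ca * cal * (cpsi + ca * (ct - 1))
    - cal * (ct - 1) * (ca^2 + cal + 2) + h"
    unfolding F0_op_def Let_def f hR coefficient_identities(3) by (simp add: mp_of_coeffs_def)
  show "poly (F0_op s a \<alpha> t\<^sub>0 $ 2 $ 1) x = h"
    unfolding F0_op_def Let_def f hR by (simp add: mp_of_coeffs_def)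
  show "poly (F0_op s a \<alpha> t\<^sub>0 $ 2 $ 2) x = d2 + ca * h"
    unfolding F0_op_def Let_def f hR d2R by (simp add: mp_of_coeffs_def)
qed

text \<open>
  The substitution \<open>(p\<^sub>1, p\<^sub>2) \<mapsto> (p\<^sub>1, a (t - 1) p\<^sub>1 + p\<^sub>2)\<close> on the rows of a matrix polynomial
  carries the operator to the conjugated one.
\<close>

lemma D_op_nth:
  fixes P :: "2 matpoly" and i :: 2
  defines "u1 \<equiv> P $ i $ 1" and "u2 \<equiv> Bp * P $ i $ 1 + P $ i $ 2"
  shows "D_op s a \<alpha> t\<^sub>0 P $ i $ 1 = T1 u1 u2"
    and "D_op s a \<alpha> t\<^sub>0 P $ i $ 2 = T2 u1 u2 - Bp * T1 u1 u2"
proof -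
  have D: "D_op s a \<alpha> t\<^sub>0 P $ i $ j =
      pderiv (pderiv (P $ i $ 1)) * F2_op s a \<alpha> t\<^sub>0 $ 1 $ j + pderiv (pderiv (P $ i $ 2)) * F2_op s a \<alpha> t\<^sub>0 $ 2 $ j
      + (pderiv (P $ i $ 1) * F1_op s a \<alpha> t\<^sub>0 $ 1 $ j + pderiv (P $ i $ 2) * F1_op s a \<alpha> t\<^sub>0 $ 2 $ j)
      + (P $ i $ 1 * F0_op s a \<alpha> t\<^sub>0 $ 1 $ j + P $ i $ 2 * F0_op s a \<alpha> t\<^sub>0 $ 2 $ j)" for j
    by (simp add: D_op_def right_op_def matrix_matrix_mult_def sum_2 mp_deriv_def map_matrix_def)
  have u2': "pderiv u2 = smult ca (P $ i $ 1) + Bp * pderiv (P $ i $ 1) + pderiv (P $ i $ 2)"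
    by (simp add: u2_def pderiv_add pderiv_bpoly_mult)
  have u2'': "pderiv (pderiv u2) = smult (2 * ca) (pderiv (P $ i $ 1)) + Bp * pderiv (pderiv (P $ i $ 1))
      + pderiv (pderiv (P $ i $ 2))"
    unfolding u2' pderiv_add pderiv_bpoly_mult pderiv_smult mult_2 smult_add_left by (simp only: add.assoc)
  have D12: "d1 - d2 = - cpsi + (cal + 2) * (cpsi - ckap - ca * (cal + 1 - ct)) + ca * (cal + 1 - ct)"
    using a(1) unfolding d1_def d2_def diff by (simp add: field_simps power2_eq_square)
  show "D_op s a \<alpha> t\<^sub>0 P $ i $ 1 = T1 u1 u2"
    unfolding poly_eq_poly_eq_iff[symmetric] fun_eq_iff
  proof
    fix x
    show "poly (D_op s a \<alpha> t\<^sub>0 P $ i $ 1) x = poly (T1 u1 u2) x"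
      unfolding D T1_def u2'' unfolding u2' unfolding u1_def u2_def poly_add poly_diff poly_mult poly_smult poly_polyX
        poly_bpoly poly_F2_op poly_F1_op poly_F0_op by algebra
  qed
  show "D_op s a \<alpha> t\<^sub>0 P $ i $ 2 = T2 u1 u2 - Bp * T1 u1 u2"
    unfolding poly_eq_poly_eq_iff[symmetric] fun_eq_iff
  proof
    fix x
    show "poly (D_op s a \<alpha> t\<^sub>0 P $ i $ 2) x = poly (T2 u1 u2 - Bp * T1 u1 u2) x"
      using h_eq D12 diff_eq
      unfolding D T1_def T2_def u2'' unfolding u2' unfolding u1_def u2_def poly_add poly_diff poly_mult poly_smult poly_polyX
        poly_bpoly poly_F2_op poly_F1_op poly_F0_op by algebra
  qed
qed

lemma map_poly_cnj_T:
  "map_poly cnj (T1 p q) = T1 (map_poly cnj p) (map_poly cnj q)"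
  "map_poly cnj (T2 p q) = T2 (map_poly cnj p) (map_poly cnj q)"
  unfolding poly_eq_poly_eq_iff[symmetric] fun_eq_iff
  by (simp_all add: T1_def T2_def pderiv_map_poly_cnj d1_def d2_def h_def)

context
  fixes W :: "real set \<Rightarrow> complex^2^2"
  assumes W: "moment_measure W"
begin

abbreviation (input) "L \<equiv> moment_fun W"

text \<open>
  The entries of \<open>T\<^sup>-\<^sup>1 W T\<^sup>-\<^sup>*\<close>, as functionals on polynomials, where \<open>T\<close> is the unipotent matrix with
  rows \<open>(1, a (t - 1))\<close> and \<open>(0, 1)\<close>.
\<close>

definition XF where "XF r = L 1 1 r - L 1 2 (Bp * r) - L 2 1 (Bp * r) + L 2 2 (Bp * (Bp * r))"
definition YF where "YF r = L 1 2 r - L 2 2 (Bp * r)"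
definition YG where "YG r = L 2 1 r - L 2 2 (Bp * r)"
definition ZF where "ZF r = L 2 2 r"

lemmas lin_L = linear_functionalD[OF linear_functional_moment_fun[OF W]]

lemma linear_forms: "linear_functional XF" "linear_functional YF" "linear_functional YG" "linear_functional ZF"
  unfolding linear_functional_def XF_def YF_def YG_def ZF_def
  by (simp_all add: lin_L distrib_left) (simp_all add: algebra_simps)

lemma conjugate_form:
  "(\<Sum>k\<in>UNIV. \<Sum>l\<in>UNIV. L k l (p k * q l))
    = XF (p 1 * q 1) + YF (p 1 * (Bp * q 1 + q 2)) + YG ((Bp * p 1 + p 2) * q 1)
      + ZF ((Bp * p 1 + p 2) * (Bp * q 1 + q 2))"
  by (simp add: sum_2 XF_def YF_def YG_def ZF_def lin_L distrib_left distrib_right mult_ac)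

lemma mp_inner_form:
  "mp_inner P W Q $ i $ j =
    (let u1 = P $ i $ 1; u2 = Bp * P $ i $ 1 + P $ i $ 2;
         v1 = map_poly cnj (Q $ j $ 1); v2 = Bp * map_poly cnj (Q $ j $ 1) + map_poly cnj (Q $ j $ 2)
     in XF (u1 * v1) + YF (u1 * v2) + YG (u2 * v1) + ZF (u2 * v2))"
  unfolding mp_inner_moment_fun Let_def
  by (rule conjugate_form[of "\<lambda>k. P $ i $ k" "\<lambda>l. map_poly cnj (Q $ j $ l)"])

lemma map_poly_cnj_add: "map_poly cnj (p + q) = map_poly cnj p + map_poly cnj q"
  by (simp add: poly_eq_poly_eq_iff[symmetric] fun_eq_iff)

lemma map_poly_cnj_diff: "map_poly cnj (p - q) = map_poly cnj p - map_poly cnj q"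
  by (simp add: poly_eq_poly_eq_iff[symmetric] fun_eq_iff)

lemma map_poly_cnj_Bp: "map_poly cnj (Bp * p) = Bp * map_poly cnj p"
  by (simp add: poly_eq_poly_eq_iff[symmetric] fun_eq_iff)

lemma symmetric_wrt_iff: "symmetric_wrt (D_op s a \<alpha> t\<^sub>0) W \<longleftrightarrow> symmetric_form XF YF YG ZF"
proof
  assume sym: "symmetric_wrt (D_op s a \<alpha> t\<^sub>0) W"
  show "symmetric_form XF YF YG ZF"
    unfolding symmetric_form_def
  proof (intro allI)
    fix u1 u2 v1 v2
    define P :: "2 matpoly" where "P = (\<chi> i j. if j = 1 then u1 else u2 - Bp * u1)"
    define Q :: "2 matpoly" where
      "Q = (\<chi> i j. if j = 1 then map_poly cnj v1 else map_poly cnj v2 - Bp * map_poly cnj v1)"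
    have cnj2: "map_poly cnj (map_poly cnj p) = p" for p
      by (simp add: poly_eq_poly_eq_iff[symmetric] fun_eq_iff)
    have "mp_inner (D_op s a \<alpha> t\<^sub>0 P) W Q $ 1 $ 1 = mp_inner P W (D_op s a \<alpha> t\<^sub>0 Q) $ 1 $ 1"
      using sym by (simp add: symmetric_wrt_def)
    then show "XF (T1 u1 u2 * v1) + YF (T1 u1 u2 * v2) + YG (T2 u1 u2 * v1) + ZF (T2 u1 u2 * v2)
      = XF (u1 * T1 v1 v2) + YF (u1 * T2 v1 v2) + YG (u2 * T1 v1 v2) + ZF (u2 * T2 v1 v2)"
      by (simp add: mp_inner_form Let_def D_op_nth P_def Q_def map_poly_cnj_T map_poly_cnj_diff
          map_poly_cnj_Bp cnj2)
  qed
next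
  assume sym: "symmetric_form XF YF YG ZF"
  show "symmetric_wrt (D_op s a \<alpha> t\<^sub>0) W"
    unfolding symmetric_wrt_def vec_eq_iff mp_inner_form Let_def D_op_nth
    by (simp add: sym[unfolded symmetric_form_def] map_poly_cnj_T map_poly_cnj_diff map_poly_cnj_add
        map_poly_cnj_Bp)
qed

end


section \<open>The set of weight matrices\<close>

lemma linear_functional_Z: "linear_functional (laguerre_fun \<alpha>)"
  by (rule linear_functional_laguerre) (use params in simp)

lemmas lin_Z = linear_functionalD[OF linear_functional_Z]

abbreviation (input) "mass \<equiv> map_matrix complex_of_real (M_mass s a \<alpha> t\<^sub>0)"

lemma mass_nth:
  "mass $ 1 $ 1 = (cpsi + ca * (ct - 1))\<^sup>2" "mass $ 1 $ 2 = cpsi + ca * (ct - 1)"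
  "mass $ 2 $ 1 = cpsi + ca * (ct - 1)" "mass $ 2 $ 2 = 1"
  by (simp_all add: map_matrix_def M_mass_def Let_def coefficient_identities(3))

text \<open>The moment functionals of \<open>c W + d \<delta> M\<close>, before and after the conjugation.\<close>

lemma forms_iff:
  assumes W: "moment_measure W"
  shows "(\<forall>k l p. moment_fun W k l p = c * laguerre_fun \<alpha> (wpoly ca k l * p) + d * (mass $ k $ l * poly p ct)) \<longleftrightarrow>
    (\<forall>r. XF W r = c * laguerre_fun \<alpha> (polyX * (polyX * r)) + d * (cpsi\<^sup>2 * poly r ct)) \<and>
    (\<forall>r. YF W r = d * (cpsi * poly r ct)) \<and> (\<forall>r. YG W r = d * (cpsi * poly r ct)) \<and>
    (\<forall>r. ZF W r = c * laguerre_fun \<alpha> r + d * poly r ct)"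
    (is "?L \<longleftrightarrow> ?R")
proof
  assume L: ?L
  note L' = L[rule_format]
  have w: "wpoly ca 1 1 = polyX * polyX + Bp * Bp" "wpoly ca 1 2 = Bp" "wpoly ca 2 1 = Bp" "wpoly ca 2 2 = 1"
    by (simp_all add: wpoly_def)
  have "XF W r = c * laguerre_fun \<alpha> (polyX * (polyX * r)) + d * (cpsi\<^sup>2 * poly r ct)" for r
    unfolding XF_def[OF W] L' w mass_nth distrib_right mult.assoc lin_Z mult_1 poly_mult poly_bpoly by algebra
  moreover have "YF W r = d * (cpsi * poly r ct)" "YG W r = d * (cpsi * poly r ct)" for r
    unfolding YF_def[OF W] YG_def[OF W] L' w mass_nth mult_1 poly_mult poly_bpoly by algebra+
  moreover have "ZF W r = c * laguerre_fun \<alpha> r + d * poly r ct" for r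
    unfolding ZF_def[OF W] L' w mass_nth mult_1 ..
  ultimately show ?R
    by blast
next
  assume R: ?R
  note lins = linear_functionalD[OF linear_functional_moment_fun[OF W]]
  have w: "wpoly ca 1 1 = polyX * polyX + Bp * Bp" "wpoly ca 1 2 = Bp" "wpoly ca 2 1 = Bp" "wpoly ca 2 2 = 1"
    by (simp_all add: wpoly_def)
  have 22: "moment_fun W 2 2 p = c * laguerre_fun \<alpha> p + d * poly p ct" for p
    using R by (simp add: ZF_def[OF W])
  have 12: "moment_fun W 1 2 p = d * (cpsi * poly p ct) + moment_fun W 2 2 (Bp * p)" for p
    using R by (simp add: YF_def[OF W] diff_eq_eq)
  have 21: "moment_fun W 2 1 p = d * (cpsi * poly p ct) + moment_fun W 2 2 (Bp * p)" for p
    using R by (simp add: YG_def[OF W] diff_eq_eq)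
  have 11: "moment_fun W 1 1 p = c * laguerre_fun \<alpha> (polyX * (polyX * p)) + d * (cpsi\<^sup>2 * poly p ct)
      + moment_fun W 1 2 (Bp * p) + moment_fun W 2 1 (Bp * p) - moment_fun W 2 2 (Bp * (Bp * p))" for p
  proof -
    have "moment_fun W 1 1 p - moment_fun W 1 2 (Bp * p) - moment_fun W 2 1 (Bp * p) + moment_fun W 2 2 (Bp * (Bp * p))
      = c * laguerre_fun \<alpha> (polyX * (polyX * p)) + d * (cpsi\<^sup>2 * poly p ct)"
      using R unfolding XF_def[OF W] by blast
    then show ?thesis
      by algebra
  qed
  show ?L
  proof (intro allI)
    fix k l :: 2 and p :: "complex poly"
    consider "k = 1" "l = 1" | "k = 1" "l = 2" | "k = 2" "l = 1" | "k = 2" "l = 2"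
      using exhaust_2[of k] exhaust_2[of l] by blast
    then show "moment_fun W k l p = c * laguerre_fun \<alpha> (wpoly ca k l * p) + d * (mass $ k $ l * poly p ct)"
    proof cases
      case 1
      show ?thesis
        unfolding 1 11 12 21 22 w mass_nth distrib_right mult.assoc lin_Z poly_mult poly_bpoly by algebra
    next
      case 2
      show ?thesis
        unfolding 2 12 22 w mass_nth poly_mult poly_bpoly by algebra
    next
      case 3
      show ?thesis
        unfolding 3 21 22 w mass_nth poly_mult poly_bpoly by algebra
    next
      case 4
      show ?thesis
        unfolding 4 22 w mass_nth by simp
    qed
  qed
qed

lemma symmetric_form_combination:
  "symmetric_form (\<lambda>r. c * laguerre_fun \<alpha> (polyX * (polyX * r)) + d * (cpsi\<^sup>2 * poly r ct))
    (\<lambda>r. d * (cpsi * poly r ct)) (\<lambda>r. d * (cpsi * poly r ct)) (\<lambda>r. c * laguerre_fun \<alpha> r + d * poly r ct)"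
  unfolding symmetric_form_def
proof (intro allI)
  fix u1 u2 v1 v2
  have "pearson (cal + 1) (laguerre_fun \<alpha>)"
    by (rule pearson_laguerre) (use params in simp)
  note w = symmetric_form_weight[OF linear_functional_Z this, unfolded symmetric_form_def, rule_format,
      of u1 u2 v1 v2]
  note m = symmetric_form_point[unfolded symmetric_form_def, rule_format, of u1 u2 v1 v2]
  have aux: "c * x1 + d * m1 + d * m2 + d * m3 + (c * x4 + d * m4) = c * y1 + d * n1 + d * n2 + d * n3 + (c * y4 + d * n4)"
    if "x1 + 0 + 0 + x4 = y1 + 0 + 0 + y4" "m1 + m2 + m3 + m4 = n1 + n2 + n3 + n4"
    for x1 x4 y1 y4 m1 m2 m3 m4 n1 n2 n3 n4 :: complex
    using that by algebra
  show "c * laguerre_fun \<alpha> (polyX * (polyX * (T1 u1 u2 * v1))) + d * (cpsi\<^sup>2 * poly (T1 u1 u2 * v1) ct) +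
       d * (cpsi * poly (T1 u1 u2 * v2) ct) + d * (cpsi * poly (T2 u1 u2 * v1) ct) +
       (c * laguerre_fun \<alpha> (T2 u1 u2 * v2) + d * poly (T2 u1 u2 * v2) ct) =
       c * laguerre_fun \<alpha> (polyX * (polyX * (u1 * T1 v1 v2))) + d * (cpsi\<^sup>2 * poly (u1 * T1 v1 v2) ct) +
       d * (cpsi * poly (u1 * T2 v1 v2) ct) + d * (cpsi * poly (u2 * T1 v1 v2) ct) +
       (c * laguerre_fun \<alpha> (u2 * T2 v1 v2) + d * poly (u2 * T2 v1 v2) ct)"
    by (rule aux[OF w m])
qed

abbreviation (input) "weight \<equiv> density_mm (weight_density a \<alpha>)"

text \<open>The matrices of measures that are claimed to make up \<open>\<Upsilon>(D)\<close>.\<close>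

definition candidate :: "real \<Rightarrow> real \<Rightarrow> real set \<Rightarrow> complex^2^2" where
  "candidate \<gamma> \<zeta> = (\<lambda>A. \<gamma> *\<^sub>R weight A + \<zeta> *\<^sub>R dirac_mm t\<^sub>0 mass A)"

lemma candidate_moments:
  assumes "0 \<le> \<gamma>" "0 \<le> \<zeta>"
  shows "moment_measure (candidate \<gamma> \<zeta>)"
    and "moment_fun (candidate \<gamma> \<zeta>) k l p
      = of_real \<gamma> * laguerre_fun \<alpha> (wpoly ca k l * p) + of_real \<zeta> * (mass $ k $ l * poly p ct)"
    and "integrable (qmeasure (candidate \<gamma> \<zeta>) v) (\<lambda>t. exp (1 / 2 * \<bar>t\<bar>))"
proof -
  note w = moment_measure_weight[OF params(2), of a]
  note m = moment_measure_dirac[OF psd_mass[of s a \<alpha> t\<^sub>0], of t\<^sub>0]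
  show "moment_measure (candidate \<gamma> \<zeta>)"
    unfolding candidate_def by (rule moment_measure_combination(1)[OF w m assms])
  show "moment_fun (candidate \<gamma> \<zeta>) k l p
      = of_real \<gamma> * laguerre_fun \<alpha> (wpoly ca k l * p) + of_real \<zeta> * (mass $ k $ l * poly p ct)"
    unfolding candidate_def moment_measure_combination(2)[OF w m assms] moment_fun_weight[OF params(2)]
      moment_fun_dirac[OF psd_mass] ..
  have "(\<lambda>t::real. exp (1 / 2 * \<bar>t\<bar>)) \<in> borel_measurable borel"
    by measurable
  then show "integrable (qmeasure (candidate \<gamma> \<zeta>) v) (\<lambda>t. exp (1 / 2 * \<bar>t\<bar>))"
    unfolding candidate_def using w m assms
    by (intro integrable_qmeasure_combination exp_integrable_weight integrable_qmeasure_dirac psd_mass params(2))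
      (simp_all add: moment_measure_def)
qed

lemma candidate_forms:
  assumes "0 \<le> \<gamma>" "0 \<le> \<zeta>"
  shows "XF (candidate \<gamma> \<zeta>) r = of_real \<gamma> * laguerre_fun \<alpha> (polyX * (polyX * r)) + of_real \<zeta> * (cpsi\<^sup>2 * poly r ct)"
    "YF (candidate \<gamma> \<zeta>) r = of_real \<zeta> * (cpsi * poly r ct)"
    "YG (candidate \<gamma> \<zeta>) r = of_real \<zeta> * (cpsi * poly r ct)"
    "ZF (candidate \<gamma> \<zeta>) r = of_real \<gamma> * laguerre_fun \<alpha> r + of_real \<zeta> * poly r ct"
  using forms_iff[OF candidate_moments(1)[OF assms], of "of_real \<gamma>" "of_real \<zeta>"] candidate_moments(2)[OF assms]
  by blast+

text \<open>
  Nondegeneracy: if \<open>x\<close> is in the kernel of \<open>\<integral> P dC P\<^sup>*\<close>, then the integral of the row \<open>r = x\<^sup>* P\<close>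
  against \<open>C\<close> is a sum of nonnegative terms that vanishes, whence \<open>r = 0\<close>, and the leading coefficient
  gives \<open>x = 0\<close>.
\<close>

lemma invertible_mp_inner_candidate:
  assumes "0 < \<gamma>" "0 \<le> \<zeta>" and lead: "invertible (mp_lead_coeff P)"
  shows "invertible (mp_inner P (candidate \<gamma> \<zeta>) P)"
proof -
  let ?C = "candidate \<gamma> \<zeta>"
  let ?G = "mp_inner P ?C P"
  have \<gamma>: "0 \<le> \<gamma>"
    using assms(1) by simp
  note C = candidate_moments(1)[OF \<gamma> assms(2)]
  note lins = linear_functionalD[OF linear_functional_moment_fun[OF C]]
  have "x = 0" if x: "?G *v x = 0" for x
  proof -
    define r where "r k = smult (cnj (x $ 1)) (P $ 1 $ k) + smult (cnj (x $ 2)) (P $ 2 $ k)" for k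
    have cnj_r: "map_poly cnj (r k) = smult (x $ 1) (map_poly cnj (P $ 1 $ k)) + smult (x $ 2) (map_poly cnj (P $ 2 $ k))" for k
      by (simp add: r_def poly_eq_poly_eq_iff[symmetric] fun_eq_iff)
    have "(\<Sum>k\<in>UNIV. \<Sum>l\<in>UNIV. moment_fun ?C k l (r k * map_poly cnj (r l)))
        = cnj (x $ 1) * (?G *v x) $ 1 + cnj (x $ 2) * (?G *v x) $ 2"
      unfolding cnj_r unfolding r_def
      by (simp add: matrix_vector_mult_def sum_2 mp_inner_moment_fun distrib_left distrib_right lins algebra_simps)
    then have zero: "(\<Sum>k\<in>UNIV. \<Sum>l\<in>UNIV. moment_fun ?C k l (r k * map_poly cnj (r l))) = 0"
      by (simp add: x)
    define u where "u = Bp * r 1 + r 2"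
    have cnj_u: "Bp * map_poly cnj (r 1) + map_poly cnj (r 2) = map_poly cnj u"
      by (simp add: u_def poly_eq_poly_eq_iff[symmetric] fun_eq_iff)
    have "(\<Sum>k\<in>UNIV. \<Sum>l\<in>UNIV. moment_fun ?C k l (r k * map_poly cnj (r l)))
        = of_real \<gamma> * (laguerre_fun \<alpha> ((polyX * r 1) * map_poly cnj (polyX * r 1)) + laguerre_fun \<alpha> (u * map_poly cnj u))
          + of_real (\<zeta> * (cmod (cpsi * poly (r 1) ct + poly u ct))\<^sup>2)"
    proof -
      have XX: "(polyX * r 1) * map_poly cnj (polyX * r 1) = polyX * (polyX * (r 1 * map_poly cnj (r 1)))"
        by (simp add: poly_eq_poly_eq_iff[symmetric] fun_eq_iff)
      have sq: "of_real ((cmod (cpsi * poly (r 1) ct + poly u ct))\<^sup>2)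
          = (cpsi * poly (r 1) ct + poly u ct) * (cpsi * cnj (poly (r 1) ct) + cnj (poly u ct))"
        unfolding complex_norm_square by simp
      show ?thesis
        unfolding conjugate_form[OF C, of r "\<lambda>l. map_poly cnj (r l)"] cnj_u u_def[symmetric]
          candidate_forms[OF \<gamma> assms(2)] XX of_real_mult sq
        by (simp add: power2_eq_square algebra_simps)
    qed
    with zero have "0 = Re (of_real \<gamma> * (laguerre_fun \<alpha> ((polyX * r 1) * map_poly cnj (polyX * r 1))
        + laguerre_fun \<alpha> (u * map_poly cnj u)) + of_real (\<zeta> * (cmod (cpsi * poly (r 1) ct + poly u ct))\<^sup>2))"
      by simp
    also have "\<dots> = \<gamma> * Re (laguerre_fun \<alpha> ((polyX * r 1) * map_poly cnj (polyX * r 1)))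
        + \<gamma> * Re (laguerre_fun \<alpha> (u * map_poly cnj u)) + \<zeta> * (cmod (cpsi * poly (r 1) ct + poly u ct))\<^sup>2"
    proof -
      have "Re (of_real g * (A + B) + of_real e) = g * Re A + g * Re B + e" for g e A B
        by (simp add: distrib_left)
      then show ?thesis .
    qed
    finally have sum0: "0 = \<gamma> * Re (laguerre_fun \<alpha> ((polyX * r 1) * map_poly cnj (polyX * r 1)))
        + \<gamma> * Re (laguerre_fun \<alpha> (u * map_poly cnj u)) + \<zeta> * (cmod (cpsi * poly (r 1) ct + poly u ct))\<^sup>2" .
    have "0 \<le> \<gamma> * Re (laguerre_fun \<alpha> ((polyX * r 1) * map_poly cnj (polyX * r 1)))"
      "0 \<le> \<gamma> * Re (laguerre_fun \<alpha> (u * map_poly cnj u))" "0 \<le> \<zeta> * (cmod (cpsi * poly (r 1) ct + poly u ct))\<^sup>2"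
      using \<gamma> assms(2) laguerre_fun_square_nonneg[of \<alpha> "polyX * r 1"] laguerre_fun_square_nonneg[of \<alpha> u]
      by (intro mult_nonneg_nonneg; simp)+
    with sum0 have "\<gamma> * Re (laguerre_fun \<alpha> ((polyX * r 1) * map_poly cnj (polyX * r 1))) = 0"
      "\<gamma> * Re (laguerre_fun \<alpha> (u * map_poly cnj u)) = 0"
      by linarith+
    then have "Re (laguerre_fun \<alpha> ((polyX * r 1) * map_poly cnj (polyX * r 1))) = 0"
      "Re (laguerre_fun \<alpha> (u * map_poly cnj u)) = 0"
      using assms(1) by simp_all
    then have "polyX * r 1 = 0" "u = 0"
      using laguerre_fun_square_eq_0[OF params(2)] by blast+
    then have "r 1 = 0" "r 2 = 0"
      by (auto simp: u_def polyX_def)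
    then have r0: "r k = 0" for k
      using exhaust_2[of k] by auto
    define y where "y = (\<chi> i. cnj (x $ i))"
    have "y v* mp_lead_coeff P = 0"
    proof -
      have "(y v* mp_lead_coeff P) $ k = coeff (r k) (mp_degree P)" for k
        by (simp add: vector_matrix_mult_def y_def mp_lead_coeff_def map_matrix_def sum_2 r_def mult.commute)
      then show ?thesis
        by (simp add: vec_eq_iff r0)
    qed
    moreover obtain B where B: "mp_lead_coeff P ** B = mat 1"
      using lead by (auto simp: invertible_def)
    ultimately have "y = 0"
      by (metis vector_matrix_mul_assoc vector_matrix_mul_rid vector_matrix_mult_0)
    then show "x = 0"
      by (simp add: y_def vec_eq_iff)
  qed
  then obtain B where "B ** ?G = mat 1"
    using matrix_left_invertible_ker[of ?G] by blast
  then show ?thesis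
    using matrix_left_right_inverse by (auto simp: invertible_def)
qed

lemma candidate_in_Upsilon:
  assumes "0 < \<gamma>" "0 \<le> \<zeta>"
  shows "candidate \<gamma> \<zeta> \<in> Upsilon (D_op s a \<alpha> t\<^sub>0)"
proof -
  have \<gamma>: "0 \<le> \<gamma>"
    using assms(1) by simp
  note C = candidate_moments(1)[OF \<gamma> assms(2)]
  have "cmeas_integrable (\<lambda>A. candidate \<gamma> \<zeta> A $ i $ j) (\<lambda>t. complex_of_real t ^ n)" for n i j
    by (rule cmeas_integral_qmeasure(1)) (use C in \<open>simp_all add: moment_measure_def\<close>)
  then have "weight_matrix (candidate \<gamma> \<zeta>)"
    using C invertible_mp_inner_candidate[OF assms]
    by (simp add: weight_matrix_def moment_measure_def psd_measure_def)
  moreover have "symmetric_wrt (D_op s a \<alpha> t\<^sub>0) (candidate \<gamma> \<zeta>)"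
  proof -
    note forms = ext[of "XF (candidate \<gamma> \<zeta>)", OF candidate_forms(1)[OF \<gamma> assms(2)]]
      ext[of "YF (candidate \<gamma> \<zeta>)", OF candidate_forms(2)[OF \<gamma> assms(2)]]
      ext[of "YG (candidate \<gamma> \<zeta>)", OF candidate_forms(3)[OF \<gamma> assms(2)]]
      ext[of "ZF (candidate \<gamma> \<zeta>)", OF candidate_forms(4)[OF \<gamma> assms(2)]]
    show ?thesis
      unfolding symmetric_wrt_iff[OF C] forms by (rule symmetric_form_combination)
  qed
  ultimately show ?thesis
    by (simp add: Upsilon_def)
qed

lemma laguerre_moments:
  "laguerre_fun \<alpha> polyX = (cal + 1) * laguerre_fun \<alpha> 1"
  "laguerre_fun \<alpha> (polyX * polyX) = (cal + 2) * (cal + 1) * laguerre_fun \<alpha> 1"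
proof -
  have p: "laguerre_fun \<alpha> (polyX * pderiv r) + (cal + 1) * laguerre_fun \<alpha> r - laguerre_fun \<alpha> (polyX * r) = 0" for r
    using pearson_laguerre[OF params(2)] by (simp add: pearson_def)
  show 1: "laguerre_fun \<alpha> polyX = (cal + 1) * laguerre_fun \<alpha> 1"
    using p[of 1] by (simp add: lin_Z)
  have "pderiv polyX = 1"
    by (simp add: polyX_def pderiv_pCons)
  then show "laguerre_fun \<alpha> (polyX * polyX) = (cal + 2) * (cal + 1) * laguerre_fun \<alpha> 1"
    using p[of polyX] 1 by (simp add: algebra_simps)
qed

text \<open>
  The moments of a weight matrix in \<open>\<Upsilon>(D)\<close> are those of \<open>c W + d \<delta> M\<close>.  The coefficients are
  real because the moments of the entry \<open>(2, 2)\<close> are.  The nonnegative integral of \<open>(t - t\<^sub>0)\<^sup>2\<close> against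
  that entry does not see the point mass, whence \<open>c \<ge> 0\<close>, and \<open>c = 0\<close> is excluded by nondegeneracy.
\<close>

lemma Upsilon_moments:
  assumes W: "weight_matrix W" and sym: "symmetric_wrt (D_op s a \<alpha> t\<^sub>0) W"
  obtains \<gamma> \<zeta> :: real where "0 < \<gamma>"
    "\<And>k l p. moment_fun W k l p
      = of_real \<gamma> * laguerre_fun \<alpha> (wpoly ca k l * p) + of_real \<zeta> * (mass $ k $ l * poly p ct)"
proof -
  note mm = weight_matrix_moment_measure[OF W]
  let ?z = "Gamma (\<alpha> + 1)"
  note z = laguerre_fun_1[OF params(2)]
  have "pearson (cal + 1) (laguerre_fun \<alpha>)"
    by (rule pearson_laguerre[OF params(2)])
  moreover have "laguerre_fun \<alpha> 1 \<noteq> 0"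
    using z by simp
  moreover have "symmetric_form (XF W) (YF W) (YG W) (ZF W)"
    using sym symmetric_wrt_iff[OF mm] by simp
  ultimately obtain c d where "\<And>r. XF W r = c * laguerre_fun \<alpha> (polyX * (polyX * r)) + d * (cpsi\<^sup>2 * poly r ct)"
    "\<And>r. YF W r = d * (cpsi * poly r ct)" "\<And>r. YG W r = d * (cpsi * poly r ct)"
    "\<And>r. ZF W r = c * laguerre_fun \<alpha> r + d * poly r ct"
    using symmetric_form_unique[OF linear_forms[OF mm] _ linear_functional_Z] by metis
  then have L: "moment_fun W k l p = c * laguerre_fun \<alpha> (wpoly ca k l * p) + d * (mass $ k $ l * poly p ct)" for k l p
    using forms_iff[OF mm, of c d] by blast
  have L22: "moment_fun W 2 2 p = c * laguerre_fun \<alpha> p + d * poly p ct" for p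
    using L[of 2 2 p] by (simp add: wpoly_def M_mass_def Let_def)
  let ?m = "qmeasure W (axis 2 1)"
  have int22: "moment_fun W 2 2 p = integral\<^sup>L ?m (\<lambda>t. poly p (of_real t))" for p
    by (simp add: integral_poly_qmeasure[OF mm] sum_2 axis_def)
  have real: "Im (moment_fun W 2 2 p) = 0" if "\<And>t. Im (poly p (complex_of_real t)) = 0" for p
  proof -
    have "poly p (complex_of_real t) = of_real (Re (poly p (complex_of_real t)))" for t
      using that by (simp add: complex_eq_iff)
    then have "moment_fun W 2 2 p = of_real (\<integral>t. Re (poly p (complex_of_real t)) \<partial>?m)"
      unfolding int22 by (metis (no_types, lifting) Bochner_Integration.integral_cong integral_complex_of_real)
    then show ?thesis
      by simp
  qed
  have im: "Im c * ?z + Im d = 0" "Im c * ((\<alpha> + 1) * ?z) + Im d * t\<^sub>0 = 0"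
      "Im c * ((\<alpha> + 2) * (\<alpha> + 1) * ?z) + Im d * (t\<^sub>0 * t\<^sub>0) = 0"
    using real[of 1] real[of polyX] real[of "polyX * polyX"]
    by (simp_all add: L22 laguerre_moments z(1))
  have "Im c = 0"
  proof (rule ccontr)
    assume ne: "Im c \<noteq> 0"
    have "Im c * ?z * (\<alpha> + 1 - t\<^sub>0) = 0"
      using im by algebra
    then have t: "t\<^sub>0 = \<alpha> + 1"
      using ne z(2) by simp
    have "Im c * ?z * (\<alpha> + 1) = 0"
      using im unfolding t by algebra
    then show False
      using ne z(2) params(2) by simp
  qed
  moreover from this im(1) have "Im d = 0"
    by simp
  ultimately have cd: "c = of_real (Re c)" "d = of_real (Re d)"
    by (simp_all add: complex_eq_iff)
  define q where "q = polyX * polyX - smult (2 * ct) polyX + smult (ct * ct) 1"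
  have q_poly: "poly q x = (x - ct) * (x - ct)" for x
    by (simp add: q_def algebra_simps)
  have "Re (moment_fun W 2 2 q) = (\<integral>t. (t - t\<^sub>0) * (t - t\<^sub>0) \<partial>?m)"
    unfolding int22 q_poly by (simp flip: of_real_diff of_real_mult)
  moreover have "0 \<le> (\<integral>t. (t - t\<^sub>0) * (t - t\<^sub>0) \<partial>?m)"
    by (intro integral_nonneg_AE) simp
  moreover have "laguerre_fun \<alpha> q = of_real (?z * ((t\<^sub>0 - \<alpha> - 1)\<^sup>2 + (\<alpha> + 1)))"
    unfolding q_def lin_Z laguerre_moments z(1) by (simp add: power2_eq_square algebra_simps)
  then have "Re (moment_fun W 2 2 q) = Re c * (?z * ((t\<^sub>0 - \<alpha> - 1)\<^sup>2 + (\<alpha> + 1)))"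
    unfolding L22 q_poly by (simp del: of_real_mult)
  ultimately have "0 \<le> Re c * (?z * ((t\<^sub>0 - \<alpha> - 1)\<^sup>2 + (\<alpha> + 1)))"
    by simp
  moreover have "0 < ?z * ((t\<^sub>0 - \<alpha> - 1)\<^sup>2 + (\<alpha> + 1))"
  proof -
    have "0 < \<alpha> + 1"
      using params(2) by simp
    then have "0 < (t\<^sub>0 - \<alpha> - 1)\<^sup>2 + (\<alpha> + 1)"
      by (rule add_nonneg_pos[OF zero_le_power2])
    with z(2) show ?thesis
      by (rule mult_pos_pos)
  qed
  ultimately have nonneg: "0 \<le> Re c"
    by (simp add: zero_le_mult_iff)
  have "Re c \<noteq> 0"
  proof
    assume "Re c = 0"
    then have c: "c = 0"
      using cd(1) by simp
    \<comment> \<open>A multiple of the point mass at \<open>t\<^sub>0\<close> is degenerate at \<open>(t - t\<^sub>0) I\<close>.\<close>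
    define P :: "2 matpoly" where "P = (\<chi> i j. if i = j then [:- ct, 1:] else 0)"
    have "mp_inner P W P = 0"
    proof -
      have "mp_inner P W P $ i $ j = 0" for i j
        unfolding mp_inner_moment_fun L c by (intro sum.neutral ballI) (simp add: P_def)
      then show ?thesis
        by (simp add: vec_eq_iff)
    qed
    moreover have "mp_lead_coeff P = mat 1"
    proof -
      have "{degree (P $ i $ j) |i j. True} = {1, 0}"
      proof (intro equalityI subsetI)
        fix n
        assume "n \<in> {degree (P $ i $ j) |i j. True}"
        then show "n \<in> {1, 0}"
          by (auto simp: P_def split: if_splits)
      next
        fix n :: nat
        assume "n \<in> {1, 0}"
        moreover have "degree (P $ 1 $ 1) = 1" "degree (P $ 1 $ 2) = 0"
          by (simp_all add: P_def)
        ultimately show "n \<in> {degree (P $ i $ j) |i j. True}"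
          by (metis (mono_tags, lifting) empty_iff insert_iff mem_Collect_eq)
      qed
      then have "mp_degree P = 1"
        by (simp add: mp_degree_def)
      then show ?thesis
        by (simp add: mp_lead_coeff_def map_matrix_def P_def mat_def vec_eq_iff)
    qed
    moreover have "invertible (mat 1 :: complex^2^2)"
      by (simp add: invertible_def)
    ultimately have "invertible (0 :: complex^2^2)"
      using W by (metis weight_matrix_def)
    then obtain B :: "complex^2^2" where "0 ** B = mat 1"
      by (auto simp: invertible_def)
    moreover have "(0 ** B) $ 1 $ 1 = (0 :: complex)" "(mat 1 :: complex^2^2) $ 1 $ 1 = 1"
      by (simp_all add: matrix_matrix_mult_def mat_def)
    ultimately show False
      by simp
  qed
  then show thesis
    using that[of "Re c" "Re d"] nonneg L cd by simp
qed

lemma weight_singleton: "weight {x} = 0"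
proof -
  have "(\<integral>t. indicator {x} t *\<^sub>R weight_density a \<alpha> t \<partial>lborel) = 0"
  proof (rule integral_eq_zero_AE)
    show "AE t in lborel. indicator {x} t *\<^sub>R weight_density a \<alpha> t = 0"
      using AE_lborel_singleton[of x] by eventually_elim simp
  qed
  then show ?thesis
    by (simp add: density_mm_def set_lebesgue_integral_def)
qed

text \<open>
  The moments determine the weight matrix.  A negative \<open>\<zeta>\<close> is excluded by applying this to
  \<open>W + |\<zeta>| \<delta> M\<close>, which would have no mass at \<open>t\<^sub>0\<close>.
\<close>

lemma Upsilon_candidate:
  assumes W: "weight_matrix W" and sym: "symmetric_wrt (D_op s a \<alpha> t\<^sub>0) W"
  shows "\<exists>\<gamma> \<zeta>. W = candidate \<gamma> \<zeta> \<and> 0 < \<gamma> \<and> 0 \<le> \<zeta>"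
proof -
  note mm = weight_matrix_moment_measure[OF W]
  obtain \<gamma> \<zeta> where \<gamma>: "0 < \<gamma>"
    and L: "\<And>k l p. moment_fun W k l p
      = of_real \<gamma> * laguerre_fun \<alpha> (wpoly ca k l * p) + of_real \<zeta> * (mass $ k $ l * poly p ct)"
    using Upsilon_moments[OF W sym] by metis
  have \<gamma>': "0 \<le> \<gamma>"
    using \<gamma> by simp
  have "0 \<le> \<zeta>"
  proof (rule ccontr)
    assume "\<not> 0 \<le> \<zeta>"
    then have \<zeta>: "0 \<le> - \<zeta>" "\<zeta> < 0"
      by simp_all
    define V where "V = (\<lambda>A. 1 *\<^sub>R W A + (- \<zeta>) *\<^sub>R dirac_mm t\<^sub>0 mass A)"
    note m = moment_measure_dirac[OF psd_mass[of s a \<alpha> t\<^sub>0], of t\<^sub>0]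
    note comb = moment_measure_combination[OF mm m zero_le_one \<zeta>(1), folded V_def]
    have "V = candidate \<gamma> 0"
    proof (rule moment_measure_determinacy)
      show "moment_fun V k l p = moment_fun (candidate \<gamma> 0) k l p" for k l p
        unfolding comb(2) L moment_fun_dirac[OF psd_mass] candidate_moments(2)[OF \<gamma>' order_refl] by simp
      show "0 < (1 / 2 :: real)"
        by simp
    qed (use comb(1) candidate_moments(1,3)[OF \<gamma>' order_refl] in auto)
    then have "V {t\<^sub>0} $ 2 $ 2 = 0"
      by (simp add: candidate_def weight_singleton)
    then have "W {t\<^sub>0} $ 2 $ 2 = of_real \<zeta>"
      by (simp add: V_def dirac_mm_def M_mass_def Let_def) (simp add: scaleR_conv_of_real)
    moreover have "psd (W {t\<^sub>0})"
      using W by (simp add: weight_matrix_def)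
    then have "0 \<le> Re (qform (W {t\<^sub>0}) (axis 2 1))"
      by (simp add: psd_qform)
    then have "0 \<le> Re (W {t\<^sub>0} $ 2 $ 2)"
      by (simp add: qform_expand axis_def)
    ultimately show False
      using \<zeta>(2) by simp
  qed
  moreover have "W = candidate \<gamma> \<zeta>"
  proof (rule moment_measure_determinacy)
    show "moment_fun W k l p = moment_fun (candidate \<gamma> \<zeta>) k l p" for k l p
      unfolding L candidate_moments(2)[OF \<gamma>' \<open>0 \<le> \<zeta>\<close>] ..
    show "0 < (1 / 2 :: real)"
      by simp
  qed (use mm candidate_moments(1,3)[OF \<gamma>' \<open>0 \<le> \<zeta>\<close>] in auto)
  ultimately show ?thesis
    using \<gamma> by blast
qed

lemma Upsilon_eq_candidates: "Upsilon (D_op s a \<alpha> t\<^sub>0) = {candidate \<gamma> \<zeta> |\<gamma> \<zeta>. 0 < \<gamma> \<and> 0 \<le> \<zeta>}"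
  using candidate_in_Upsilon Upsilon_candidate unfolding Upsilon_def by blast

end

theorem mainTheorem4:
  fixes a \<alpha> t\<^sub>0 s :: real
  assumes "a \<noteq> 0" and "\<alpha> > -1" and "s \<in> {1, -1}"
  shows "Upsilon (D_op s a \<alpha> t\<^sub>0) =
    {(\<lambda>A. \<gamma> *\<^sub>R density_mm (\<lambda>t. indicator {0<..} t *\<^sub>R map_matrix complex_of_real (Wd a \<alpha> t)) A
          + \<zeta> *\<^sub>R dirac_mm t\<^sub>0 (map_matrix complex_of_real (M_mass s a \<alpha> t\<^sub>0)) A)
      | \<gamma> \<zeta> :: real. \<gamma> > 0 \<and> \<zeta> \<ge> 0}"
  unfolding Upsilon_eq_candidates[OF assms] candidate_def[OF assms] weight_density_def[abs_def] ..

end
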